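(* Let $\mathbb{K}$ be a commutative ring, let $\Phi:\mathsf{Mod}(\mathbb{K})\to\mathsf{Mod}(\mathbb{K})$ be a functor with $\Phi(0)=0$, and let $A$ be a $\mathbb{K}$-module. If $\Phi$ is a polynomial functor of degree $d$, then $$\lim^i\,\Phi\mathsf{R}_A=0\qquad\text{for all } i>d.$$
   Context: $\mathsf{Pres}(A)$ is the category whose objects are epimorphisms $p:F\twoheadrightarrow A$ with $F$ a free $\mathbb{K}$-module, and whose morphisms are homomorphisms $F\to F'$ over $A$. The relation functor $\mathsf{R}_A:\mathsf{Pres}(A)\to\mathsf{Mod}(\mathbb{K})$ is $\mathsf{R}_A(p)=\mathrm{Ker}(p)$, and $\Phi\mathsf{R}_A=\Phi\circ\mathsf{R}_A$. $\lim^i$ denotes the $i$-th right derived functor of the limit functor on functors $\mathsf{Pres}(A)\to\mathsf{Mod}(\mathbb{K})$. For a functor $\Phi$ with $\Phi(0)=0$, the $n$-th cross effect is $$\Phi(A_1|\dots|A_n)=\mathrm{Ker}\Big(\Phi\big(\bigoplus_{i=1}^nA_i\big)\to\bigoplus_{i=1}^n\Phi\big(\bigoplus_{j\neq i}A_j\big)\Big),$$ with maps induced by the canonical projections. $\Phi$ is polynomial (in the sense of Eilenberg–Mac Lane) of degree $\le d$ if its $(d+1)$-st cross effect vanishes identically; it has degree $d$ if $d\geq 0$ is the least such integer. *)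

theory Defs
  imports "HOL-Algebra.Module" "HOL-Algebra.AbelCoset" "HOL-Library.Equipollence" "HOL-Library.Countable_Set"
begin

section \<open>Categories and functors\<close>

text \<open>
  Morphisms do not carry their endpoints, so composition and the action of a functor on
  morphisms take the endpoints as arguments: \<open>cmp C x y z g f\<close> is the composite of
  \<open>f : x \<rightarrow> y\<close> and \<open>g : y \<rightarrow> z\<close>.
\<close>

record ('o, 'm) category =
  obj :: "'o set"
  arr :: "'o \<Rightarrow> 'o \<Rightarrow> 'm set"
  idn :: "'o \<Rightarrow> 'm"
  cmp :: "'o \<Rightarrow> 'o \<Rightarrow> 'o \<Rightarrow> 'm \<Rightarrow> 'm \<Rightarrow> 'm"

record ('o, 'm, 'p, 'n) func =
  onO :: "'o \<Rightarrow> 'p"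
  onA :: "'o \<Rightarrow> 'o \<Rightarrow> 'm \<Rightarrow> 'n"

definition is_functor ::
  "('o, 'm) category \<Rightarrow> ('p, 'n) category \<Rightarrow> ('o, 'm, 'p, 'n) func \<Rightarrow> bool" where
  "is_functor C D F \<longleftrightarrow>
     (\<forall>x \<in> obj C. onO F x \<in> obj D) \<and>
     (\<forall>x \<in> obj C. \<forall>y \<in> obj C. \<forall>f \<in> arr C x y. onA F x y f \<in> arr D (onO F x) (onO F y)) \<and>
     (\<forall>x \<in> obj C. onA F x x (idn C x) = idn D (onO F x)) \<and>
     (\<forall>x \<in> obj C. \<forall>y \<in> obj C. \<forall>z \<in> obj C. \<forall>f \<in> arr C x y. \<forall>g \<in> arr C y z.
        onA F x z (cmp C x y z g f) =
        cmp D (onO F x) (onO F y) (onO F z) (onA F y z g) (onA F x y f))"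

definition func_comp ::
  "('p, 'n, 'q, 'l) func \<Rightarrow> ('o, 'm, 'p, 'n) func \<Rightarrow> ('o, 'm, 'q, 'l) func" where
  "func_comp G F =
     \<lparr>onO = (\<lambda>x. onO G (onO F x)),
      onA = (\<lambda>x y f. onA G (onO F x) (onO F y) (onA F x y f))\<rparr>"

definition nat_trans ::
  "('o, 'm) category \<Rightarrow> ('p, 'n) category \<Rightarrow> ('o, 'm, 'p, 'n) func \<Rightarrow> ('o, 'm, 'p, 'n) func
     \<Rightarrow> ('o \<Rightarrow> 'n) set" where
  "nat_trans C D F G =
     {\<eta>. (\<forall>x \<in> obj C. \<eta> x \<in> arr D (onO F x) (onO G x)) \<and>
         (\<forall>x \<in> obj C. \<forall>y \<in> obj C. \<forall>f \<in> arr C x y.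
            cmp D (onO F x) (onO F y) (onO G y) (\<eta> y) (onA F x y f) =
            cmp D (onO F x) (onO G x) (onO G y) (onA G x y f) (\<eta> x))}"


section \<open>The category of modules\<close>

text \<open>Homomorphisms are extensional functions on the carrier, so that equality of morphisms
  is equality of functions.\<close>

definition mod_hom ::
  "('r, 'k) ring_scheme \<Rightarrow> ('r, 'v) module \<Rightarrow> ('r, 'w) module \<Rightarrow> ('v \<Rightarrow> 'w) set" where
  "mod_hom K M N =
     {f \<in> carrier M \<rightarrow>\<^sub>E carrier N.
        (\<forall>x \<in> carrier M. \<forall>y \<in> carrier M. f (x \<oplus>\<^bsub>M\<^esub> y) = f x \<oplus>\<^bsub>N\<^esub> f y) \<and>
        (\<forall>a \<in> carrier K. \<forall>x \<in> carrier M. f (a \<odot>\<^bsub>M\<^esub> x) = a \<odot>\<^bsub>N\<^esub> f x)}"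

text \<open>
  \<open>Mod_cat K S\<close> is the category of \<open>K\<close>-modules whose carrier belongs to the class \<open>S\<close> of
  sets. Two classes are used. \<open>small_sets T\<close> consists of the sets of cardinality less
  than that of \<open>T\<close>; when \<open>T\<close> has inaccessible cardinality these are, up to bijection, the
  elements of a Grothendieck universe, and \<open>Mod_cat K (small_sets T)\<close> is the category of modules
  in that universe. The class \<open>UNIV\<close> plays the role of a larger universe: the category
  of presentations is not small with respect to the first one, so higher limits
  are computed among functors with values in \<open>Mod_cat K UNIV\<close>. When \<open>T\<close> is uncountable, \<open>K\<close> is
  small and \<open>Pow T \<lesssim> (UNIV :: 'v set)\<close>, the second class contains a copy of the free module on
  every set of homomorphisms between small modules.

  The fields \<open>mult\<close> and \<open>one\<close> of the record type of modules, and the values of the operations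
  outside the carrier, are irrelevant; modules that differ only in these are distinct but
  isomorphic objects.
\<close>

definition Mod_cat :: "('r, 'k) ring_scheme \<Rightarrow> 'v set set \<Rightarrow> (('r, 'v) module, 'v \<Rightarrow> 'v) category" where
  "Mod_cat K S =
     \<lparr>obj = {M. module K M \<and> carrier M \<in> S},
      arr = mod_hom K,
      idn = (\<lambda>M. \<lambda>x \<in> carrier M. x),
      cmp = (\<lambda>L M N g f. compose (carrier L) g f)\<rparr>"

definition small_sets :: "'v set \<Rightarrow> 'v set set" where
  "small_sets T = {S. S \<prec> T}"

definition free_module :: "('r, 'k) ring_scheme \<Rightarrow> ('r, 'v) module \<Rightarrow> bool" where
  "free_module K F \<longleftrightarrow> module K F \<and>
     (\<exists>B \<subseteq> carrier F. \<forall>x \<in> carrier F.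
        \<exists>!a. a \<in> B \<rightarrow>\<^sub>E carrier K \<and> finite {b \<in> B. a b \<noteq> \<zero>\<^bsub>K\<^esub>} \<and>
             x = (\<Oplus>\<^bsub>F\<^esub>b \<in> {b \<in> B. a b \<noteq> \<zero>\<^bsub>K\<^esub>}. a b \<odot>\<^bsub>F\<^esub> b))"

definition zero_module :: "('r, 'v) module \<Rightarrow> bool" where
  "zero_module M \<longleftrightarrow> carrier M = {\<zero>\<^bsub>M\<^esub>}"

definition quotient_module :: "('r, 'v) module \<Rightarrow> 'v set \<Rightarrow> ('r, 'v set) module" where
  "quotient_module M N =
     \<lparr>carrier = a_rcosets\<^bsub>M\<^esub> N, mult = undefined, one = undefined,
      zero = N, add = (\<lambda>X Y. X <+>\<^bsub>M\<^esub> Y),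
      smult = (\<lambda>a X. \<Union>x \<in> X. N +>\<^bsub>M\<^esub> (a \<odot>\<^bsub>M\<^esub> x))\<rparr>"


section \<open>Presentations and the relation functor\<close>

definition Pres_cat ::
  "('r, 'k) ring_scheme \<Rightarrow> 'v set set \<Rightarrow> ('r, 'v) module
     \<Rightarrow> (('r, 'v) module \<times> ('v \<Rightarrow> 'v), 'v \<Rightarrow> 'v) category" where
  "Pres_cat K S A =
     \<lparr>obj = {(F, p). F \<in> obj (Mod_cat K S) \<and> free_module K F \<and>
                    p \<in> mod_hom K F A \<and> p ` carrier F = carrier A},
      arr = (\<lambda>(F, p) (F', p'). {g \<in> mod_hom K F F'. compose (carrier F) p' g = p}),
      idn = (\<lambda>(F, p). \<lambda>x \<in> carrier F. x),
      cmp = (\<lambda>(F, p) y z g f. compose (carrier F) g f)\<rparr>"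

definition rel_functor ::
  "('r, 'v) module
     \<Rightarrow> (('r, 'v) module \<times> ('v \<Rightarrow> 'v), 'v \<Rightarrow> 'v, ('r, 'v) module, 'v \<Rightarrow> 'v) func" where
  "rel_functor A =
     \<lparr>onO = (\<lambda>(F, p). F\<lparr>carrier := a_kernel F A p\<rparr>),
      onA = (\<lambda>(F, p) (F', p') g. restrict g (a_kernel F A p))\<rparr>"


section \<open>Cross effects and polynomial functors\<close>

text \<open>
  \<open>(S, \<pi>)\<close> is a direct sum of the finite family \<open>(M i)\<close>, \<open>i \<in> I\<close>, with canonical projections
  \<open>\<pi> i\<close>: the elements of \<open>S\<close> correspond to the tuples of elements of the \<open>M i\<close>. Direct sums
  are used up to isomorphism because the carrier of a module has to be a set of elements
  of \<open>'v\<close>, which excludes tuples.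
\<close>

definition is_direct_sum ::
  "('r, 'k) ring_scheme \<Rightarrow> 'i set \<Rightarrow> ('i \<Rightarrow> ('r, 'v) module) \<Rightarrow> ('r, 'v) module
     \<Rightarrow> ('i \<Rightarrow> 'v \<Rightarrow> 'v) \<Rightarrow> bool" where
  "is_direct_sum K I M S \<pi> \<longleftrightarrow> module K S \<and> (\<forall>i \<in> I. \<pi> i \<in> mod_hom K S (M i)) \<and>
     bij_betw (\<lambda>x. \<lambda>i \<in> I. \<pi> i x) (carrier S) (\<Pi>\<^sub>E i \<in> I. carrier (M i))"

text \<open>
  The \<open>n\<close>-th cross effect at a direct sum \<open>S\<close> of \<open>M 1, \<dots>, M n\<close>, where \<open>q i\<close> is the canonical
  projection of \<open>S\<close> onto the direct sum \<open>P i\<close> of the \<open>M j\<close> with \<open>j \<noteq> i\<close>. The kernel of the map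
  into the direct sum of the \<open>\<Phi> (P i)\<close> is the set of common zeros of the \<open>\<Phi> (q i)\<close>.
\<close>

definition cross_effect ::
  "(('r, 'v) module, 'v \<Rightarrow> 'v, ('r, 'v) module, 'v \<Rightarrow> 'v) func \<Rightarrow> nat
     \<Rightarrow> ('r, 'v) module \<Rightarrow> (nat \<Rightarrow> ('r, 'v) module) \<Rightarrow> (nat \<Rightarrow> 'v \<Rightarrow> 'v) \<Rightarrow> ('r, 'v) module" where
  "cross_effect \<Phi> n S P q =
     (onO \<Phi> S)\<lparr>carrier := {x \<in> carrier (onO \<Phi> S).
        \<forall>i \<in> {1..n}. onA \<Phi> S (P i) (q i) x = \<zero>\<^bsub>onO \<Phi> (P i)\<^esub>}\<rparr>"

definition cross_effect_vanishes ::
  "('r, 'k) ring_scheme \<Rightarrow> 'v set set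
     \<Rightarrow> (('r, 'v) module, 'v \<Rightarrow> 'v, ('r, 'v) module, 'v \<Rightarrow> 'v) func \<Rightarrow> nat \<Rightarrow> bool" where
  "cross_effect_vanishes K U \<Phi> n \<longleftrightarrow>
     (\<forall>M S \<pi> P \<rho> q.
        (\<forall>i \<in> {1..n}. M i \<in> obj (Mod_cat K U)) \<and>
        S \<in> obj (Mod_cat K U) \<and> is_direct_sum K {1..n} M S \<pi> \<and>
        (\<forall>i \<in> {1..n}. P i \<in> obj (Mod_cat K U) \<and> is_direct_sum K ({1..n} - {i}) M (P i) (\<rho> i) \<and>
           q i \<in> mod_hom K S (P i) \<and>
           (\<forall>j \<in> {1..n} - {i}. compose (carrier S) (\<rho> i j) (q i) = \<pi> j)) \<longrightarrow>
        zero_module (cross_effect \<Phi> n S P q))"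

definition polynomial_degree_le ::
  "('r, 'k) ring_scheme \<Rightarrow> 'v set set
     \<Rightarrow> (('r, 'v) module, 'v \<Rightarrow> 'v, ('r, 'v) module, 'v \<Rightarrow> 'v) func \<Rightarrow> nat \<Rightarrow> bool" where
  "polynomial_degree_le K U \<Phi> d \<longleftrightarrow> cross_effect_vanishes K U \<Phi> (d + 1)"

definition polynomial_of_degree ::
  "('r, 'k) ring_scheme \<Rightarrow> 'v set set
     \<Rightarrow> (('r, 'v) module, 'v \<Rightarrow> 'v, ('r, 'v) module, 'v \<Rightarrow> 'v) func \<Rightarrow> nat \<Rightarrow> bool" where
  "polynomial_of_degree K U \<Phi> d \<longleftrightarrow>
     polynomial_degree_le K U \<Phi> d \<and> (\<forall>e < d. \<not> polynomial_degree_le K U \<Phi> e)"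


section \<open>Limits and their right derived functors\<close>

definition lim_module ::
  "('o, 'm) category \<Rightarrow> ('o, 'm, ('r, 'v) module, 'v \<Rightarrow> 'v) func \<Rightarrow> ('r, 'o \<Rightarrow> 'v) module" where
  "lim_module C F =
     \<lparr>carrier = {s \<in> (\<Pi>\<^sub>E x \<in> obj C. carrier (onO F x)).
        \<forall>x \<in> obj C. \<forall>y \<in> obj C. \<forall>f \<in> arr C x y. onA F x y f (s x) = s y},
      mult = undefined, one = undefined,
      zero = (\<lambda>x \<in> obj C. \<zero>\<^bsub>onO F x\<^esub>),
      add = (\<lambda>s t. \<lambda>x \<in> obj C. s x \<oplus>\<^bsub>onO F x\<^esub> t x),
      smult = (\<lambda>a s. \<lambda>x \<in> obj C. a \<odot>\<^bsub>onO F x\<^esub> s x)\<rparr>"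

definition lim_map ::
  "('o, 'm) category \<Rightarrow> ('o \<Rightarrow> 'v \<Rightarrow> 'v) \<Rightarrow> ('o \<Rightarrow> 'v) \<Rightarrow> ('o \<Rightarrow> 'v)" where
  "lim_map C \<eta> s = (\<lambda>x \<in> obj C. \<eta> x (s x))"

text \<open>Monomorphisms, kernels and images in the category of functors \<open>C \<rightarrow> Mod_cat K UNIV\<close> are
  computed objectwise.\<close>

definition injective_functor ::
  "('r, 'k) ring_scheme \<Rightarrow> ('o, 'm) category
     \<Rightarrow> ('o, 'm, ('r, 'v) module, 'v \<Rightarrow> 'v) func \<Rightarrow> bool" where
  "injective_functor K C I \<longleftrightarrow> is_functor C (Mod_cat K UNIV) I \<and>
     (\<forall>X Y. is_functor C (Mod_cat K UNIV) X \<and> is_functor C (Mod_cat K UNIV) Y \<longrightarrow>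
        (\<forall>\<mu> \<in> nat_trans C (Mod_cat K UNIV) X Y. \<forall>\<xi> \<in> nat_trans C (Mod_cat K UNIV) X I.
           (\<forall>x \<in> obj C. inj_on (\<mu> x) (carrier (onO X x))) \<longrightarrow>
           (\<exists>\<zeta> \<in> nat_trans C (Mod_cat K UNIV) Y I.
              \<forall>x \<in> obj C. compose (carrier (onO X x)) (\<zeta> x) (\<mu> x) = \<xi> x)))"

definition injective_resolution ::
  "('r, 'k) ring_scheme \<Rightarrow> ('o, 'm) category
     \<Rightarrow> ('o, 'm, ('r, 'v) module, 'v \<Rightarrow> 'v) func
     \<Rightarrow> (nat \<Rightarrow> ('o, 'm, ('r, 'v) module, 'v \<Rightarrow> 'v) func)
     \<Rightarrow> ('o \<Rightarrow> 'v \<Rightarrow> 'v) \<Rightarrow> (nat \<Rightarrow> 'o \<Rightarrow> 'v \<Rightarrow> 'v) \<Rightarrow> bool" where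
  "injective_resolution K C F I \<epsilon> \<delta> \<longleftrightarrow>
     is_functor C (Mod_cat K UNIV) F \<and>
     (\<forall>n. injective_functor K C (I n)) \<and>
     \<epsilon> \<in> nat_trans C (Mod_cat K UNIV) F (I 0) \<and>
     (\<forall>n. \<delta> n \<in> nat_trans C (Mod_cat K UNIV) (I n) (I (Suc n))) \<and>
     (\<forall>x \<in> obj C.
        inj_on (\<epsilon> x) (carrier (onO F x)) \<and>
        \<epsilon> x ` carrier (onO F x) = a_kernel (onO (I 0) x) (onO (I 1) x) (\<delta> 0 x) \<and>
        (\<forall>n. \<delta> n x ` carrier (onO (I n) x) =
             a_kernel (onO (I (Suc n)) x) (onO (I (Suc (Suc n))) x) (\<delta> (Suc n) x)))"

definition cochain_cohomology ::
  "(nat \<Rightarrow> ('r, 'v) module) \<Rightarrow> (nat \<Rightarrow> 'v \<Rightarrow> 'v) \<Rightarrow> nat \<Rightarrow> ('r, 'v set) module" where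
  "cochain_cohomology L \<delta> i =
     quotient_module ((L i)\<lparr>carrier := a_kernel (L i) (L (Suc i)) (\<delta> i)\<rparr>)
       (case i of 0 \<Rightarrow> {\<zero>\<^bsub>L 0\<^esub>} | Suc j \<Rightarrow> \<delta> j ` carrier (L j))"

text \<open>
  \<open>is_higher_lim K C F i H\<close>: the module \<open>H\<close> is the \<open>i\<close>-th right derived functor of the limit at
  \<open>F\<close>, computed from some injective resolution of \<open>F\<close>. Different resolutions give isomorphic
  modules, so \<open>lim\<^sup>i F = 0\<close> says that every such \<open>H\<close> is zero.

  Let \<open>\<mu>\<close> be an infinite cardinal that bounds the ring and the sets of objects (up to isomorphism)
  and morphisms of \<open>C\<close>. If \<open>'v\<close> has cardinality \<open>2\<^sup>\<mu>\<close>, then every functor \<open>F\<close> has an injective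
  resolution, since the usual embedding of \<open>F\<close> into a product of coinduced functors
  can be formed within \<open>'v\<close>.
\<close>

definition is_higher_lim ::
  "('r, 'k) ring_scheme \<Rightarrow> ('o, 'm) category
     \<Rightarrow> ('o, 'm, ('r, 'v) module, 'v \<Rightarrow> 'v) func \<Rightarrow> nat \<Rightarrow> ('r, ('o \<Rightarrow> 'v) set) module \<Rightarrow> bool" where
  "is_higher_lim K C F i H \<longleftrightarrow>
     (\<exists>I \<epsilon> \<delta>. injective_resolution K C F I \<epsilon> \<delta> \<and>
        H = cochain_cohomology (\<lambda>n. lim_module C (I n)) (\<lambda>n. lim_map C (\<delta> n)) i)"

end

(*
Fix a presentation c of A. The coproduct E x of c and x is an endofunctor of the category of
presentations with natural maps eta : x -> E x and kappa : c -> E x, and for every functor G the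
objects E^n c give a complex G(c) -> G(E c) -> G(E^2 c) -> ... whose kernel in degree 0 is lim G.
If G is injective, then the objectwise split map G -> G o E has a natural retraction, and this
makes the complex exact in positive degrees. Comparing the two directions of the double complex
I_n(E^p c) shows that lim^i F is the i-th cohomology of F(E^* c).

For F = Phi R the relation module of E^k x carries k idempotents, each of which moves one copy of c
into x along a fixed map; they make that module a direct sum with k + 1 summands. If the cross
effect of order d + 1 vanishes, then F(E^(d+1) x) is generated by the images of the d + 1
inclusions of E^d x, and an induction on the number of copies of c gives exactness of F(E^* c)
in degrees above d.
*)

theory Submission
  imports Defs
begin

section \<open>Additive maps and subtraction in abelian groups\<close>

section \<open>Additive maps\<close>

text \<open>Injectivity enters only through the natural retraction, so a given resolution serves and
  no injective functor has to be built; a chase through the double complex replaces a spectral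
  sequence. The bound \<open>d\<close> comes from a count of degrees. The functor
  \<open>G \<circ> E\<close> modulo \<open>G\<close> is the difference functor of \<open>G\<close>,
  and a cocycle of \<open>G\<close> in degree \<open>n + 1\<close> is a cocycle of the difference
  functor in degree \<open>n\<close>. Each difference costs one degree, and the vanishing of the
  cross effect of order \<open>d + 1\<close> ends the differences after \<open>d + 1\<close> steps.
  The obstacle is that the evident decomposition of \<open>E^k x\<close> does not pass to relation
  modules: setting a copy of \<open>c\<close> to zero changes the map to \<open>A\<close>. Moving
  the copy along a map \<sigma> over \<open>A\<close> keeps that map, and what is split off is the
  twisted copy of all \<open>(a, - \<sigma> a)\<close>, which does lie in the relation module. Using
  a single \<sigma> for all copies makes the twisted copies independent of each other.\<close>

abbreviation ahom :: "('a, 'c) ring_scheme \<Rightarrow> ('b, 'e) ring_scheme \<Rightarrow> ('a \<Rightarrow> 'b) set" where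
  "ahom M N \<equiv> hom (add_monoid M) (add_monoid N)"

lemma ahom_iff:
  "f \<in> ahom M N \<longleftrightarrow> (\<forall>x \<in> carrier M. f x \<in> carrier N) \<and>
     (\<forall>x \<in> carrier M. \<forall>y \<in> carrier M. f (x \<oplus>\<^bsub>M\<^esub> y) = f x \<oplus>\<^bsub>N\<^esub> f y)"
  by (auto simp: hom_def)

lemma ahom_closed: "f \<in> ahom M N \<Longrightarrow> x \<in> carrier M \<Longrightarrow> f x \<in> carrier N"
  by (simp add: ahom_iff)

lemma ahom_add:
  "f \<in> ahom M N \<Longrightarrow> x \<in> carrier M \<Longrightarrow> y \<in> carrier M \<Longrightarrow> f (x \<oplus>\<^bsub>M\<^esub> y) = f x \<oplus>\<^bsub>N\<^esub> f y"
  by (simp add: ahom_iff)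

lemma (in abelian_group) minus_eq_iff:
  assumes "x \<in> carrier G" "y \<in> carrier G" "z \<in> carrier G"
  shows "x \<ominus> y = z \<longleftrightarrow> x = z \<oplus> y"
  using assms by (auto simp: a_minus_def a_assoc l_neg r_neg)

lemma (in abelian_group) minus_add_cancel:
  assumes "x \<in> carrier G" "y \<in> carrier G"
  shows "(x \<ominus> y) \<oplus> y = x"
  using assms by (simp add: a_minus_def a_assoc l_neg)

lemma (in abelian_group) minus_minus_cancel:
  assumes "x \<in> carrier G" "y \<in> carrier G"
  shows "x \<ominus> (x \<ominus> y) = y"
  using assms by (simp add: minus_eq_iff a_comm[of y] minus_add_cancel)

lemma (in abelian_group) minus_self [simp]: "x \<in> carrier G \<Longrightarrow> x \<ominus> x = \<zero>"
  by (simp add: a_minus_def r_neg)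

lemma (in abelian_group) minus_zero [simp]: "x \<in> carrier G \<Longrightarrow> x \<ominus> \<zero> = x"
  by (simp add: a_minus_def)

lemma (in abelian_group) minus_eq_zero:
  assumes "x \<in> carrier G" "y \<in> carrier G"
  shows "x \<ominus> y = \<zero> \<longleftrightarrow> x = y"
  using assms by (simp add: minus_eq_iff)

lemma (in abelian_group) add_minus_add:
  assumes "a \<in> carrier G" "b \<in> carrier G" "c \<in> carrier G" "e \<in> carrier G"
  shows "(a \<oplus> b) \<ominus> (c \<oplus> e) = (a \<ominus> c) \<oplus> (b \<ominus> e)"
  using assms by (simp add: a_minus_def minus_add a_ac)

text \<open>The cancellation in the inductive step of \<open>exact_mod_subfunctor\<close>, with
  \<open>p = bd n G z\<close>, \<open>q = bd m (shift G) z\<close> and \<open>r\<close> the image of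
  \<open>w\<close> under \<eta>.\<close>

lemma (in abelian_group) minus_add_exchange:
  assumes p: "p \<in> carrier G" and q: "q \<in> carrier G" and r: "r \<in> carrier G" and e: "e \<in> carrier G"
  shows "(q \<oplus> (r \<oplus> e)) \<ominus> ((p \<oplus> q) \<oplus> r) = e \<ominus> p"
proof -
  have "(e \<ominus> p) \<oplus> ((p \<oplus> q) \<oplus> r) = ((e \<ominus> p) \<oplus> p) \<oplus> (q \<oplus> r)"
    using assms by (simp add: a_assoc)
  also have "\<dots> = q \<oplus> (r \<oplus> e)"
    unfolding minus_add_cancel[OF e p] using assms by (simp add: a_ac)
  finally show ?thesis
    using assms by (simp add: minus_eq_iff)
qed

lemma ahom_zero:
  assumes "abelian_group M" "abelian_group N" "f \<in> ahom M N"
  shows "f \<zero>\<^bsub>M\<^esub> = \<zero>\<^bsub>N\<^esub>"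
proof -
  interpret M: abelian_group M by fact
  interpret N: abelian_group N by fact
  have "f \<zero>\<^bsub>M\<^esub> \<oplus>\<^bsub>N\<^esub> f \<zero>\<^bsub>M\<^esub> = f \<zero>\<^bsub>M\<^esub>"
    using ahom_add[OF assms(3), of "\<zero>\<^bsub>M\<^esub>" "\<zero>\<^bsub>M\<^esub>"] by simp
  then show ?thesis
    using ahom_closed[OF assms(3)] by (metis M.zero_closed N.add.r_cancel_one)
qed

lemma ahom_minus:
  assumes "abelian_group M" "abelian_group N" "f \<in> ahom M N"
    and "x \<in> carrier M" "y \<in> carrier M"
  shows "f (x \<ominus>\<^bsub>M\<^esub> y) = f x \<ominus>\<^bsub>N\<^esub> f y"
proof -
  interpret M: abelian_group M by fact
  interpret N: abelian_group N by fact
  have "f (x \<ominus>\<^bsub>M\<^esub> y) \<oplus>\<^bsub>N\<^esub> f y = f x"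
    using assms ahom_add[OF assms(3), of "x \<ominus>\<^bsub>M\<^esub> y" y] by (simp add: M.minus_add_cancel)
  then show ?thesis
    using assms(4,5) ahom_closed[OF assms(3)] by (metis M.minus_closed N.minus_eq_iff)
qed

lemma ahom_diff:
  assumes "abelian_group N" "f \<in> ahom M N" "g \<in> ahom M N"
  shows "(\<lambda>x. f x \<ominus>\<^bsub>N\<^esub> g x) \<in> ahom M N"
proof -
  interpret N: abelian_group N by fact
  show ?thesis
    using assms(2,3) by (auto simp: ahom_iff N.add_minus_add)
qed

text \<open>The differentials \<open>bd\<close> are differences of homomorphisms formed without
  restriction to the carrier, so they need not lie in \<open>mod_hom\<close>. Exactness arguments
  therefore use \<open>ahom\<close>, which ignores scalars and values off the carrier.\<close>

lemma mod_hom_ahom: "f \<in> mod_hom K M N \<Longrightarrow> f \<in> ahom M N"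
  by (auto simp: mod_hom_def ahom_iff)

lemma mod_hom_extensional: "f \<in> mod_hom K M N \<Longrightarrow> f \<in> extensional (carrier M)"
  by (simp add: mod_hom_def PiE_def)

lemma mod_hom_smult:
  "f \<in> mod_hom K M N \<Longrightarrow> a \<in> carrier K \<Longrightarrow> x \<in> carrier M \<Longrightarrow> f (a \<odot>\<^bsub>M\<^esub> x) = a \<odot>\<^bsub>N\<^esub> f x"
  by (simp add: mod_hom_def)

lemma mod_homI:
  assumes "f \<in> extensional (carrier M)" "\<And>x. x \<in> carrier M \<Longrightarrow> f x \<in> carrier N"
    "\<And>x y. x \<in> carrier M \<Longrightarrow> y \<in> carrier M \<Longrightarrow> f (x \<oplus>\<^bsub>M\<^esub> y) = f x \<oplus>\<^bsub>N\<^esub> f y"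
    "\<And>a x. a \<in> carrier K \<Longrightarrow> x \<in> carrier M \<Longrightarrow> f (a \<odot>\<^bsub>M\<^esub> x) = a \<odot>\<^bsub>N\<^esub> f x"
  shows "f \<in> mod_hom K M N"
  using assms by (auto simp: mod_hom_def PiE_def)

lemma mod_hom_closed: "f \<in> mod_hom K M N \<Longrightarrow> x \<in> carrier M \<Longrightarrow> f x \<in> carrier N"
  by (auto simp: mod_hom_def)

lemma mod_hom_add:
  "f \<in> mod_hom K M N \<Longrightarrow> x \<in> carrier M \<Longrightarrow> y \<in> carrier M \<Longrightarrow> f (x \<oplus>\<^bsub>M\<^esub> y) = f x \<oplus>\<^bsub>N\<^esub> f y"
  by (simp add: mod_hom_def)

lemma mod_hom_compose:
  assumes "module K M" "f \<in> mod_hom K M N" "g \<in> mod_hom K N L"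
  shows "compose (carrier M) g f \<in> mod_hom K M L"
proof -
  interpret M: module K M by fact
  show ?thesis
    using assms(2,3)
    by (intro mod_homI) (auto simp: compose_def mod_hom_closed mod_hom_add mod_hom_smult)
qed

lemma subgroup_minus:
  assumes "abelian_group G" "additive_subgroup H G" "x \<in> H" "y \<in> H"
  shows "x \<ominus>\<^bsub>G\<^esub> y \<in> H"
  using assms by (simp add: a_minus_def additive_subgroup.a_closed additive_subgroup.a_inv_closed)

lemma additive_subgroup_minusI:
  assumes "abelian_group G" "H \<subseteq> carrier G" "\<zero>\<^bsub>G\<^esub> \<in> H"
    "\<And>x y. x \<in> H \<Longrightarrow> y \<in> H \<Longrightarrow> x \<ominus>\<^bsub>G\<^esub> y \<in> H"
  shows "additive_subgroup H G"
proof -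
  interpret G: abelian_group G by fact
  have inv: "\<ominus>\<^bsub>G\<^esub> y \<in> H" if "y \<in> H" for y
    using assms(4)[OF assms(3) that] that assms(2) by (auto simp: a_minus_def)
  have "x \<oplus>\<^bsub>G\<^esub> y \<in> H" if "x \<in> H" "y \<in> H" for x y
    using assms(4)[OF that(1) inv[OF that(2)]] that assms(2) by (auto simp: a_minus_def subsetD)
  then show ?thesis
    using inv assms(2,3) by (auto intro!: additive_subgroup.intro subgroup.intro simp: a_inv_def)
qed

section \<open>The complex attached to a weakly initial object and the coproduct functor with
  it\<close>

section \<open>The cobar complex of a functor\<close>

text \<open>An abstract form of the category of presentations: \<open>E x\<close> plays the
  coproduct of \<open>c\<close> and \<open>x\<close>, with inclusions \<open>\<kappa> x\<close> and
  \<open>\<eta> x\<close>. \<open>copair\<close> is an existence statement with two uses: paired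
  with \<open>idn\<close> it splits \<open>\<eta> x\<close>, and it factors any two arrows out of
  \<open>c\<close> through the two inclusions of \<open>E c\<close>.\<close>

locale cone_category =
  fixes K :: "('r, 'k) ring_scheme"
    and C :: "('o, 'm) category"
    and E :: "('o, 'm, 'o, 'm) func"
    and \<eta> \<kappa> :: "'o \<Rightarrow> 'm"
    and c :: 'o
  assumes c_obj: "c \<in> obj C"
    and idn_arr: "x \<in> obj C \<Longrightarrow> idn C x \<in> arr C x x"
    and cmp_arr: "x \<in> obj C \<Longrightarrow> y \<in> obj C \<Longrightarrow> z \<in> obj C \<Longrightarrow> f \<in> arr C x y \<Longrightarrow> g \<in> arr C y z
      \<Longrightarrow> cmp C x y z g f \<in> arr C x z"
    and arr_nonempty: "x \<in> obj C \<Longrightarrow> \<exists>f. f \<in> arr C c x"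
    and E_functor: "is_functor C C E"
    and eta_arr: "x \<in> obj C \<Longrightarrow> \<eta> x \<in> arr C x (onO E x)"
    and kappa_arr: "x \<in> obj C \<Longrightarrow> \<kappa> x \<in> arr C c (onO E x)"
    and eta_natural: "x \<in> obj C \<Longrightarrow> y \<in> obj C \<Longrightarrow> f \<in> arr C x y \<Longrightarrow>
      cmp C x y (onO E y) (\<eta> y) f = cmp C x (onO E x) (onO E y) (onA E x y f) (\<eta> x)"
    and kappa_natural: "x \<in> obj C \<Longrightarrow> y \<in> obj C \<Longrightarrow> f \<in> arr C x y \<Longrightarrow>
      cmp C c (onO E x) (onO E y) (onA E x y f) (\<kappa> x) = \<kappa> y"
    and copair: "x \<in> obj C \<Longrightarrow> y \<in> obj C \<Longrightarrow> f \<in> arr C x y \<Longrightarrow> g \<in> arr C c y \<Longrightarrow>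
      \<exists>h \<in> arr C (onO E x) y. cmp C x (onO E x) y h (\<eta> x) = f \<and> cmp C c (onO E x) y h (\<kappa> x) = g"
begin

abbreviation fct :: "('o, 'm, ('r, 'v) module, 'v \<Rightarrow> 'v) func \<Rightarrow> bool" where
  "fct \<equiv> is_functor C (Mod_cat K UNIV)"

abbreviation nat_tr :: "('o, 'm, ('r, 'v) module, 'v \<Rightarrow> 'v) func
    \<Rightarrow> ('o, 'm, ('r, 'v) module, 'v \<Rightarrow> 'v) func \<Rightarrow> ('o \<Rightarrow> 'v \<Rightarrow> 'v) set" where
  "nat_tr \<equiv> nat_trans C (Mod_cat K UNIV)"

abbreviation shift :: "('o, 'm, 'p, 'n) func \<Rightarrow> ('o, 'm, 'p, 'n) func" where
  "shift G \<equiv> func_comp G E"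

text \<open>The power adds the new \<open>E\<close> on the outside, so
  \<open>onO (shift G) (ob n)\<close> simplifies to \<open>onO G (ob (Suc n))\<close>. This lets the
  recursions below trade a degree for a shift of the functor.\<close>

abbreviation ob :: "nat \<Rightarrow> 'o" where
  "ob n \<equiv> (onO E ^^ n) c"

lemma E_obj: "x \<in> obj C \<Longrightarrow> onO E x \<in> obj C"
  using E_functor by (simp add: is_functor_def)

lemma E_arr: "x \<in> obj C \<Longrightarrow> y \<in> obj C \<Longrightarrow> f \<in> arr C x y \<Longrightarrow> onA E x y f \<in> arr C (onO E x) (onO E y)"
  using E_functor by (simp add: is_functor_def)

lemma E_pow_obj: "x \<in> obj C \<Longrightarrow> (onO E ^^ n) x \<in> obj C"
  by (induction n) (auto intro: E_obj)

lemma ob_obj: "ob n \<in> obj C"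
  by (simp add: E_pow_obj c_obj)

lemma fct_group: "fct G \<Longrightarrow> x \<in> obj C \<Longrightarrow> abelian_group (onO G x)"
  by (auto simp: is_functor_def Mod_cat_def intro: module.axioms(2))

lemma fct_hom: "fct G \<Longrightarrow> x \<in> obj C \<Longrightarrow> y \<in> obj C \<Longrightarrow> f \<in> arr C x y
    \<Longrightarrow> onA G x y f \<in> mod_hom K (onO G x) (onO G y)"
  by (simp add: is_functor_def Mod_cat_def)

lemma fct_ahom: "fct G \<Longrightarrow> x \<in> obj C \<Longrightarrow> y \<in> obj C \<Longrightarrow> f \<in> arr C x y
    \<Longrightarrow> onA G x y f \<in> ahom (onO G x) (onO G y)"
  by (blast intro: mod_hom_ahom fct_hom)

lemma fct_closed: "fct G \<Longrightarrow> x \<in> obj C \<Longrightarrow> y \<in> obj C \<Longrightarrow> f \<in> arr C x y \<Longrightarrow> v \<in> carrier (onO G x)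
    \<Longrightarrow> onA G x y f v \<in> carrier (onO G y)"
  by (meson ahom_closed fct_ahom)

lemma fct_idn: "fct G \<Longrightarrow> x \<in> obj C \<Longrightarrow> v \<in> carrier (onO G x) \<Longrightarrow> onA G x x (idn C x) v = v"
  by (simp add: is_functor_def Mod_cat_def)

lemma fct_cmp: "fct G \<Longrightarrow> x \<in> obj C \<Longrightarrow> y \<in> obj C \<Longrightarrow> z \<in> obj C \<Longrightarrow> f \<in> arr C x y
    \<Longrightarrow> g \<in> arr C y z \<Longrightarrow> v \<in> carrier (onO G x)
    \<Longrightarrow> onA G x z (cmp C x y z g f) v = onA G y z g (onA G x y f v)"
  by (simp add: is_functor_def Mod_cat_def compose_def)

lemma fct_shift: "fct G \<Longrightarrow> fct (shift G)"
  using E_functor by (simp add: is_functor_def func_comp_def)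

lemma shift_simps [simp]:
  "onO (shift G) x = onO G (onO E x)"
  "onA (shift G) x y f = onA G (onO E x) (onO E y) (onA E x y f)"
  by (simp_all add: func_comp_def)

lemma nat_tr_ahom: "\<theta> \<in> nat_tr G H \<Longrightarrow> x \<in> obj C \<Longrightarrow> \<theta> x \<in> ahom (onO G x) (onO H x)"
  by (auto simp: nat_trans_def Mod_cat_def intro: mod_hom_ahom)

lemma nat_tr_app:
  assumes "\<theta> \<in> nat_tr G H" "x \<in> obj C" "y \<in> obj C" "f \<in> arr C x y" "v \<in> carrier (onO G x)"
  shows "\<theta> y (onA G x y f v) = onA H x y f (\<theta> x v)"
proof -
  have "compose (carrier (onO G x)) (\<theta> y) (onA G x y f) v = compose (carrier (onO G x)) (onA H x y f) (\<theta> x) v"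
    using assms by (simp add: nat_trans_def Mod_cat_def)
  then show ?thesis
    using assms(5) by (simp add: compose_def)
qed

lemma nat_tr_shift: "\<theta> \<in> nat_tr G H \<Longrightarrow> (\<lambda>x. \<theta> (onO E x)) \<in> nat_tr (shift G) (shift H)"
  by (auto simp: nat_trans_def E_obj E_arr)

lemma nat_tr_eta:
  assumes "fct G"
  shows "(\<lambda>x. onA G x (onO E x) (\<eta> x)) \<in> nat_tr G (shift G)"
proof -
  have *: "cmp (Mod_cat K UNIV) (onO G x) (onO G y) (onO G (onO E y)) (onA G y (onO E y) (\<eta> y)) (onA G x y f) =
      onA G x (onO E y) (cmp C x y (onO E y) (\<eta> y) f)"
    "cmp (Mod_cat K UNIV) (onO G x) (onO G (onO E x)) (onO G (onO E y)) (onA G (onO E x) (onO E y) (onA E x y f))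
        (onA G x (onO E x) (\<eta> x)) = onA G x (onO E y) (cmp C x (onO E x) (onO E y) (onA E x y f) (\<eta> x))"
    if "x \<in> obj C" "y \<in> obj C" "f \<in> arr C x y" for x y f
    using assms that by (simp_all add: is_functor_def E_obj E_arr eta_arr)
  show ?thesis
    using assms by (simp add: nat_trans_def * eta_natural) (simp add: Mod_cat_def fct_hom E_obj eta_arr)
qed

text \<open>Unfolded, this is the alternating sum of \<open>n + 2\<close> coface maps:
  \<open>(-1)^i\<close> times the value of \<open>G\<close> at \<open>E^i\<close> of
  \<open>\<eta> (ob (n - i))\<close> for \<open>i \<le> n\<close>, and \<open>(-1)^(n + 1)\<close>
  times its value at \<open>E^n\<close> of \<open>\<kappa> c\<close>. The recursion through
  \<open>shift G\<close> replaces manipulations of such sums by naturality.\<close>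

primrec bd :: "nat \<Rightarrow> ('o, 'm, ('r, 'v) module, 'v \<Rightarrow> 'v) func \<Rightarrow> 'v \<Rightarrow> 'v" where
  "bd 0 G = (\<lambda>v. onA G c (onO E c) (\<eta> c) v \<ominus>\<^bsub>onO G (onO E c)\<^esub> onA G c (onO E c) (\<kappa> c) v)"
| "bd (Suc n) G = (\<lambda>v. onA G (ob (Suc n)) (ob (Suc (Suc n))) (\<eta> (ob (Suc n))) v
      \<ominus>\<^bsub>onO G (ob (Suc (Suc n)))\<^esub> bd n (shift G) v)"

lemma bd_ahom: "fct G \<Longrightarrow> bd n G \<in> ahom (onO G (ob n)) (onO G (ob (Suc n)))"
proof (induction n arbitrary: G)
  case 0
  then show ?case
    by (auto intro!: ahom_diff fct_group fct_ahom eta_arr kappa_arr E_obj c_obj)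
next
  case (Suc n)
  then show ?case
    using Suc.IH[OF fct_shift[OF Suc.prems]]
    by (auto intro!: ahom_diff fct_group fct_ahom eta_arr kappa_arr E_obj ob_obj)
qed

lemma bd_closed: "fct G \<Longrightarrow> v \<in> carrier (onO G (ob n)) \<Longrightarrow> bd n G v \<in> carrier (onO G (ob (Suc n)))"
  by (meson ahom_closed bd_ahom)

text \<open>Every term of \<open>bd\<close> is the value of the functor at an arrow. The induction
  ranges over all functors and transformations because degree \<open>Suc n\<close> refers to the
  shifted ones.\<close>

lemma bd_natural:
  assumes "fct G" "fct H" "\<theta> \<in> nat_tr G H" "v \<in> carrier (onO G (ob n))"
  shows "bd n H (\<theta> (ob n) v) = \<theta> (ob (Suc n)) (bd n G v)"
  using assms
proof (induction n arbitrary: G H \<theta>)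
  case 0
  then show ?case
    by (simp add: ahom_minus[OF _ _ nat_tr_ahom[OF 0(3)]] fct_group E_obj c_obj eta_arr kappa_arr
        fct_closed nat_tr_app)
next
  case (Suc n)
  have "bd n (shift H) (\<theta> (ob (Suc n)) v) = \<theta> (ob (Suc (Suc n))) (bd n (shift G) v)"
    using Suc.IH[OF fct_shift[OF Suc.prems(1)] fct_shift[OF Suc.prems(2)] nat_tr_shift[OF Suc.prems(3)]] Suc.prems(4)
    by simp
  moreover have "bd n (shift G) v \<in> carrier (onO G (ob (Suc (Suc n))))"
    using bd_closed[OF fct_shift[OF Suc.prems(1)], of v n] Suc.prems(4) by simp
  ultimately show ?case
    using Suc.prems
    by (simp add: ahom_minus[OF _ _ nat_tr_ahom[OF Suc.prems(3)]] fct_group E_obj ob_obj eta_arr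
        fct_closed nat_tr_app)
qed

text \<open>The cosimplicial identities that involve \<eta>, packed into one equation: \<eta> is a
  natural transformation from \<open>G\<close> to \<open>shift G\<close>.\<close>

lemma bd_eta:
  assumes "fct G" "v \<in> carrier (onO G (ob n))"
  shows "bd n (shift G) (onA G (ob n) (ob (Suc n)) (\<eta> (ob n)) v) =
    onA G (ob (Suc n)) (ob (Suc (Suc n))) (\<eta> (ob (Suc n))) (bd n G v)"
  using bd_natural[OF assms(1) fct_shift[OF assms(1)] nat_tr_eta[OF assms(1)] assms(2)] by simp

lemma bd_bd:
  assumes "fct G" "v \<in> carrier (onO G (ob n))"
  shows "bd (Suc n) G (bd n G v) = \<zero>\<^bsub>onO G (ob (Suc (Suc n)))\<^esub>"
  using assms
proof (induction n arbitrary: G)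
  case 0
  interpret M: abelian_group "onO G (onO E (onO E c))"
    using 0 by (simp add: fct_group E_obj c_obj)
  have G': "abelian_group (onO G (onO E c))"
    using 0 by (simp add: fct_group E_obj c_obj)
  let ?e = "onA G c (onO E c) (\<eta> c) v" and ?k = "onA G c (onO E c) (\<kappa> c) v"
  have cl: "?e \<in> carrier (onO G (onO E c))" "?k \<in> carrier (onO G (onO E c))"
    using 0 by (simp_all add: fct_closed E_obj c_obj eta_arr kappa_arr)
  \<comment> \<open>Both terms are the value of \<open>G\<close> at
    \<open>\<kappa> (onO E c)\<close>, by naturality of \<kappa> along \<open>\<eta> c\<close> and
    along \<open>\<kappa> c\<close>.\<close>
  have bdk: "bd 0 (shift G) ?k = \<zero>\<^bsub>onO G (onO E (onO E c))\<^esub>"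
    using 0 kappa_natural[OF c_obj E_obj[OF c_obj] eta_arr[OF c_obj]]
      kappa_natural[OF c_obj E_obj[OF c_obj] kappa_arr[OF c_obj]]
    by (simp add: fct_cmp[symmetric] E_obj c_obj kappa_arr eta_arr E_arr fct_closed)
  have "bd 0 (shift G) (?e \<ominus>\<^bsub>onO G (onO E c)\<^esub> ?k) =
      bd 0 (shift G) ?e \<ominus>\<^bsub>onO G (onO E (onO E c))\<^esub> bd 0 (shift G) ?k"
    using ahom_minus[OF _ _ bd_ahom[OF fct_shift[OF 0(1)], of 0]] cl G' M.abelian_group_axioms by simp
  also have "\<dots> = bd 0 (shift G) ?e"
    using bdk bd_closed[OF fct_shift[OF 0(1)], of ?e 0] cl by (simp del: bd.simps)
  also have "\<dots> = onA G (onO E c) (onO E (onO E c)) (\<eta> (onO E c)) (bd 0 G v)"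
    using bd_eta[of G v 0] 0 by (simp del: bd.simps)
  finally have *: "bd 0 (shift G) (bd 0 G v) = onA G (onO E c) (onO E (onO E c)) (\<eta> (onO E c)) (bd 0 G v)"
    by simp
  show ?case
    unfolding bd.simps(2) using * bd_closed[OF 0] 0(1)
    by (simp add: fct_closed E_obj c_obj eta_arr del: bd.simps)
next
  case (Suc n)
  let ?G = "shift G"
  interpret M: abelian_group "onO G (onO E (onO E (onO E (ob n))))"
    using Suc.prems by (simp add: fct_group E_obj ob_obj)
  let ?e = "onA G (ob (Suc n)) (ob (Suc (Suc n))) (\<eta> (ob (Suc n))) v"
  have b: "bd n ?G v \<in> carrier (onO G (ob (Suc (Suc n))))"
    using bd_closed[OF fct_shift[OF Suc.prems(1)], of v n] Suc.prems by simp
  have e: "?e \<in> carrier (onO G (ob (Suc (Suc n))))"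
    using Suc.prems by (simp add: fct_closed E_obj ob_obj eta_arr)
  \<comment> \<open>The induction hypothesis for \<open>shift G\<close> kills one half of
    \<open>bd (Suc n) G v\<close>; \<open>bd_eta\<close> rewrites the other half, after which the
    two terms of the outer differential coincide.\<close>
  have "bd (Suc n) ?G (bd n ?G v) = \<zero>\<^bsub>onO G (ob (Suc (Suc (Suc n))))\<^esub>"
    using Suc.IH[OF fct_shift[OF Suc.prems(1)]] Suc.prems by simp
  moreover have "bd (Suc n) ?G (?e \<ominus>\<^bsub>onO G (ob (Suc (Suc n)))\<^esub> bd n ?G v) =
      bd (Suc n) ?G ?e \<ominus>\<^bsub>onO G (ob (Suc (Suc (Suc n))))\<^esub> bd (Suc n) ?G (bd n ?G v)"
    using ahom_minus[OF _ _ bd_ahom[OF fct_shift[OF Suc.prems(1)], of "Suc n"]] e b Suc.prems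
    by (simp add: fct_group E_obj ob_obj del: bd.simps)
  moreover have "bd (Suc n) ?G ?e \<in> carrier (onO G (ob (Suc (Suc (Suc n)))))"
    using bd_closed[OF fct_shift[OF Suc.prems(1)], of ?e "Suc n"] e by (simp del: bd.simps)
  ultimately have "bd (Suc n) ?G (bd (Suc n) G v) = bd (Suc n) ?G ?e"
    by (simp del: bd.simps add: bd.simps(2)[of n G])
  also have "\<dots> = onA G (ob (Suc (Suc n))) (ob (Suc (Suc (Suc n)))) (\<eta> (ob (Suc (Suc n)))) (bd (Suc n) G v)"
    using bd_eta[OF Suc.prems] .
  finally show ?case
    using bd_closed[OF Suc.prems] Suc.prems(1)
    by (simp add: fct_closed E_obj ob_obj eta_arr bd.simps(2)[of "Suc n"] del: bd.simps)
qed

text \<open>Copairing the identity with some arrow out of \<open>c\<close> gives a left inverse of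
  \<open>\<eta> x\<close>. It depends on a choice and need not be natural in \<open>x\<close>;
  naturality comes only with injectivity.\<close>

lemma eta_inj:
  assumes "fct G" "x \<in> obj C"
  shows "inj_on (onA G x (onO E x) (\<eta> x)) (carrier (onO G x))"
proof -
  obtain g where "g \<in> arr C c x"
    using arr_nonempty assms(2) by blast
  then obtain h where h: "h \<in> arr C (onO E x) x" "cmp C x (onO E x) x h (\<eta> x) = idn C x"
    using copair[OF assms(2) assms(2) idn_arr[OF assms(2)]] by blast
  have "onA G (onO E x) x h (onA G x (onO E x) (\<eta> x) v) = v" if "v \<in> carrier (onO G x)" for v
    using fct_cmp[OF assms(1,2) E_obj[OF assms(2)] assms(2) eta_arr[OF assms(2)] h(1) that] h(2)
      fct_idn[OF assms that] by simp
  then show ?thesis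
    by (rule inj_on_inverseI)
qed

text \<open>The identity of \<open>I\<close> extends along the objectwise injective transformation
  \<eta> from \<open>I\<close> to \<open>shift I\<close>.\<close>

lemma injective_retraction:
  assumes "injective_functor K C I"
  obtains \<zeta> where "\<zeta> \<in> nat_tr (shift I) I"
    "\<And>x v. x \<in> obj C \<Longrightarrow> v \<in> carrier (onO I x) \<Longrightarrow> \<zeta> x (onA I x (onO E x) (\<eta> x) v) = v"
proof -
  have I: "fct I"
    using assms by (simp add: injective_functor_def)
  have "(\<lambda>x. \<lambda>v \<in> carrier (onO I x). v) \<in> nat_tr I I"
  proof -
    have "compose (carrier (onO I x)) (\<lambda>v \<in> carrier (onO I y). v) (onA I x y f) =
        compose (carrier (onO I x)) (onA I x y f) (\<lambda>v \<in> carrier (onO I x). v)"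
      if "x \<in> obj C" "y \<in> obj C" "f \<in> arr C x y" for x y f
      using fct_closed[OF I that] by (auto simp: compose_def fun_eq_iff)
    moreover have "(\<lambda>v \<in> carrier (onO I x). v) \<in> mod_hom K (onO I x) (onO I x)" if "x \<in> obj C" for x
    proof -
      have M: "module K (onO I x)"
        using I that by (auto simp: is_functor_def Mod_cat_def)
      interpret M: module K "onO I x" by (rule M)
      show ?thesis
        by (auto simp: mod_hom_def)
    qed
    ultimately show ?thesis
      by (simp add: nat_trans_def Mod_cat_def)
  qed
  then obtain \<zeta> where \<zeta>: "\<zeta> \<in> nat_tr (shift I) I"
    "\<forall>x \<in> obj C. compose (carrier (onO I x)) (\<zeta> x) (onA I x (onO E x) (\<eta> x)) = (\<lambda>v \<in> carrier (onO I x). v)"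
    using assms[unfolded injective_functor_def, THEN conjunct2, rule_format, OF conjI[OF I fct_shift[OF I]]
        nat_tr_eta[OF I]] eta_inj[OF I] by blast
  have "\<zeta> x (onA I x (onO E x) (\<eta> x) v) = v" if "x \<in> obj C" "v \<in> carrier (onO I x)" for x v
    using fun_cong[OF bspec[OF \<zeta>(2) that(1)], of v] that(2) by (simp add: compose_def)
  then show thesis
    by (rule that[OF \<zeta>(1)])
qed

text \<open>The retraction is a contracting homotopy. On a cocycle \<open>y\<close> the two terms of
  \<open>bd (Suc n) I y\<close> agree; applying \<zeta> turns one of them into \<open>y\<close> and,
  by \<open>bd_natural\<close>, the other into the differential of \<open>\<zeta> y\<close>.\<close>

lemma injective_row_exact:
  assumes "injective_functor K C I" "y \<in> carrier (onO I (ob (Suc n)))"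
    and "bd (Suc n) I y = \<zero>\<^bsub>onO I (ob (Suc (Suc n)))\<^esub>"
  shows "\<exists>w \<in> carrier (onO I (ob n)). y = bd n I w"
proof -
  have I: "fct I"
    using assms by (simp add: injective_functor_def)
  interpret M: abelian_group "onO I (ob (Suc (Suc n)))"
    using I by (simp add: fct_group E_obj ob_obj)
  obtain \<zeta> where \<zeta>: "\<zeta> \<in> nat_tr (shift I) I"
    "\<And>x v. x \<in> obj C \<Longrightarrow> v \<in> carrier (onO I x) \<Longrightarrow> \<zeta> x (onA I x (onO E x) (\<eta> x) v) = v"
    using injective_retraction[OF assms(1)] by blast
  have z: "\<zeta> (ob n) y \<in> carrier (onO I (ob n))"
    using ahom_closed[OF nat_tr_ahom[OF \<zeta>(1) ob_obj]] assms(2) by simp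
  have "bd n (shift I) y \<in> carrier (onO I (ob (Suc (Suc n))))"
    using bd_closed[OF fct_shift[OF I], of y n] assms(2) by simp
  moreover have "onA I (ob (Suc n)) (ob (Suc (Suc n))) (\<eta> (ob (Suc n))) y \<in> carrier (onO I (ob (Suc (Suc n))))"
    using I assms(2) by (simp add: fct_closed E_obj ob_obj eta_arr)
  ultimately have "bd n (shift I) y = onA I (ob (Suc n)) (ob (Suc (Suc n))) (\<eta> (ob (Suc n))) y"
    using assms(3) M.minus_eq_zero by simp
  then have "\<zeta> (ob (Suc n)) (bd n (shift I) y) = y"
    using \<zeta>(2)[OF ob_obj[of "Suc n"] assms(2)] by simp
  moreover have "bd n I (\<zeta> (ob n) y) = \<zeta> (ob (Suc n)) (bd n (shift I) y)"
    using bd_natural[OF fct_shift[OF I] I \<zeta>(1)] assms(2) by simp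
  ultimately show ?thesis
    using z by metis
qed

lemma lim_in_ker:
  assumes "fct G" "s \<in> carrier (lim_module C G)"
  shows "s c \<in> carrier (onO G c)" "bd 0 G (s c) = \<zero>\<^bsub>onO G (ob 1)\<^esub>"
proof -
  interpret M: abelian_group "onO G (onO E c)"
    using assms by (simp add: fct_group E_obj c_obj)
  show *: "s c \<in> carrier (onO G c)"
    using assms(2) c_obj by (auto simp: lim_module_def)
  have "onA G c (onO E c) f (s c) = s (onO E c)" if "f \<in> arr C c (onO E c)" for f
    using assms(2) c_obj E_obj that by (simp add: lim_module_def)
  then show "bd 0 G (s c) = \<zero>\<^bsub>onO G (ob 1)\<^esub>"
    using * assms(1) fct_closed[OF assms(1) c_obj E_obj[OF c_obj] eta_arr[OF c_obj] *]
    by (simp add: eta_arr kappa_arr c_obj)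
qed

text \<open>Every object receives an arrow from \<open>c\<close>, so a compatible family is
  determined by its value there.\<close>

lemma lim_eqI:
  assumes "s \<in> carrier (lim_module C G)" "t \<in> carrier (lim_module C G)" "s c = t c"
  shows "s = t"
proof (rule extensionalityI[of _ "obj C"])
  fix x assume x: "x \<in> obj C"
  then obtain f where "f \<in> arr C c x"
    using arr_nonempty by blast
  then have "onA G c x f (s c) = s x" "onA G c x f (t c) = t x"
    using assms(1,2) c_obj x unfolding lim_module_def by (simp_all only: partial_object.simps) blast+
  then show "s x = t x"
    using assms(3) by simp
qed (use assms in \<open>auto simp: lim_module_def PiE_def\<close>)

text \<open>Two arrows from \<open>c\<close> to \<open>x\<close> factor as \<open>h\<close> after
  \<open>\<eta> c\<close> and the same \<open>h\<close> after \<open>\<kappa> c\<close>. An element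
  on which these two inclusions agree therefore has one well-defined image in each
  \<open>onO G x\<close>, and these images form the family.\<close>

lemma lim_of_ker:
  assumes "fct G" "v \<in> carrier (onO G c)" "bd 0 G v = \<zero>\<^bsub>onO G (ob 1)\<^esub>"
  shows "\<exists>s \<in> carrier (lim_module C G). s c = v"
proof -
  interpret M: abelian_group "onO G (onO E c)"
    using assms by (simp add: fct_group E_obj c_obj)
  have ek: "onA G c (onO E c) (\<eta> c) v = onA G c (onO E c) (\<kappa> c) v"
    using assms by (simp add: M.minus_eq_zero fct_closed E_obj c_obj eta_arr kappa_arr)
  have indep: "onA G c x f v = onA G c x g v" if x: "x \<in> obj C" and f: "f \<in> arr C c x" and g: "g \<in> arr C c x" for x f g
  proof -
    obtain h where h: "h \<in> arr C (onO E c) x" "cmp C c (onO E c) x h (\<eta> c) = f" "cmp C c (onO E c) x h (\<kappa> c) = g"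
      using copair[OF c_obj x f g] by blast
    have "onA G c x f v = onA G (onO E c) x h (onA G c (onO E c) (\<eta> c) v)"
      using fct_cmp[OF assms(1) c_obj E_obj[OF c_obj] x eta_arr[OF c_obj] h(1) assms(2)] h(2) by simp
    moreover have "onA G c x g v = onA G (onO E c) x h (onA G c (onO E c) (\<kappa> c) v)"
      using fct_cmp[OF assms(1) c_obj E_obj[OF c_obj] x kappa_arr[OF c_obj] h(1) assms(2)] h(3) by simp
    ultimately show ?thesis
      using ek by simp
  qed
  define k where "k x = (SOME f. f \<in> arr C c x)" for x
  have k: "k x \<in> arr C c x" if "x \<in> obj C" for x
    unfolding k_def using arr_nonempty[OF that] by (rule someI_ex)
  define s where "s = (\<lambda>x \<in> obj C. onA G c x (k x) v)"
  have "onA G x y f (s x) = s y" if x: "x \<in> obj C" and y: "y \<in> obj C" and f: "f \<in> arr C x y" for x y f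
  proof -
    have "onA G x y f (s x) = onA G c y (cmp C c x y f (k x)) v"
      using fct_cmp[OF assms(1) c_obj x y k[OF x] f assms(2)] x by (simp add: s_def)
    also have "\<dots> = s y"
      using indep[OF y cmp_arr[OF c_obj x y k[OF x] f] k[OF y]] y by (simp add: s_def)
    finally show ?thesis .
  qed
  moreover have "s x \<in> carrier (onO G x)" if "x \<in> obj C" for x
    using that assms k by (simp add: s_def fct_closed c_obj)
  ultimately have "s \<in> carrier (lim_module C G)"
    by (simp add: lim_module_def) (simp add: s_def)
  moreover have "s c = v"
    using indep[OF c_obj k[OF c_obj] idn_arr[OF c_obj]] fct_idn[OF assms(1) c_obj assms(2)] c_obj by (simp add: s_def)
  ultimately show ?thesis by blast
qed

text \<open>The double complex \<open>I n (E\<^sup>p c)\<close> has exact columns, and exact rows in degrees \<open>p > 0\<close>.\<close>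

lemma resolution_chase:
  assumes res: "injective_resolution K C F I \<epsilon> \<delta>"
    and F_exact: "\<And>n f. d \<le> n \<Longrightarrow> f \<in> carrier (onO F (ob (Suc n)))
      \<Longrightarrow> bd (Suc n) F f = \<zero>\<^bsub>onO F (ob (Suc (Suc n)))\<^esub> \<Longrightarrow> \<exists>g \<in> carrier (onO F (ob n)). f = bd n F g"
    and "d \<le> p + m" "x \<in> carrier (onO (I (Suc m)) (ob p))"
    and "bd p (I (Suc m)) x = \<zero>\<^bsub>onO (I (Suc m)) (ob (Suc p))\<^esub>"
    and "\<delta> (Suc m) (ob p) x = \<zero>\<^bsub>onO (I (Suc (Suc m))) (ob p)\<^esub>"
  shows "\<exists>y \<in> carrier (onO (I m) (ob p)). x = \<delta> m (ob p) y \<and> bd p (I m) y = \<zero>\<^bsub>onO (I m) (ob (Suc p))\<^esub>"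
  using assms(3-)
\<comment> \<open>The sum \<open>p + m\<close> stays fixed while \<open>m\<close> decreases, so
  \<open>d \<le> p + m\<close> is passed along unchanged and reads \<open>d \<le> p\<close> when the
  row of \<open>F\<close> is reached.\<close>
proof (induction m arbitrary: p x)
  have F: "fct F" and I: "\<And>n. fct (I n)" and inj: "\<And>n. injective_functor K C (I n)"
    and \<epsilon>: "\<epsilon> \<in> nat_tr F (I 0)" and \<delta>: "\<And>n. \<delta> n \<in> nat_tr (I n) (I (Suc n))"
    and col: "\<And>n x. x \<in> obj C \<Longrightarrow> \<delta> n x ` carrier (onO (I n) x) =
             a_kernel (onO (I (Suc n)) x) (onO (I (Suc (Suc n))) x) (\<delta> (Suc n) x)"
    and col0: "\<And>x. x \<in> obj C \<Longrightarrow> \<epsilon> x ` carrier (onO F x) = a_kernel (onO (I 0) x) (onO (I 1) x) (\<delta> 0 x)"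
    and \<epsilon>_inj: "\<And>x. x \<in> obj C \<Longrightarrow> inj_on (\<epsilon> x) (carrier (onO F x))"
    using res unfolding injective_resolution_def injective_functor_def by auto
  have grp: "abelian_group (onO (I n) (ob p))" "abelian_group (onO F (ob p))" for n p
    by (simp_all add: fct_group I F ob_obj)
  have \<delta>hom: "\<delta> n (ob p) \<in> ahom (onO (I n) (ob p)) (onO (I (Suc n)) (ob p))" for n p
    by (rule nat_tr_ahom[OF \<delta> ob_obj])
  have \<epsilon>hom: "\<epsilon> (ob p) \<in> ahom (onO F (ob p)) (onO (I 0) (ob p))" for p
    by (rule nat_tr_ahom[OF \<epsilon> ob_obj])
  have bdhom: "bd p (I n) \<in> ahom (onO (I n) (ob p)) (onO (I n) (ob (Suc p)))" for n p
    by (rule bd_ahom[OF I])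
  have col': "\<exists>u \<in> carrier (onO (I n) (ob p)). x = \<delta> n (ob p) u"
    if "x \<in> carrier (onO (I (Suc n)) (ob p))" "\<delta> (Suc n) (ob p) x = \<zero>\<^bsub>onO (I (Suc (Suc n))) (ob p)\<^esub>" for n p x
    using col[OF ob_obj[of p], of n] that by (auto simp: a_kernel_def')
  have \<delta>\<delta>: "\<delta> (Suc n) (ob p) (\<delta> n (ob p) u) = \<zero>\<^bsub>onO (I (Suc (Suc n))) (ob p)\<^esub>"
    if "u \<in> carrier (onO (I n) (ob p))" for n p u
    using col[OF ob_obj[of p], of n] that by (auto simp: a_kernel_def')
  have \<delta>\<epsilon>: "\<delta> 0 (ob p) (\<epsilon> (ob p) u) = \<zero>\<^bsub>onO (I 1) (ob p)\<^esub>"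
    if "u \<in> carrier (onO F (ob p))" for p u
    using col0[OF ob_obj[of p]] that by (auto simp: a_kernel_def')
  have lift: "\<exists>u \<in> carrier (onO (I n) (ob p)). x = \<delta> n (ob p) u \<and>
      bd p (I n) u \<in> carrier (onO (I n) (ob (Suc p))) \<and>
      \<delta> n (ob (Suc p)) (bd p (I n) u) = \<zero>\<^bsub>onO (I (Suc n)) (ob (Suc p))\<^esub>"
    if "x \<in> carrier (onO (I (Suc n)) (ob p))" "bd p (I (Suc n)) x = \<zero>\<^bsub>onO (I (Suc n)) (ob (Suc p))\<^esub>"
      "\<delta> (Suc n) (ob p) x = \<zero>\<^bsub>onO (I (Suc (Suc n))) (ob p)\<^esub>" for n p x
  proof -
    from col'[OF that(1,3)] obtain u where u: "u \<in> carrier (onO (I n) (ob p))" "x = \<delta> n (ob p) u"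
      by blast
    then show ?thesis
      using that(2) bd_natural[OF I I \<delta> u(1)] ahom_closed[OF bdhom u(1)] by (intro bexI[of _ u]) simp_all
  qed
  \<comment> \<open>Changing a lift \<open>u\<close> by a column cocycle \<open>w\<close> with the
    same row differential leaves \<open>\<delta> u\<close> alone and makes the row differential
    zero.\<close>
  have correct: "\<exists>y \<in> carrier (onO (I n) (ob p)). \<delta> n (ob p) u = \<delta> n (ob p) y
      \<and> bd p (I n) y = \<zero>\<^bsub>onO (I n) (ob (Suc p))\<^esub>"
    if "u \<in> carrier (onO (I n) (ob p))" "w \<in> carrier (onO (I n) (ob p))"
      "\<delta> n (ob p) w = \<zero>\<^bsub>onO (I (Suc n)) (ob p)\<^esub>" "bd p (I n) u = bd p (I n) w" for n p u w
  proof -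
    interpret M: abelian_group "onO (I n) (ob p)" by (rule grp)
    interpret N: abelian_group "onO (I (Suc n)) (ob p)" by (rule grp)
    interpret B: abelian_group "onO (I n) (ob (Suc p))" by (rule grp)
    have "\<delta> n (ob p) (u \<ominus>\<^bsub>onO (I n) (ob p)\<^esub> w) = \<delta> n (ob p) u"
      using that ahom_minus[OF grp(1) grp(1) \<delta>hom] ahom_closed[OF \<delta>hom that(1)] by simp
    moreover have "bd p (I n) (u \<ominus>\<^bsub>onO (I n) (ob p)\<^esub> w) = \<zero>\<^bsub>onO (I n) (ob (Suc p))\<^esub>"
      using ahom_minus[OF grp(1) grp(1) bdhom that(1,2)] B.minus_self[OF ahom_closed[OF bdhom that(1)]] that(4)
      by (simp only:)
    ultimately show ?thesis
      using M.minus_closed[OF that(1,2)] by (intro bexI[of _ "u \<ominus>\<^bsub>onO (I n) (ob p)\<^esub> w"]) simp_all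
  qed
  {
    case 0
    obtain u where u: "u \<in> carrier (onO (I 0) (ob p))" "x = \<delta> 0 (ob p) u"
      "bd p (I 0) u \<in> carrier (onO (I 0) (ob (Suc p)))"
      "\<delta> 0 (ob (Suc p)) (bd p (I 0) u) = \<zero>\<^bsub>onO (I (Suc 0)) (ob (Suc p))\<^esub>"
      using lift[of x 0 p] 0 by auto
    obtain f where f: "f \<in> carrier (onO F (ob (Suc p)))" "bd p (I 0) u = \<epsilon> (ob (Suc p)) f"
      using col0[OF ob_obj[of "Suc p"]] u(3,4) by (auto simp: a_kernel_def' simp del: funpow.simps)
    \<comment> \<open>\<open>f\<close> is a cocycle of \<open>F\<close>, because \<epsilon> commutes
      with \<open>bd\<close> and is injective.\<close>
    have "\<epsilon> (ob (Suc (Suc p))) (bd (Suc p) F f) = bd (Suc p) (I 0) (bd p (I 0) u)"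
      using bd_natural[OF F I \<epsilon> f(1)] f(2) by simp
    also have "\<dots> = \<epsilon> (ob (Suc (Suc p))) \<zero>\<^bsub>onO F (ob (Suc (Suc p)))\<^esub>"
      using bd_bd[OF I u(1)] ahom_zero[OF grp(2) grp(1) \<epsilon>hom] by (simp only:)
    finally have "bd (Suc p) F f = \<zero>\<^bsub>onO F (ob (Suc (Suc p)))\<^esub>"
      using inj_onD[OF \<epsilon>_inj[OF ob_obj] _ bd_closed[OF F f(1)]
          abelian_monoid.zero_closed[OF abelian_group.axioms(1)[OF grp(2)]]] by (simp only:)
    then obtain g where g: "g \<in> carrier (onO F (ob p))" "f = bd p F g"
      using F_exact[of p f] f(1) 0(1) by auto
    have "bd p (I 0) u = bd p (I 0) (\<epsilon> (ob p) g)"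
      using bd_natural[OF F I \<epsilon> g(1)] g(2) f(2) by simp
    then show ?case
      using correct[OF u(1) ahom_closed[OF \<epsilon>hom g(1)]] \<delta>\<epsilon>[OF g(1)] u(2) by simp
  next
    case (Suc m)
    obtain u where u: "u \<in> carrier (onO (I (Suc m)) (ob p))" "x = \<delta> (Suc m) (ob p) u"
      "bd p (I (Suc m)) u \<in> carrier (onO (I (Suc m)) (ob (Suc p)))"
      "\<delta> (Suc m) (ob (Suc p)) (bd p (I (Suc m)) u) = \<zero>\<^bsub>onO (I (Suc (Suc m))) (ob (Suc p))\<^esub>"
      using lift[of x "Suc m" p] Suc.prems by auto
    \<comment> \<open>The row differential of \<open>u\<close> satisfies the hypotheses with
      \<open>m\<close> lowered and \<open>p\<close> raised by one. The resulting \<open>y'\<close>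
      is a row cocycle at the positive position \<open>Suc p\<close>, where rows of injectives are
      exact; this gives \<open>w\<close>.\<close>
    obtain y' where y': "y' \<in> carrier (onO (I m) (ob (Suc p)))" "bd p (I (Suc m)) u = \<delta> m (ob (Suc p)) y'"
      "bd (Suc p) (I m) y' = \<zero>\<^bsub>onO (I m) (ob (Suc (Suc p)))\<^esub>"
      using Suc.IH[OF _ u(3) bd_bd[OF I u(1)] u(4)] Suc.prems(1) by auto
    obtain w where w: "w \<in> carrier (onO (I m) (ob p))" "y' = bd p (I m) w"
      using injective_row_exact[OF inj y'(1,3)] by auto
    have "bd p (I (Suc m)) u = bd p (I (Suc m)) (\<delta> m (ob p) w)"
      using bd_natural[OF I I \<delta> w(1)] w(2) y'(2) by simp
    then show ?case
      using correct[OF u(1) ahom_closed[OF \<delta>hom w(1)]] \<delta>\<delta>[OF w(1)] u(2) by simp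
  }
qed

end

section \<open>Difference functors modulo a subfunctor, and exactness in high degrees\<close>

context cone_category
begin

text \<open>The pair of \<open>G\<close> and \<open>D\<close> stands for the quotient of
  \<open>G\<close> by \<open>D\<close>. Forming the quotient would move from carriers in
  \<open>'v\<close> to carriers in \<open>'v set\<close>, and an induction cannot change the type.
  Additive subgroups are enough for statements about exactness.\<close>

definition subfunctor :: "('o, 'm, ('r, 'v) module, 'v \<Rightarrow> 'v) func \<Rightarrow> ('o \<Rightarrow> 'v set) \<Rightarrow> bool" where
  "subfunctor G D \<longleftrightarrow> (\<forall>x \<in> obj C. additive_subgroup (D x) (onO G x)) \<and>
     (\<forall>x \<in> obj C. \<forall>y \<in> obj C. \<forall>f \<in> arr C x y. onA G x y f ` D x \<subseteq> D y)"

lemma subfunctor_group: "subfunctor G D \<Longrightarrow> x \<in> obj C \<Longrightarrow> additive_subgroup (D x) (onO G x)"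
  by (simp add: subfunctor_def)

lemma subfunctor_map: "subfunctor G D \<Longrightarrow> x \<in> obj C \<Longrightarrow> y \<in> obj C \<Longrightarrow> f \<in> arr C x y \<Longrightarrow> v \<in> D x
    \<Longrightarrow> onA G x y f v \<in> D y"
  unfolding subfunctor_def by blast

text \<open>\<open>shift G\<close> modulo \<open>eta_sub G D\<close> is the difference functor, in the direction of \<open>c\<close>, of
  \<open>G\<close> modulo \<open>D\<close>.\<close>

definition eta_sub :: "('o, 'm, ('r, 'v) module, 'v \<Rightarrow> 'v) func \<Rightarrow> ('o \<Rightarrow> 'v set) \<Rightarrow> 'o \<Rightarrow> 'v set" where
  "eta_sub G D x = {onA G x (onO E x) (\<eta> x) u \<oplus>\<^bsub>onO G (onO E x)\<^esub> e |u e. u \<in> carrier (onO G x) \<and> e \<in> D (onO E x)}"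

text \<open>Unfolded at \<open>x\<close>, this is \<open>D ((onO E ^^ k) x)\<close> plus the images
  under \<open>G\<close> of the \<open>k\<close> inclusions of \<open>(onO E ^^ (k - 1)) x\<close>,
  one for each omitted copy of \<open>c\<close>. That it is everything means that the
  \<open>k\<close>-th difference functor of \<open>G\<close> modulo \<open>D\<close> vanishes at
  \<open>x\<close>.\<close>

primrec iter_sub :: "nat \<Rightarrow> ('o, 'm, ('r, 'v) module, 'v \<Rightarrow> 'v) func \<Rightarrow> ('o \<Rightarrow> 'v set) \<Rightarrow> 'o \<Rightarrow> 'v set" where
  "iter_sub 0 G D = D"
| "iter_sub (Suc k) G D = iter_sub k (shift G) (eta_sub G D)"

lemma eta_subI: "u \<in> carrier (onO G x) \<Longrightarrow> e \<in> D (onO E x)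
    \<Longrightarrow> onA G x (onO E x) (\<eta> x) u \<oplus>\<^bsub>onO G (onO E x)\<^esub> e \<in> eta_sub G D x"
  by (auto simp: eta_sub_def)

lemma eta_sub_image:
  assumes "fct G" "subfunctor G D" "x \<in> obj C" "u \<in> carrier (onO G x)"
  shows "onA G x (onO E x) (\<eta> x) u \<in> eta_sub G D x"
proof -
  interpret M: abelian_group "onO G (onO E x)"
    using assms by (simp add: fct_group E_obj)
  show ?thesis
    using eta_subI[of u G x _ D, OF assms(4) additive_subgroup.zero_closed[OF subfunctor_group[OF assms(2) E_obj[OF assms(3)]]]]
      fct_closed[OF assms(1) assms(3) E_obj[OF assms(3)] eta_arr[OF assms(3)] assms(4)] by simp
qed

lemma eta_sub_sub:
  assumes "fct G" "subfunctor G D" "x \<in> obj C" "e \<in> D (onO E x)"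
  shows "e \<in> eta_sub G D x"
proof -
  interpret M: abelian_group "onO G (onO E x)"
    using assms by (simp add: fct_group E_obj)
  interpret N: abelian_group "onO G x"
    using assms by (simp add: fct_group)
  have "e \<in> carrier (onO G (onO E x))"
    using additive_subgroup.a_subset[OF subfunctor_group[OF assms(2) E_obj[OF assms(3)]]] assms(4) by blast
  moreover have "onA G x (onO E x) (\<eta> x) \<zero>\<^bsub>onO G x\<^esub> = \<zero>\<^bsub>onO G (onO E x)\<^esub>"
    using ahom_zero[OF _ _ fct_ahom[OF assms(1,3) E_obj[OF assms(3)] eta_arr[OF assms(3)]]]
      N.abelian_group_axioms M.abelian_group_axioms by simp
  ultimately show ?thesis
    using eta_subI[of "\<zero>\<^bsub>onO G x\<^esub>" G x e D] assms(4) by simp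
qed

lemma subfunctor_eta_sub:
  assumes G: "fct G" and D: "subfunctor G D"
  shows "subfunctor (shift G) (eta_sub G D)"
  unfolding subfunctor_def
proof (intro conjI ballI)
  fix x assume x: "x \<in> obj C"
  interpret M: abelian_group "onO G (onO E x)"
    using G x by (simp add: fct_group E_obj)
  interpret N: abelian_group "onO G x"
    using G x by (simp add: fct_group)
  have hom: "onA G x (onO E x) (\<eta> x) \<in> ahom (onO G x) (onO G (onO E x))"
    by (rule fct_ahom[OF G x E_obj[OF x] eta_arr[OF x]])
  have sg: "additive_subgroup (D (onO E x)) (onO G (onO E x))"
    by (rule subfunctor_group[OF D E_obj[OF x]])
  have sub: "D (onO E x) \<subseteq> carrier (onO G (onO E x))"
    by (rule additive_subgroup.a_subset[OF sg])
  have "additive_subgroup (eta_sub G D x) (onO G (onO E x))"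
  proof (rule additive_subgroup_minusI[OF M.abelian_group_axioms])
    show "eta_sub G D x \<subseteq> carrier (onO G (onO E x))"
      using sub ahom_closed[OF hom] by (auto simp: eta_sub_def)
    show "\<zero>\<^bsub>onO G (onO E x)\<^esub> \<in> eta_sub G D x"
      by (rule eta_sub_sub[OF G D x additive_subgroup.zero_closed[OF sg]])
    fix v w assume "v \<in> eta_sub G D x" "w \<in> eta_sub G D x"
    then obtain u e u' e' where *: "u \<in> carrier (onO G x)" "e \<in> D (onO E x)" "u' \<in> carrier (onO G x)" "e' \<in> D (onO E x)"
      "v = onA G x (onO E x) (\<eta> x) u \<oplus>\<^bsub>onO G (onO E x)\<^esub> e" "w = onA G x (onO E x) (\<eta> x) u' \<oplus>\<^bsub>onO G (onO E x)\<^esub> e'"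
      by (auto simp: eta_sub_def)
    then have "v \<ominus>\<^bsub>onO G (onO E x)\<^esub> w = onA G x (onO E x) (\<eta> x) (u \<ominus>\<^bsub>onO G x\<^esub> u') \<oplus>\<^bsub>onO G (onO E x)\<^esub> (e \<ominus>\<^bsub>onO G (onO E x)\<^esub> e')"
      using ahom_minus[OF N.abelian_group_axioms M.abelian_group_axioms hom] ahom_closed[OF hom] sub
      by (simp add: M.add_minus_add subsetD)
    then show "v \<ominus>\<^bsub>onO G (onO E x)\<^esub> w \<in> eta_sub G D x"
      using eta_subI[of _ G x _ D, OF N.minus_closed[OF *(1,3)] subgroup_minus[OF M.abelian_group_axioms sg *(2,4)]] by simp
  qed
  then show "additive_subgroup (eta_sub G D x) (onO (shift G) x)"
    by simp
next
  fix x y f assume x: "x \<in> obj C" and y: "y \<in> obj C" and f: "f \<in> arr C x y"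
  show "onA (shift G) x y f ` eta_sub G D x \<subseteq> eta_sub G D y"
  proof
    fix w assume "w \<in> onA (shift G) x y f ` eta_sub G D x"
    then obtain u e where u: "u \<in> carrier (onO G x)" and e: "e \<in> D (onO E x)"
      and w: "w = onA G (onO E x) (onO E y) (onA E x y f) (onA G x (onO E x) (\<eta> x) u \<oplus>\<^bsub>onO G (onO E x)\<^esub> e)"
      by (auto simp: eta_sub_def)
    have "e \<in> carrier (onO G (onO E x))"
      using e additive_subgroup.a_subset[OF subfunctor_group[OF D E_obj[OF x]]] by blast
    then have "w = onA G (onO E x) (onO E y) (onA E x y f) (onA G x (onO E x) (\<eta> x) u)
        \<oplus>\<^bsub>onO G (onO E y)\<^esub> onA G (onO E x) (onO E y) (onA E x y f) e"
      using w ahom_add[OF fct_ahom[OF G E_obj[OF x] E_obj[OF y] E_arr[OF x y f]]]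
        fct_closed[OF G x E_obj[OF x] eta_arr[OF x] u] by simp
    also have "onA G (onO E x) (onO E y) (onA E x y f) (onA G x (onO E x) (\<eta> x) u) =
        onA G y (onO E y) (\<eta> y) (onA G x y f u)"
      using nat_tr_app[OF nat_tr_eta[OF G] x y f u] by simp
    finally show "w \<in> eta_sub G D y"
      using eta_subI[of "onA G x y f u" G y "onA G (onO E x) (onO E y) (onA E x y f) e" D]
        fct_closed[OF G x y f u] subfunctor_map[OF D E_obj[OF x] E_obj[OF y] E_arr[OF x y f] e] by simp
  qed
qed

lemma iter_sub_group:
  "fct G \<Longrightarrow> subfunctor G D \<Longrightarrow> x \<in> obj C \<Longrightarrow> additive_subgroup (iter_sub k G D x) (onO G ((onO E ^^ k) x))"
proof (induction k arbitrary: G D)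
  case 0
  then show ?case by (simp add: subfunctor_group)
next
  case (Suc k)
  then show ?case
    using Suc.IH[OF fct_shift[OF Suc.prems(1)] subfunctor_eta_sub[OF Suc.prems(1,2)]] by simp
qed

lemma iter_sub_sub:
  "fct G \<Longrightarrow> subfunctor G D \<Longrightarrow> x \<in> obj C \<Longrightarrow> e \<in> D ((onO E ^^ k) x) \<Longrightarrow> e \<in> iter_sub k G D x"
proof (induction k arbitrary: G D)
  case 0
  then show ?case by simp
next
  case (Suc k)
  then show ?case
    using Suc.IH[OF fct_shift[OF Suc.prems(1)] subfunctor_eta_sub[OF Suc.prems(1,2)]]
      eta_sub_sub[OF Suc.prems(1,2) E_pow_obj[OF Suc.prems(3)]] by simp
qed

lemma bd_subfunctor:
  "fct G \<Longrightarrow> subfunctor G D \<Longrightarrow> e \<in> D (ob n) \<Longrightarrow> bd n G e \<in> D (ob (Suc n))"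
proof (induction n arbitrary: G D)
  case 0
  then show ?case
    by (auto intro!: subgroup_minus subfunctor_group subfunctor_map fct_group E_obj c_obj eta_arr kappa_arr)
next
  case (Suc n)
  have "subfunctor (shift G) (\<lambda>x. D (onO E x))"
    using Suc.prems(2) by (auto simp: subfunctor_def E_obj E_arr)
  then have "bd n (shift G) e \<in> D (ob (Suc (Suc n)))"
    using Suc.IH[OF fct_shift[OF Suc.prems(1)], of "\<lambda>x. D (onO E x)"] Suc.prems(3) by simp
  then show ?case
    using Suc.prems by (auto intro!: subgroup_minus subfunctor_group subfunctor_map fct_group E_obj ob_obj eta_arr)
qed

text \<open>The boundaries of degree \<open>n + 1\<close> in the complex of \<open>G\<close> modulo
  \<open>D\<close>, pulled back to \<open>G\<close>.\<close>

definition bd_sub :: "('o, 'm, ('r, 'v) module, 'v \<Rightarrow> 'v) func \<Rightarrow> ('o \<Rightarrow> 'v set) \<Rightarrow> nat \<Rightarrow> 'v set" where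
  "bd_sub G D n = {bd n G w \<oplus>\<^bsub>onO G (ob (Suc n))\<^esub> e |w e. w \<in> carrier (onO G (ob n)) \<and> e \<in> D (ob (Suc n))}"

text \<open>By \<open>bd_eta\<close> the differential of \<open>\<eta> v\<close> is \<eta> applied
  to \<open>\<eta> v - bd n G v\<close>. The left inverse of \<eta> is induced by an arrow of the
  category, so it respects \<open>D\<close>, and \<open>\<eta> v\<close> agrees with
  \<open>bd n G v\<close> modulo \<open>D\<close>.\<close>

lemma exact_mod_subfunctor_eta:
  assumes G: "fct G" and D: "subfunctor G D" and v: "v \<in> carrier (onO G (ob n))"
    and bd: "bd (Suc n) G (onA G (ob n) (ob (Suc n)) (\<eta> (ob n)) v) \<in> D (ob (Suc (Suc n)))"
  shows "onA G (ob n) (ob (Suc n)) (\<eta> (ob n)) v \<in> bd_sub G D n"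
proof -
  let ?S = "ob (Suc n)"
  let ?SS = "ob (Suc (Suc n))"
  interpret M: abelian_group "onO G ?S"
    by (rule fct_group[OF G ob_obj])
  let ?ev = "onA G (ob n) ?S (\<eta> (ob n)) v"
  have S: "?S \<in> obj C" and SS: "?SS \<in> obj C"
    by (rule ob_obj)+
  have eS: "\<eta> ?S \<in> arr C ?S ?SS"
    using eta_arr[OF S] by simp
  have ev: "?ev \<in> carrier (onO G ?S)"
    using v fct_closed[OF G ob_obj S] eta_arr[OF ob_obj] by simp
  have bv: "bd n G v \<in> carrier (onO G ?S)"
    by (rule bd_closed[OF G v])
  have "bd (Suc n) G ?ev = onA G ?S ?SS (\<eta> ?S) ?ev \<ominus>\<^bsub>onO G ?SS\<^esub> onA G ?S ?SS (\<eta> ?S) (bd n G v)"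
    unfolding bd.simps(2) bd_eta[OF G v] ..
  also have "\<dots> = onA G ?S ?SS (\<eta> ?S) (?ev \<ominus>\<^bsub>onO G ?S\<^esub> bd n G v)"
    using ahom_minus[OF fct_group[OF G S] fct_group[OF G SS] fct_ahom[OF G S SS eS] ev bv] by simp
  finally have inD: "onA G ?S ?SS (\<eta> ?S) (?ev \<ominus>\<^bsub>onO G ?S\<^esub> bd n G v) \<in> D ?SS"
    using bd by simp
  obtain g where "g \<in> arr C c ?S"
    using arr_nonempty S by blast
  then obtain h where h: "h \<in> arr C ?SS ?S" "cmp C ?S ?SS ?S h (\<eta> ?S) = idn C ?S"
    using copair[OF S S idn_arr[OF S]] by auto
  have "onA G ?SS ?S h (onA G ?S ?SS (\<eta> ?S) (?ev \<ominus>\<^bsub>onO G ?S\<^esub> bd n G v)) = ?ev \<ominus>\<^bsub>onO G ?S\<^esub> bd n G v"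
    using fct_cmp[OF G S SS S eS h(1) M.minus_closed[OF ev bv]] h(2)
      fct_idn[OF G S M.minus_closed[OF ev bv]] by simp
  then have "?ev \<ominus>\<^bsub>onO G ?S\<^esub> bd n G v \<in> D ?S"
    using subfunctor_map[OF D SS S h(1) inD] by simp
  moreover have "?ev = bd n G v \<oplus>\<^bsub>onO G ?S\<^esub> (?ev \<ominus>\<^bsub>onO G ?S\<^esub> bd n G v)"
    using M.minus_add_cancel[OF ev bv] M.a_comm[OF bv M.minus_closed[OF ev bv]] by simp
  ultimately show ?thesis
    using v unfolding bd_sub_def by blast
qed

lemma bd_sub_group:
  assumes G: "fct G" and D: "subfunctor G D"
  shows "additive_subgroup (bd_sub G D n) (onO G (ob (Suc n)))"
proof -
  interpret M: abelian_group "onO G (ob (Suc n))" by (rule fct_group[OF G ob_obj])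
  interpret N: abelian_group "onO G (ob n)" by (rule fct_group[OF G ob_obj])
  note hom = bd_ahom[OF G, of n]
  have sg: "additive_subgroup (D (ob (Suc n))) (onO G (ob (Suc n)))"
    by (rule subfunctor_group[OF D ob_obj])
  have sub: "D (ob (Suc n)) \<subseteq> carrier (onO G (ob (Suc n)))"
    by (rule additive_subgroup.a_subset[OF sg])
  show ?thesis
  proof (rule additive_subgroup_minusI[OF M.abelian_group_axioms])
    show "bd_sub G D n \<subseteq> carrier (onO G (ob (Suc n)))"
      using sub bd_closed[OF G] unfolding bd_sub_def by blast
    have "bd n G \<zero>\<^bsub>onO G (ob n)\<^esub> \<oplus>\<^bsub>onO G (ob (Suc n))\<^esub> \<zero>\<^bsub>onO G (ob (Suc n))\<^esub> = \<zero>\<^bsub>onO G (ob (Suc n))\<^esub>"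
      using ahom_zero[OF N.abelian_group_axioms M.abelian_group_axioms hom] M.r_zero[OF M.zero_closed] by (simp only:)
    then show "\<zero>\<^bsub>onO G (ob (Suc n))\<^esub> \<in> bd_sub G D n"
      unfolding bd_sub_def using N.zero_closed additive_subgroup.zero_closed[OF sg]
      by (intro CollectI exI[of _ "\<zero>\<^bsub>onO G (ob n)\<^esub>"] exI[of _ "\<zero>\<^bsub>onO G (ob (Suc n))\<^esub>"]) (simp only: simp_thms)
    fix v w assume "v \<in> bd_sub G D n" "w \<in> bd_sub G D n"
    then obtain u e u' e' where *: "u \<in> carrier (onO G (ob n))" "e \<in> D (ob (Suc n))" "u' \<in> carrier (onO G (ob n))" "e' \<in> D (ob (Suc n))"
      "v = bd n G u \<oplus>\<^bsub>onO G (ob (Suc n))\<^esub> e" "w = bd n G u' \<oplus>\<^bsub>onO G (ob (Suc n))\<^esub> e'"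
      unfolding bd_sub_def by blast
    have "v \<ominus>\<^bsub>onO G (ob (Suc n))\<^esub> w = bd n G (u \<ominus>\<^bsub>onO G (ob n)\<^esub> u') \<oplus>\<^bsub>onO G (ob (Suc n))\<^esub> (e \<ominus>\<^bsub>onO G (ob (Suc n))\<^esub> e')"
      unfolding *(5,6) ahom_minus[OF N.abelian_group_axioms M.abelian_group_axioms hom *(1,3)]
      using bd_closed[OF G *(1)] bd_closed[OF G *(3)] *(2,4) sub by (intro M.add_minus_add) (auto simp del: bd.simps)
    then show "v \<ominus>\<^bsub>onO G (ob (Suc n))\<^esub> w \<in> bd_sub G D n"
      using N.minus_closed[OF *(1,3)] subgroup_minus[OF M.abelian_group_axioms sg *(2,4)] unfolding bd_sub_def by blast
  qed
qed

text \<open>Passing to the difference functor lowers both \<open>k\<close> and the degree by one,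
  which preserves \<open>k \<le> Suc n\<close>. A cocycle of \<open>G\<close> modulo
  \<open>D\<close> is also a cocycle of the difference functor, hence a boundary there by induction.
  This puts \<open>y\<close>, up to a boundary of \<open>G\<close>, into the image of \<eta>, where
  \<open>exact_mod_subfunctor_eta\<close> finishes.\<close>

lemma exact_mod_subfunctor:
  assumes "fct G" "subfunctor G D" "\<And>x. x \<in> obj C \<Longrightarrow> iter_sub k G D x = carrier (onO G ((onO E ^^ k) x))"
    and "k \<le> Suc n" "y \<in> carrier (onO G (ob (Suc n)))" "bd (Suc n) G y \<in> D (ob (Suc (Suc n)))"
  shows "y \<in> bd_sub G D n"
  using assms
proof (induction k arbitrary: G D n y)
  case (0 G D n y)
  interpret M: abelian_group "onO G (ob (Suc n))" by (rule fct_group[OF 0(1) ob_obj])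
  have N: "abelian_group (onO G (ob n))" by (rule fct_group[OF 0(1) ob_obj])
  \<comment> \<open>For \<open>k = 0\<close> the assumption on \<open>iter_sub\<close> says that
    \<open>D\<close> is all of \<open>G\<close>.\<close>
  have "y \<in> D (ob (Suc n))"
    using 0(3)[OF ob_obj[of "Suc n"]] 0(5) by simp
  moreover have "y = bd n G \<zero>\<^bsub>onO G (ob n)\<^esub> \<oplus>\<^bsub>onO G (ob (Suc n))\<^esub> y"
    using ahom_zero[OF N M.abelian_group_axioms bd_ahom[OF 0(1)]] M.l_zero[OF 0(5)] by simp
  ultimately show ?case
    using abelian_monoid.zero_closed[OF abelian_group.axioms(1)[OF N]] unfolding bd_sub_def by blast
next
  case (Suc k G D n y)
  note G = Suc.prems(1) and D = Suc.prems(2) and y = Suc.prems(5)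
  note G' = fct_shift[OF G] and D' = subfunctor_eta_sub[OF G D]
  let ?S = "ob (Suc n)"
  let ?SS = "ob (Suc (Suc n))"
  interpret M: abelian_group "onO G ?S" by (rule fct_group[OF G ob_obj])
  interpret N: abelian_group "onO G (ob n)" by (rule fct_group[OF G ob_obj])
  interpret L: abelian_group "onO G ?SS" by (rule fct_group[OF G ob_obj])
  have S: "?S \<in> obj C" and SS: "?SS \<in> obj C"
    by (rule ob_obj)+
  have eS: "\<eta> ?S \<in> arr C ?S ?SS"
    using eta_arr[OF S] by simp
  have en: "\<eta> (ob n) \<in> arr C (ob n) ?S"
    using eta_arr[OF ob_obj[of n]] by simp
  have iter: "iter_sub k (shift G) (eta_sub G D) x = carrier (onO (shift G) ((onO E ^^ k) x))" if "x \<in> obj C" for x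
    using Suc.prems(3)[OF that] by simp
  let ?b = "bd n (shift G) y"
  have b: "?b \<in> carrier (onO G ?SS)"
    using bd_closed[OF G', of y n] y by simp
  have ey: "onA G ?S ?SS (\<eta> ?S) y \<in> carrier (onO G ?SS)"
    by (rule fct_closed[OF G S SS eS y])
  have subQ: "bd n G w \<in> bd_sub G D n" if "w \<in> carrier (onO G (ob n))" for w
  proof -
    have "bd n G w = bd n G w \<oplus>\<^bsub>onO G ?S\<^esub> \<zero>\<^bsub>onO G ?S\<^esub>"
      using M.r_zero[OF bd_closed[OF G that]] by simp
    then show ?thesis
      unfolding bd_sub_def using that additive_subgroup.zero_closed[OF subfunctor_group[OF D S]] by blast
  qed
  have subD: "e \<in> bd_sub G D n" if "e \<in> D ?S" for e
  proof -
    have e: "e \<in> carrier (onO G ?S)"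
      using that additive_subgroup.a_subset[OF subfunctor_group[OF D S]] by blast
    have "e = bd n G \<zero>\<^bsub>onO G (ob n)\<^esub> \<oplus>\<^bsub>onO G ?S\<^esub> e"
      using ahom_zero[OF N.abelian_group_axioms M.abelian_group_axioms bd_ahom[OF G]] M.l_zero[OF e] by simp
    then show ?thesis
      unfolding bd_sub_def using that N.zero_closed by blast
  qed
  note Q = bd_sub_group[OF G D, of n]
  have "\<exists>v \<in> carrier (onO G (ob n)). y \<ominus>\<^bsub>onO G ?S\<^esub> onA G (ob n) ?S (\<eta> (ob n)) v \<in> bd_sub G D n"
  proof (cases n)
    case 0
    \<comment> \<open>Here \<open>y\<close> has degree 0 for the shifted functor, out of reach of
      the induction hypothesis. But \<open>Suc k \<le> Suc n\<close> forces \<open>k = 0\<close>,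
      and the assumption itself puts \<open>y\<close> into \<open>eta_sub\<close>.\<close>
    then have "y \<in> eta_sub G D c"
      using iter[OF c_obj] y Suc.prems(4) by simp
    then obtain u e where u: "u \<in> carrier (onO G c)" and e: "e \<in> D (onO E c)"
      and yy: "y = onA G c (onO E c) (\<eta> c) u \<oplus>\<^bsub>onO G (onO E c)\<^esub> e"
      by (auto simp: eta_sub_def)
    have "e \<in> carrier (onO G ?S)"
      using e additive_subgroup.a_subset[OF subfunctor_group[OF D S]] 0 by auto
    moreover have "onA G (ob n) ?S (\<eta> (ob n)) u \<in> carrier (onO G ?S)"
      using fct_closed[OF G ob_obj S en] u 0 by simp
    ultimately have "y \<ominus>\<^bsub>onO G ?S\<^esub> onA G (ob n) ?S (\<eta> (ob n)) u = e"
      using yy M.minus_eq_iff[OF y] M.a_comm[of e] 0 by simp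
    then show ?thesis
      using u e subD 0 by auto
  next
    case (Suc m)
    \<comment> \<open>The double difference is \<open>bd n (shift G) y\<close>, written with one
      term in the image of \<eta> and one in \<open>D\<close>. So \<open>y\<close> is a cocycle of
      the difference functor.\<close>
    have "onA G ?S ?SS (\<eta> ?S) y \<ominus>\<^bsub>onO G ?SS\<^esub> (onA G ?S ?SS (\<eta> ?S) y \<ominus>\<^bsub>onO G ?SS\<^esub> ?b) \<in> eta_sub G D ?S"
    proof (rule subgroup_minus[OF L.abelian_group_axioms])
      show "additive_subgroup (eta_sub G D ?S) (onO G ?SS)"
        using subfunctor_group[OF D' S] by simp
      show "onA G ?S ?SS (\<eta> ?S) y \<in> eta_sub G D ?S"
        using eta_sub_image[OF G D S y] by simp
      show "onA G ?S ?SS (\<eta> ?S) y \<ominus>\<^bsub>onO G ?SS\<^esub> ?b \<in> eta_sub G D ?S"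
        using eta_sub_sub[OF G D S] Suc.prems(6) by simp
    qed
    then have "bd n (shift G) y \<in> eta_sub G D ?S"
      using L.minus_minus_cancel[OF ey b] by simp
    then have "y \<in> bd_sub (shift G) (eta_sub G D) m"
      using Suc.IH[OF G' D' iter, of m y] Suc.prems(4) y Suc by simp
    then obtain z t where z: "z \<in> carrier (onO G (ob n))" and t: "t \<in> eta_sub G D (ob n)"
      and yz: "y = bd m (shift G) z \<oplus>\<^bsub>onO G ?S\<^esub> t"
      unfolding bd_sub_def using Suc by auto
    obtain w e where w: "w \<in> carrier (onO G (ob n))" and e: "e \<in> D ?S"
      and tw: "t = onA G (ob n) ?S (\<eta> (ob n)) w \<oplus>\<^bsub>onO G ?S\<^esub> e"
      using t unfolding eta_sub_def by auto
    let ?e = "onA G (ob n) ?S (\<eta> (ob n))"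
    have ez: "?e z \<in> carrier (onO G ?S)" and ew: "?e w \<in> carrier (onO G ?S)"
      using fct_closed[OF G ob_obj S en] z w by auto
    have ec: "e \<in> carrier (onO G ?S)"
      using e additive_subgroup.a_subset[OF subfunctor_group[OF D S]] by blast
    have bz: "bd m (shift G) z \<in> carrier (onO G ?S)"
      using bd_closed[OF G', of z m] z Suc by simp
    have bn: "bd n G z = ?e z \<ominus>\<^bsub>onO G ?S\<^esub> bd m (shift G) z"
      unfolding Suc bd.simps(2) ..
    have "?e (z \<oplus>\<^bsub>onO G (ob n)\<^esub> w) = ?e z \<oplus>\<^bsub>onO G ?S\<^esub> ?e w"
      by (rule ahom_add[OF fct_ahom[OF G ob_obj S en] z w])
    \<comment> \<open>Subtracting the image of \<open>z\<close> along with that of \<open>w\<close>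
      completes \<open>bd m (shift G) z\<close> to a boundary of \<open>G\<close>, up to
      sign.\<close>
    then have "y \<ominus>\<^bsub>onO G ?S\<^esub> ?e (z \<oplus>\<^bsub>onO G (ob n)\<^esub> w) = e \<ominus>\<^bsub>onO G ?S\<^esub> bd n G z"
    proof -
      have bnc: "bd n G z \<in> carrier (onO G ?S)"
        by (rule bd_closed[OF G z])
      have ez': "?e z = bd n G z \<oplus>\<^bsub>onO G ?S\<^esub> bd m (shift G) z"
        using M.minus_add_cancel[OF ez bz] unfolding bn by simp
      show ?thesis
        unfolding \<open>?e (z \<oplus>\<^bsub>onO G (ob n)\<^esub> w) = ?e z \<oplus>\<^bsub>onO G ?S\<^esub> ?e w\<close> yz tw
        by (subst ez') (rule M.minus_add_exchange[OF bnc bz ew ec])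
    qed
    then have "y \<ominus>\<^bsub>onO G ?S\<^esub> ?e (z \<oplus>\<^bsub>onO G (ob n)\<^esub> w) \<in> bd_sub G D n"
      using subgroup_minus[OF M.abelian_group_axioms Q subD[OF e] subQ[OF z]] by (simp only:)
    then show ?thesis
      using N.a_closed[OF z w] by blast
  qed
  then obtain v where v: "v \<in> carrier (onO G (ob n))"
    and yv: "y \<ominus>\<^bsub>onO G ?S\<^esub> onA G (ob n) ?S (\<eta> (ob n)) v \<in> bd_sub G D n"
    by blast
  let ?e = "onA G (ob n) ?S (\<eta> (ob n))"
  have ev: "?e v \<in> carrier (onO G ?S)"
    by (rule fct_closed[OF G ob_obj S en v])
  have hom: "bd (Suc n) G \<in> ahom (onO G ?S) (onO G ?SS)"
    by (rule bd_ahom[OF G])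
  obtain w e where w: "w \<in> carrier (onO G (ob n))" and e: "e \<in> D ?S"
    and yw: "y \<ominus>\<^bsub>onO G ?S\<^esub> ?e v = bd n G w \<oplus>\<^bsub>onO G ?S\<^esub> e"
    using yv unfolding bd_sub_def by blast
  have ec: "e \<in> carrier (onO G ?S)"
    using e additive_subgroup.a_subset[OF subfunctor_group[OF D S]] by blast
  have be: "bd (Suc n) G e \<in> D ?SS"
    by (rule bd_subfunctor[OF G D e])
  have bec: "bd (Suc n) G e \<in> carrier (onO G ?SS)"
    by (rule bd_closed[OF G ec])
  \<comment> \<open>\<open>y\<close> and \<open>\<eta> v\<close> differ by a boundary and an element
    of \<open>D\<close>, so \<open>\<eta> v\<close> inherits from \<open>y\<close> that its
    differential lies in \<open>D\<close>.\<close>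
  have "bd (Suc n) G (y \<ominus>\<^bsub>onO G ?S\<^esub> ?e v) = bd (Suc n) G e"
    using ahom_add[OF hom bd_closed[OF G w] ec] bd_bd[OF G w] L.l_zero[OF bec] yw by (simp only:)
  then have dd: "bd (Suc n) G y \<ominus>\<^bsub>onO G ?SS\<^esub> bd (Suc n) G (?e v) = bd (Suc n) G e"
    using ahom_minus[OF M.abelian_group_axioms L.abelian_group_axioms hom y ev] by (simp only:)
  have "bd (Suc n) G (?e v) = bd (Suc n) G y \<ominus>\<^bsub>onO G ?SS\<^esub> bd (Suc n) G e"
    using L.minus_minus_cancel[OF bd_closed[OF G y] bd_closed[OF G ev]] dd by (simp only:)
  then have "bd (Suc n) G (?e v) \<in> D ?SS"
    using subgroup_minus[OF L.abelian_group_axioms subfunctor_group[OF D SS] Suc.prems(6) be] by (simp only:)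
  then have "?e v \<in> bd_sub G D n"
    by (rule exact_mod_subfunctor_eta[OF G D v])
  then have "(y \<ominus>\<^bsub>onO G ?S\<^esub> ?e v) \<oplus>\<^bsub>onO G ?S\<^esub> ?e v \<in> bd_sub G D n"
    by (rule additive_subgroup.a_closed[OF Q yv])
  then show ?case
    using M.minus_add_cancel[OF y ev] by (simp only:)
qed

lemma zero_subfunctor:
  assumes G: "fct G"
  shows "subfunctor G (\<lambda>x. {\<zero>\<^bsub>onO G x\<^esub>})"
  unfolding subfunctor_def
proof (intro conjI ballI)
  fix x assume "x \<in> obj C"
  then interpret M: abelian_group "onO G x" by (rule fct_group[OF G])
  show "additive_subgroup {\<zero>\<^bsub>onO G x\<^esub>} (onO G x)"
    by (rule additive_subgroup_minusI[OF M.abelian_group_axioms]) auto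
next
  fix x y f assume "x \<in> obj C" "y \<in> obj C" "f \<in> arr C x y"
  then show "onA G x y f ` {\<zero>\<^bsub>onO G x\<^esub>} \<subseteq> {\<zero>\<^bsub>onO G y\<^esub>}"
    using ahom_zero[OF fct_group[OF G] fct_group[OF G] fct_ahom[OF G]] by simp
qed

text \<open>With \<open>D\<close> zero and \<open>k = Suc d\<close> the complex of \<open>F\<close>
  is exact in degrees above \<open>d\<close>. The chase, started at \<open>p = 0\<close> from the
  value of \<open>s\<close> at \<open>c\<close>, yields an element in the kernel of
  \<open>bd 0\<close>, which is the value at \<open>c\<close> of a compatible family.\<close>

lemma higher_lim_vanishes:
  assumes res: "injective_resolution K C F I \<epsilon> \<delta>"
    and iter: "\<And>x. x \<in> obj C \<Longrightarrow>
      iter_sub (Suc d) F (\<lambda>x. {\<zero>\<^bsub>onO F x\<^esub>}) x = carrier (onO F ((onO E ^^ Suc d) x))"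
    and m: "d \<le> m" and s: "s \<in> carrier (lim_module C (I (Suc m)))"
    and ker: "lim_map C (\<delta> (Suc m)) s = \<zero>\<^bsub>lim_module C (I (Suc (Suc m)))\<^esub>"
  shows "s \<in> lim_map C (\<delta> m) ` carrier (lim_module C (I m))"
proof -
  have F: "fct F" and I: "\<And>n. fct (I n)" and \<delta>: "\<And>n. \<delta> n \<in> nat_tr (I n) (I (Suc n))"
    using res unfolding injective_resolution_def injective_functor_def by auto
  have exact: "\<exists>g \<in> carrier (onO F (ob n)). f = bd n F g"
    if "d \<le> n" "f \<in> carrier (onO F (ob (Suc n)))" "bd (Suc n) F f = \<zero>\<^bsub>onO F (ob (Suc (Suc n)))\<^esub>" for n f
  proof -
    interpret M: abelian_group "onO F (ob (Suc n))" by (rule fct_group[OF F ob_obj])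
    have "f \<in> bd_sub F (\<lambda>x. {\<zero>\<^bsub>onO F x\<^esub>}) n"
      by (rule exact_mod_subfunctor[OF F zero_subfunctor[OF F] iter _ that(2)]) (use that in auto)
    then obtain g where g: "g \<in> carrier (onO F (ob n))" "f = bd n F g \<oplus>\<^bsub>onO F (ob (Suc n))\<^esub> \<zero>\<^bsub>onO F (ob (Suc n))\<^esub>"
      unfolding bd_sub_def by blast
    then show ?thesis
      using M.r_zero[OF bd_closed[OF F g(1)]] by auto
  qed
  have sc: "\<delta> (Suc m) c (s c) = \<zero>\<^bsub>onO (I (Suc (Suc m))) c\<^esub>"
    using fun_cong[OF ker, of c] c_obj by (simp add: lim_map_def lim_module_def)
  obtain y where y: "y \<in> carrier (onO (I m) c)" "s c = \<delta> m c y" "bd 0 (I m) y = \<zero>\<^bsub>onO (I m) (ob 1)\<^esub>"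
    using resolution_chase[OF res exact, where p = 0 and m = m and x = "s c"] m lim_in_ker[OF I s] sc by auto
  obtain t where t: "t \<in> carrier (lim_module C (I m))" "t c = y"
    using lim_of_ker[OF I y(1,3)] by blast
  have "lim_map C (\<delta> m) t \<in> carrier (lim_module C (I (Suc m)))"
  proof -
    have tx: "t x \<in> carrier (onO (I m) x)" if "x \<in> obj C" for x
      using t(1) that by (auto simp: lim_module_def)
    have "onA (I m) x y f (t x) = t y" if "x \<in> obj C" "y \<in> obj C" "f \<in> arr C x y" for x y f
      using t(1) that unfolding lim_module_def partial_object.simps by blast
    then show ?thesis
      using nat_tr_app[OF \<delta>[of m], symmetric] ahom_closed[OF nat_tr_ahom[OF \<delta>[of m]]] tx
      by (simp add: lim_module_def lim_map_def)
  qed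
  then have "s = lim_map C (\<delta> m) t"
    using lim_eqI[OF s] t(2) y(2) c_obj by (simp add: lim_map_def)
  then show ?thesis
    using t(1) by blast
qed

end

section \<open>Linear combinations and the lifting property of free modules\<close>

section \<open>Free modules\<close>

lemma ahom_finsum:
  assumes "abelian_group M" "abelian_group N" "f \<in> ahom M N" "g \<in> S \<rightarrow> carrier M"
  shows "f (finsum M g S) = finsum N (\<lambda>i. f (g i)) S"
proof -
  interpret M: abelian_group M by fact
  interpret N: abelian_group N by fact
  show ?thesis
    using assms(4)
  proof (induction S rule: infinite_finite_induct)
    case (insert x S)
    then show ?case
      using ahom_add[OF assms(3)] ahom_closed[OF assms(3)]
      by (subst M.finsum_insert; (subst N.finsum_insert)?) (auto simp: Pi_iff)
  qed (simp_all add: M.finsum_infinite N.finsum_infinite ahom_zero[OF assms(1-3)])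
qed

definition coefs :: "('r, 'k) ring_scheme \<Rightarrow> 'b set \<Rightarrow> ('b \<Rightarrow> 'r) set" where
  "coefs K B = {a \<in> B \<rightarrow>\<^sub>E carrier K. finite {b \<in> B. a b \<noteq> \<zero>\<^bsub>K\<^esub>}}"

text \<open>\<open>h\<close> assigns vectors to the indices: the identity gives the sum in
  \<open>free_module\<close>, and other choices evaluate the same coefficients in another
  module.\<close>

definition lincomb :: "('r, 'k) ring_scheme \<Rightarrow> ('r, 'v) module \<Rightarrow> 'b set \<Rightarrow> ('b \<Rightarrow> 'v) \<Rightarrow> ('b \<Rightarrow> 'r) \<Rightarrow> 'v" where
  "lincomb K M B h a = (\<Oplus>\<^bsub>M\<^esub>b \<in> {b \<in> B. a b \<noteq> \<zero>\<^bsub>K\<^esub>}. a b \<odot>\<^bsub>M\<^esub> h b)"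

lemma free_module_iff:
  "free_module K F \<longleftrightarrow> module K F \<and> (\<exists>B \<subseteq> carrier F. \<forall>x \<in> carrier F.
     \<exists>!a. a \<in> coefs K B \<and> x = lincomb K F B (\<lambda>b. b) a)"
  by (simp add: free_module_def coefs_def lincomb_def)

text \<open>Supports differ from one family of coefficients to another; a common finite superset
  allows term-by-term computation.\<close>

lemma lincomb_superset:
  assumes "module K M" "a \<in> coefs K B" "h \<in> B \<rightarrow> carrier M" "finite S" "{b \<in> B. a b \<noteq> \<zero>\<^bsub>K\<^esub>} \<subseteq> S" "S \<subseteq> B"
  shows "lincomb K M B h a = (\<Oplus>\<^bsub>M\<^esub>b \<in> S. a b \<odot>\<^bsub>M\<^esub> h b)"
proof -
  interpret M: module K M by fact
  show ?thesis
    unfolding lincomb_def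
  proof (rule M.add.finprod_mono_neutral_cong_left)
    show "a i \<odot>\<^bsub>M\<^esub> h i = \<zero>\<^bsub>M\<^esub>" if "i \<in> S - {b \<in> B. a b \<noteq> \<zero>\<^bsub>K\<^esub>}" for i
    proof -
      have "a i = \<zero>\<^bsub>K\<^esub>" "h i \<in> carrier M"
        using that assms by auto
      then show ?thesis
        by simp
    qed
    show "(\<lambda>b. a b \<odot>\<^bsub>M\<^esub> h b) \<in> S \<rightarrow> carrier M"
      using assms by (fastforce simp: coefs_def)
  qed (use assms in auto)
qed

lemma lincomb_closed:
  assumes "module K M" "a \<in> coefs K B" "h \<in> B \<rightarrow> carrier M"
  shows "lincomb K M B h a \<in> carrier M"
proof -
  interpret M: module K M by fact
  show ?thesis
    unfolding lincomb_def using assms(2,3) by (intro M.finsum_closed) (fastforce simp: coefs_def)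
qed

lemma lincomb_add:
  assumes "module K M" "a \<in> coefs K B" "a' \<in> coefs K B" "h \<in> B \<rightarrow> carrier M"
  shows "(\<lambda>b \<in> B. a b \<oplus>\<^bsub>K\<^esub> a' b) \<in> coefs K B"
    "lincomb K M B h (\<lambda>b \<in> B. a b \<oplus>\<^bsub>K\<^esub> a' b) = lincomb K M B h a \<oplus>\<^bsub>M\<^esub> lincomb K M B h a'"
proof -
  interpret M: module K M by fact
  let ?S = "{b \<in> B. a b \<noteq> \<zero>\<^bsub>K\<^esub>} \<union> {b \<in> B. a' b \<noteq> \<zero>\<^bsub>K\<^esub>}"
  let ?s = "\<lambda>b \<in> B. a b \<oplus>\<^bsub>K\<^esub> a' b"
  have fin: "finite ?S"
    using assms by (auto simp: coefs_def)
  have aK: "a b \<in> carrier K" "a' b \<in> carrier K" "h b \<in> carrier M" if "b \<in> B" for b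
    using assms that by (auto simp: coefs_def)
  have sub: "{b \<in> B. ?s b \<noteq> \<zero>\<^bsub>K\<^esub>} \<subseteq> ?S"
    by auto
  then show s: "?s \<in> coefs K B"
    using aK finite_subset[OF sub fin] by (auto simp: coefs_def)
  have "lincomb K M B h ?s = (\<Oplus>\<^bsub>M\<^esub>b \<in> ?S. ?s b \<odot>\<^bsub>M\<^esub> h b)"
    by (rule lincomb_superset[OF assms(1) s assms(4) fin sub]) auto
  also have "\<dots> = (\<Oplus>\<^bsub>M\<^esub>b \<in> ?S. a b \<odot>\<^bsub>M\<^esub> h b \<oplus>\<^bsub>M\<^esub> a' b \<odot>\<^bsub>M\<^esub> h b)"
    using aK by (intro M.finsum_cong') (auto simp: M.smult_l_distr)
  also have "\<dots> = (\<Oplus>\<^bsub>M\<^esub>b \<in> ?S. a b \<odot>\<^bsub>M\<^esub> h b) \<oplus>\<^bsub>M\<^esub> (\<Oplus>\<^bsub>M\<^esub>b \<in> ?S. a' b \<odot>\<^bsub>M\<^esub> h b)"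
    using aK by (intro M.finsum_addf) auto
  also have "(\<Oplus>\<^bsub>M\<^esub>b \<in> ?S. a b \<odot>\<^bsub>M\<^esub> h b) = lincomb K M B h a"
    by (rule lincomb_superset[OF assms(1,2,4) fin, symmetric]) auto
  also have "(\<Oplus>\<^bsub>M\<^esub>b \<in> ?S. a' b \<odot>\<^bsub>M\<^esub> h b) = lincomb K M B h a'"
    by (rule lincomb_superset[OF assms(1,3,4) fin, symmetric]) auto
  finally show "lincomb K M B h ?s = lincomb K M B h a \<oplus>\<^bsub>M\<^esub> lincomb K M B h a'" .
qed

lemma lincomb_smult:
  assumes "module K M" "a \<in> coefs K B" "r \<in> carrier K" "h \<in> B \<rightarrow> carrier M"
  shows "(\<lambda>b \<in> B. r \<otimes>\<^bsub>K\<^esub> a b) \<in> coefs K B"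
    "lincomb K M B h (\<lambda>b \<in> B. r \<otimes>\<^bsub>K\<^esub> a b) = r \<odot>\<^bsub>M\<^esub> lincomb K M B h a"
proof -
  interpret M: module K M by fact
  let ?S = "{b \<in> B. a b \<noteq> \<zero>\<^bsub>K\<^esub>}"
  let ?s = "\<lambda>b \<in> B. r \<otimes>\<^bsub>K\<^esub> a b"
  have fin: "finite ?S"
    using assms by (auto simp: coefs_def)
  have aK: "a b \<in> carrier K" "h b \<in> carrier M" if "b \<in> B" for b
    using assms that by (auto simp: coefs_def)
  have sub: "{b \<in> B. ?s b \<noteq> \<zero>\<^bsub>K\<^esub>} \<subseteq> ?S"
    using assms(3) by auto
  then show s: "?s \<in> coefs K B"
    using aK finite_subset[OF sub fin] assms(3) by (auto simp: coefs_def)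
  have "lincomb K M B h ?s = (\<Oplus>\<^bsub>M\<^esub>b \<in> ?S. ?s b \<odot>\<^bsub>M\<^esub> h b)"
    by (rule lincomb_superset[OF assms(1) s assms(4) fin sub]) auto
  also have "\<dots> = (\<Oplus>\<^bsub>M\<^esub>b \<in> ?S. r \<odot>\<^bsub>M\<^esub> (a b \<odot>\<^bsub>M\<^esub> h b))"
    using aK assms(3) by (intro M.finsum_cong') (auto simp: M.smult_assoc1)
  also have "\<dots> = r \<odot>\<^bsub>M\<^esub> lincomb K M B h a"
    unfolding lincomb_def using aK assms(3) fin by (intro M.finsum_smult_ldistr[symmetric]) auto
  finally show "lincomb K M B h ?s = r \<odot>\<^bsub>M\<^esub> lincomb K M B h a" .
qed

lemma mod_hom_lincomb:
  assumes "module K M" "module K N" "f \<in> mod_hom K M N" "a \<in> coefs K B" "h \<in> B \<rightarrow> carrier M"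
  shows "f (lincomb K M B h a) = lincomb K N B (\<lambda>b. f (h b)) a"
proof -
  interpret M: module K M by fact
  interpret N: module K N by fact
  have aK: "a b \<in> carrier K" "h b \<in> carrier M" if "b \<in> B" for b
    using assms that by (auto simp: coefs_def)
  have "f (lincomb K M B h a) = (\<Oplus>\<^bsub>N\<^esub>b \<in> {b \<in> B. a b \<noteq> \<zero>\<^bsub>K\<^esub>}. f (a b \<odot>\<^bsub>M\<^esub> h b))"
    unfolding lincomb_def
    by (rule ahom_finsum[OF M.abelian_group_axioms N.abelian_group_axioms mod_hom_ahom[OF assms(3)]])
      (use aK in auto)
  also have "\<dots> = lincomb K N B (\<lambda>b. f (h b)) a"
    unfolding lincomb_def using aK
    by (intro N.finsum_cong') (auto simp: mod_hom_smult[OF assms(3)] intro!: N.smult_closed mod_hom_closed[OF assms(3)])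
  finally show ?thesis .
qed

lemma lincomb_cong:
  assumes "module K M" "a \<in> coefs K B" "h \<in> B \<rightarrow> carrier M" "\<And>b. b \<in> B \<Longrightarrow> h b = h' b"
  shows "lincomb K M B h a = lincomb K M B h' a"
proof -
  interpret M: module K M by fact
  have "a b \<in> carrier K" "h' b \<in> carrier M" if "b \<in> B" for b
    using assms that by (auto simp: coefs_def Pi_def)
  then show ?thesis
    unfolding lincomb_def using assms(4) by (intro M.finsum_cong') auto
qed

text \<open>Choose preimages under \<open>q\<close> of the values of \<open>p\<close> on the basis
  and extend linearly. Uniqueness of coordinates makes the coordinate map \<open>cf\<close>
  linear.\<close>

lemma free_module_lift:
  assumes F: "free_module K F" and Y: "module K Y" and A: "module K A"
    and p: "p \<in> mod_hom K F A" and q: "q \<in> mod_hom K Y A" and surj: "q ` carrier Y = carrier A"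
  shows "\<exists>g \<in> mod_hom K F Y. \<forall>x \<in> carrier F. q (g x) = p x"
proof -
  have FM: "module K F"
    using F by (simp add: free_module_iff)
  interpret F: module K F by (rule FM)
  obtain B where B: "B \<subseteq> carrier F"
    and ex1: "\<And>x. x \<in> carrier F \<Longrightarrow> \<exists>!a. a \<in> coefs K B \<and> x = lincomb K F B (\<lambda>b. b) a"
    using F by (auto simp: free_module_iff)
  define cf where "cf x = (THE a. a \<in> coefs K B \<and> x = lincomb K F B (\<lambda>b. b) a)" for x
  have cf: "cf x \<in> coefs K B" "lincomb K F B (\<lambda>b. b) (cf x) = x" if "x \<in> carrier F" for x
    using theI'[OF ex1[OF that]] by (simp_all add: cf_def)
  have cf_eq: "cf (lincomb K F B (\<lambda>b. b) a) = a" if "a \<in> coefs K B" for a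
    unfolding cf_def
    by (rule the1_equality[OF ex1[OF lincomb_closed[OF FM that]]]) (use that B in auto)
  define h where "h b = (SOME y. y \<in> carrier Y \<and> q y = p b)" for b
  have h: "h b \<in> carrier Y \<and> q (h b) = p b" if "b \<in> B" for b
    unfolding h_def
  proof (rule someI_ex)
    have "p b \<in> q ` carrier Y"
      using surj mod_hom_closed[OF p] that B by auto
    then show "\<exists>y. y \<in> carrier Y \<and> q y = p b"
      by auto
  qed
  have hB: "h \<in> B \<rightarrow> carrier Y" and idB: "(\<lambda>b. b) \<in> B \<rightarrow> carrier F"
    using h B by auto
  define g where "g = (\<lambda>x \<in> carrier F. lincomb K Y B h (cf x))"
  have "g \<in> mod_hom K F Y"
  proof (rule mod_homI)
    fix x y assume xy: "x \<in> carrier F" "y \<in> carrier F"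
    have "lincomb K F B (\<lambda>b. b) (\<lambda>b \<in> B. cf x b \<oplus>\<^bsub>K\<^esub> cf y b) = x \<oplus>\<^bsub>F\<^esub> y"
      using lincomb_add(2)[OF FM cf(1)[OF xy(1)] cf(1)[OF xy(2)] idB] cf(2) xy by simp
    then have "cf (x \<oplus>\<^bsub>F\<^esub> y) = (\<lambda>b \<in> B. cf x b \<oplus>\<^bsub>K\<^esub> cf y b)"
      using cf_eq[OF lincomb_add(1)[OF FM cf(1)[OF xy(1)] cf(1)[OF xy(2)] idB]] by simp
    then show "g (x \<oplus>\<^bsub>F\<^esub> y) = g x \<oplus>\<^bsub>Y\<^esub> g y"
      using lincomb_add(2)[OF Y cf(1)[OF xy(1)] cf(1)[OF xy(2)] hB] xy by (simp add: g_def)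
  next
    fix r x assume rx: "r \<in> carrier K" "x \<in> carrier F"
    have "lincomb K F B (\<lambda>b. b) (\<lambda>b \<in> B. r \<otimes>\<^bsub>K\<^esub> cf x b) = r \<odot>\<^bsub>F\<^esub> x"
      using lincomb_smult(2)[OF FM cf(1)[OF rx(2)] rx(1) idB] cf(2) rx by simp
    then have "cf (r \<odot>\<^bsub>F\<^esub> x) = (\<lambda>b \<in> B. r \<otimes>\<^bsub>K\<^esub> cf x b)"
      using cf_eq[OF lincomb_smult(1)[OF FM cf(1)[OF rx(2)] rx(1) idB]] by simp
    then show "g (r \<odot>\<^bsub>F\<^esub> x) = r \<odot>\<^bsub>Y\<^esub> g x"
      using lincomb_smult(2)[OF Y cf(1)[OF rx(2)] rx(1) hB] rx by (simp add: g_def)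
  qed (use lincomb_closed[OF Y cf(1) hB] in \<open>auto simp: g_def\<close>)
  moreover have "q (g x) = p x" if x: "x \<in> carrier F" for x
  proof -
    have "q (g x) = lincomb K A B (\<lambda>b. q (h b)) (cf x)"
      using mod_hom_lincomb[OF Y A q cf(1)[OF x] hB] x by (simp add: g_def)
    also have "\<dots> = lincomb K A B (\<lambda>b. p b) (cf x)"
      using h mod_hom_closed[OF q] by (intro lincomb_cong[OF A cf(1)[OF x]]) auto
    also have "\<dots> = p x"
      using mod_hom_lincomb[OF FM A p cf(1)[OF x] idB] cf(2)[OF x] by simp
    finally show ?thesis .
  qed
  ultimately show ?thesis by blast
qed

section \<open>Direct sums of two modules with coded pairs as elements\<close>

section \<open>Binary direct sums\<close>

text \<open>Modules have their elements in the fixed type \<open>'v\<close>; an injective coding of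
  pairs keeps the direct sum of two modules in that type.\<close>

locale pairing =
  fixes enc :: "'v \<times> 'v \<Rightarrow> 'v"
  assumes inj_enc: "inj enc"
begin

definition dec1 :: "'v \<Rightarrow> 'v" where "dec1 v = fst (inv_into UNIV enc v)"
definition dec2 :: "'v \<Rightarrow> 'v" where "dec2 v = snd (inv_into UNIV enc v)"

lemma dec_enc [simp]: "dec1 (enc (x, y)) = x" "dec2 (enc (x, y)) = y"
  by (simp_all add: dec1_def dec2_def inv_f_f[OF inj_enc])

lemma enc_eq_iff [simp]: "enc u = enc v \<longleftrightarrow> u = v"
  using inj_enc by (simp add: inj_eq)

definition dsum :: "('r, 'v) module \<Rightarrow> ('r, 'v) module \<Rightarrow> ('r, 'v) module" where
  "dsum M N = \<lparr>carrier = enc ` (carrier M \<times> carrier N), mult = undefined, one = undefined,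
     zero = enc (\<zero>\<^bsub>M\<^esub>, \<zero>\<^bsub>N\<^esub>),
     add = (\<lambda>u v. enc (dec1 u \<oplus>\<^bsub>M\<^esub> dec1 v, dec2 u \<oplus>\<^bsub>N\<^esub> dec2 v)),
     smult = (\<lambda>a u. enc (a \<odot>\<^bsub>M\<^esub> dec1 u, a \<odot>\<^bsub>N\<^esub> dec2 u))\<rparr>"

lemma dsum_simps [simp]:
  "enc (x, y) \<in> carrier (dsum M N) \<longleftrightarrow> x \<in> carrier M \<and> y \<in> carrier N"
  "\<zero>\<^bsub>dsum M N\<^esub> = enc (\<zero>\<^bsub>M\<^esub>, \<zero>\<^bsub>N\<^esub>)"
  "enc (x, y) \<oplus>\<^bsub>dsum M N\<^esub> enc (x', y') = enc (x \<oplus>\<^bsub>M\<^esub> x', y \<oplus>\<^bsub>N\<^esub> y')"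
  "a \<odot>\<^bsub>dsum M N\<^esub> enc (x, y) = enc (a \<odot>\<^bsub>M\<^esub> x, a \<odot>\<^bsub>N\<^esub> y)"
  by (auto simp: dsum_def)

lemma dsum_cases:
  assumes "u \<in> carrier (dsum M N)"
  obtains x y where "x \<in> carrier M" "y \<in> carrier N" "u = enc (x, y)"
  using assms by (auto simp: dsum_def)

lemma dsum_module:
  assumes "module K M" "module K N"
  shows "module K (dsum M N)"
proof -
  interpret M: module K M by fact
  interpret N: module K N by fact
  show ?thesis
  proof (rule moduleI[OF M.is_cring abelian_groupI])
    fix u assume "u \<in> carrier (dsum M N)"
    then obtain x y where u: "x \<in> carrier M" "y \<in> carrier N" "u = enc (x, y)"
      by (rule dsum_cases)
    show "\<exists>v \<in> carrier (dsum M N). v \<oplus>\<^bsub>dsum M N\<^esub> u = \<zero>\<^bsub>dsum M N\<^esub>"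
      using u by (intro bexI[of _ "enc (\<ominus>\<^bsub>M\<^esub> x, \<ominus>\<^bsub>N\<^esub> y)"]) (simp_all add: M.l_neg N.l_neg)
  qed (auto elim!: dsum_cases simp: M.a_ac N.a_ac M.smult_l_distr N.smult_l_distr
      M.smult_r_distr N.smult_r_distr M.smult_assoc1 N.smult_assoc1)
qed

lemma dsum_minus:
  assumes "abelian_group M" "abelian_group N" "abelian_group (dsum M N)"
    and "x \<in> carrier M" "y \<in> carrier N" "x' \<in> carrier M" "y' \<in> carrier N"
  shows "enc (x, y) \<ominus>\<^bsub>dsum M N\<^esub> enc (x', y') = enc (x \<ominus>\<^bsub>M\<^esub> x', y \<ominus>\<^bsub>N\<^esub> y')"
proof -
  interpret M: abelian_group M by fact
  interpret N: abelian_group N by fact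
  interpret D: abelian_group "dsum M N" by fact
  show ?thesis
    using assms(4-) by (subst D.minus_eq_iff) (simp_all add: M.minus_add_cancel N.minus_add_cancel)
qed

definition inj1 :: "('r, 'v) module \<Rightarrow> ('r, 'v) module \<Rightarrow> 'v \<Rightarrow> 'v" where
  "inj1 M N = (\<lambda>x \<in> carrier M. enc (x, \<zero>\<^bsub>N\<^esub>))"

definition inj2 :: "('r, 'v) module \<Rightarrow> ('r, 'v) module \<Rightarrow> 'v \<Rightarrow> 'v" where
  "inj2 M N = (\<lambda>y \<in> carrier N. enc (\<zero>\<^bsub>M\<^esub>, y))"

definition copr :: "('r, 'v) module \<Rightarrow> ('r, 'v) module \<Rightarrow> ('r, 'v) module \<Rightarrow> ('v \<Rightarrow> 'v) \<Rightarrow> ('v \<Rightarrow> 'v) \<Rightarrow> 'v \<Rightarrow> 'v" where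
  "copr M N L g f = (\<lambda>u \<in> carrier (dsum M N). g (dec1 u) \<oplus>\<^bsub>L\<^esub> f (dec2 u))"

lemma copr_enc [simp]:
  "x \<in> carrier M \<Longrightarrow> y \<in> carrier N \<Longrightarrow> copr M N L g f (enc (x, y)) = g x \<oplus>\<^bsub>L\<^esub> f y"
  by (simp add: copr_def)

lemma inj1_hom: "module K M \<Longrightarrow> module K N \<Longrightarrow> inj1 M N \<in> mod_hom K M (dsum M N)"
proof -
  assume "module K M" "module K N"
  then interpret M: module K M + N: module K N by auto
  show ?thesis
    by (intro mod_homI) (auto simp: inj1_def)
qed

lemma inj2_hom: "module K M \<Longrightarrow> module K N \<Longrightarrow> inj2 M N \<in> mod_hom K N (dsum M N)"
proof -
  assume "module K M" "module K N"
  then interpret M: module K M + N: module K N by auto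
  show ?thesis
    by (intro mod_homI) (auto simp: inj2_def)
qed

lemma copr_hom:
  assumes "module K M" "module K N" "module K L" and g: "g \<in> mod_hom K M L" and f: "f \<in> mod_hom K N L"
  shows "copr M N L g f \<in> mod_hom K (dsum M N) L"
proof -
  interpret M: module K M by fact
  interpret N: module K N by fact
  interpret L: module K L by fact
  note cl = mod_hom_closed[OF g] mod_hom_closed[OF f]
  show ?thesis
  proof (intro mod_homI)
    show "copr M N L g f \<in> extensional (carrier (dsum M N))"
      by (simp add: copr_def)
  qed (auto elim!: dsum_cases simp: cl mod_hom_add[OF g] mod_hom_add[OF f] mod_hom_smult[OF g] mod_hom_smult[OF f]
        L.a_ac L.smult_r_distr)
qed

text \<open>The union of the two embedded bases is a basis, provided that they do not meet. They
  could meet only in the zero vector, which belongs to a basis only over the zero ring; there every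
  module is zero and the empty basis serves.\<close>

lemma dsum_free:
  assumes "free_module K M" "free_module K N"
  shows "free_module K (dsum M N)"
proof -
  have MM: "module K M" and NM: "module K N"
    using assms by (simp_all add: free_module_iff)
  interpret M: module K M by (rule MM)
  interpret N: module K N by (rule NM)
  have DM: "module K (dsum M N)"
    by (rule dsum_module[OF MM NM])
  interpret D: module K "dsum M N" by (rule DM)
  obtain B1 where B1: "B1 \<subseteq> carrier M"
    and ex1: "\<And>x. x \<in> carrier M \<Longrightarrow> \<exists>!a. a \<in> coefs K B1 \<and> x = lincomb K M B1 (\<lambda>b. b) a"
    using assms(1) by (auto simp: free_module_iff)
  obtain B2 where B2: "B2 \<subseteq> carrier N"
    and ex2: "\<And>x. x \<in> carrier N \<Longrightarrow> \<exists>!a. a \<in> coefs K B2 \<and> x = lincomb K N B2 (\<lambda>b. b) a"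
    using assms(2) by (auto simp: free_module_iff)
  show ?thesis
  proof (cases "\<one>\<^bsub>K\<^esub> = \<zero>\<^bsub>K\<^esub>")
    case True
    have "x = \<zero>\<^bsub>dsum M N\<^esub>" if "x \<in> carrier (dsum M N)" for x
      using D.smult_one[OF that] D.smult_l_null[OF that] True by simp
    then have "x = lincomb K (dsum M N) {} (\<lambda>b. b) a" if "x \<in> carrier (dsum M N)" for x a
      using that by (simp add: lincomb_def)
    moreover have "\<exists>!a. a \<in> coefs K {}"
      by (auto simp: coefs_def)
    ultimately have "\<forall>x \<in> carrier (dsum M N). \<exists>!a. a \<in> coefs K {} \<and> x = lincomb K (dsum M N) {} (\<lambda>b. b) a"
      by auto
    then show ?thesis
      using DM by (auto simp: free_module_iff)
  next
    case False
    \<comment> \<open>Coefficient 0 and coefficient 1 at a zero basis vector would be two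
      representations of the same element.\<close>
    have nonzero: "\<zero>\<^bsub>L\<^esub> \<notin> B" if L: "module K L" and B: "B \<subseteq> carrier L"
      and ex: "\<And>x. x \<in> carrier L \<Longrightarrow> \<exists>!a. a \<in> coefs K B \<and> x = lincomb K L B (\<lambda>b. b) a" for L and B
    proof
      assume z: "\<zero>\<^bsub>L\<^esub> \<in> B"
      interpret L: module K L by (rule L)
      let ?a = "\<lambda>b \<in> B. \<zero>\<^bsub>K\<^esub>" and ?a' = "\<lambda>b \<in> B. if b = \<zero>\<^bsub>L\<^esub> then \<one>\<^bsub>K\<^esub> else \<zero>\<^bsub>K\<^esub>"
      have supp: "{b \<in> B. ?a b \<noteq> \<zero>\<^bsub>K\<^esub>} = {}" "{b \<in> B. ?a' b \<noteq> \<zero>\<^bsub>K\<^esub>} = {\<zero>\<^bsub>L\<^esub>}"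
        using z False by auto
      have "?a \<in> coefs K B" "?a' \<in> coefs K B"
        unfolding coefs_def mem_Collect_eq supp by auto
      moreover have "\<zero>\<^bsub>L\<^esub> = lincomb K L B (\<lambda>b. b) ?a" "\<zero>\<^bsub>L\<^esub> = lincomb K L B (\<lambda>b. b) ?a'"
        unfolding lincomb_def supp using z by simp_all
      ultimately have "?a = ?a'"
        using ex[OF L.zero_closed] by blast
      then have "?a \<zero>\<^bsub>L\<^esub> = ?a' \<zero>\<^bsub>L\<^esub>"
        by (rule fun_cong)
      then show False
        using z False by simp
    qed
    have z1: "\<zero>\<^bsub>M\<^esub> \<notin> B1" and z2: "\<zero>\<^bsub>N\<^esub> \<notin> B2"
      using nonzero[OF MM B1 ex1] nonzero[OF NM B2 ex2] by auto
    let ?i1 = "inj1 M N" and ?i2 = "inj2 M N"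
    let ?B = "?i1 ` B1 \<union> ?i2 ` B2"
    have i1: "?i1 b = enc (b, \<zero>\<^bsub>N\<^esub>)" if "b \<in> B1" for b
      using that B1 by (auto simp: inj1_def)
    have i2: "?i2 b = enc (\<zero>\<^bsub>M\<^esub>, b)" if "b \<in> B2" for b
      using that B2 by (auto simp: inj2_def)
    have inj: "inj_on ?i1 B1" "inj_on ?i2 B2"
      by (auto simp: inj_on_def i1 i2)
    have disj: "?i1 ` B1 \<inter> ?i2 ` B2 = {}"
      using z1 by (auto simp: i1 i2)
    have h1: "?i1 \<in> mod_hom K M (dsum M N)" and h2: "?i2 \<in> mod_hom K N (dsum M N)"
      by (rule inj1_hom[OF MM NM], rule inj2_hom[OF MM NM])
    have sub: "?B \<subseteq> carrier (dsum M N)"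
      using B1 B2 by (auto simp: i1 i2)
    let ?r1 = "\<lambda>a. \<lambda>b \<in> B1. a (?i1 b)" and ?r2 = "\<lambda>a. \<lambda>b \<in> B2. a (?i2 b)"
    \<comment> \<open>Coefficients on the union restrict to each basis and the combination splits
      accordingly. Existence and uniqueness of coordinates thereby reduce to those in
      \<open>M\<close> and in \<open>N\<close>.\<close>
    have split: "?r1 a \<in> coefs K B1 \<and> ?r2 a \<in> coefs K B2 \<and>
        lincomb K (dsum M N) ?B (\<lambda>b. b) a = enc (lincomb K M B1 (\<lambda>b. b) (?r1 a), lincomb K N B2 (\<lambda>b. b) (?r2 a))"
      if a: "a \<in> coefs K ?B" for a
    proof -
      let ?S = "{b \<in> ?B. a b \<noteq> \<zero>\<^bsub>K\<^esub>}" and ?S1 = "{b \<in> B1. ?r1 a b \<noteq> \<zero>\<^bsub>K\<^esub>}" and ?S2 = "{b \<in> B2. ?r2 a b \<noteq> \<zero>\<^bsub>K\<^esub>}"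
      have S: "?S = ?i1 ` ?S1 \<union> ?i2 ` ?S2"
        by auto
      have fin: "finite ?S1" "finite ?S2"
      proof -
        have "finite (?i1 ` ?S1 \<union> ?i2 ` ?S2)"
          using a unfolding coefs_def mem_Collect_eq S by blast
        then show "finite ?S1" "finite ?S2"
          using finite_imageD[OF _ inj_on_subset[OF inj(1)], of ?S1] finite_imageD[OF _ inj_on_subset[OF inj(2)], of ?S2]
          by blast+
      qed
      have aK: "a v \<in> carrier K" if "v \<in> ?B" for v
        using a that unfolding coefs_def by blast
      have r: "?r1 a \<in> coefs K B1" "?r2 a \<in> coefs K B2"
        using fin aK unfolding coefs_def mem_Collect_eq by auto
      have id1: "(\<lambda>b. b) \<in> B1 \<rightarrow> carrier M" and id2: "(\<lambda>b. b) \<in> B2 \<rightarrow> carrier N"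
        using B1 B2 by auto
      let ?t = "\<lambda>b. a b \<odot>\<^bsub>dsum M N\<^esub> b"
      have t: "?t \<in> ?B \<rightarrow> carrier (dsum M N)"
        using aK sub by auto
      have "lincomb K (dsum M N) ?B (\<lambda>b. b) a =
          finsum (dsum M N) ?t (?i1 ` ?S1) \<oplus>\<^bsub>dsum M N\<^esub> finsum (dsum M N) ?t (?i2 ` ?S2)"
        unfolding lincomb_def S
        by (rule D.finsum_Un_disjoint) (use fin disj t in auto)
      also have "finsum (dsum M N) ?t (?i1 ` ?S1) = finsum (dsum M N) (\<lambda>b. ?t (?i1 b)) ?S1"
        by (rule D.finsum_reindex) (use t inj in \<open>auto intro: inj_on_subset\<close>)
      also have "\<dots> = lincomb K (dsum M N) B1 ?i1 (?r1 a)"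
        unfolding lincomb_def by (rule D.finsum_cong') (use t in auto)
      also have "\<dots> = ?i1 (lincomb K M B1 (\<lambda>b. b) (?r1 a))"
        by (rule mod_hom_lincomb[OF MM DM h1 r(1), symmetric]) (use B1 in auto)
      also have "\<dots> = enc (lincomb K M B1 (\<lambda>b. b) (?r1 a), \<zero>\<^bsub>N\<^esub>)"
        using lincomb_closed[OF MM r(1), of "\<lambda>b. b"] B1 by (auto simp: inj1_def)
      also have "finsum (dsum M N) ?t (?i2 ` ?S2) = finsum (dsum M N) (\<lambda>b. ?t (?i2 b)) ?S2"
        by (rule D.finsum_reindex) (use t inj in \<open>auto intro: inj_on_subset\<close>)
      also have "\<dots> = lincomb K (dsum M N) B2 ?i2 (?r2 a)"
        unfolding lincomb_def by (rule D.finsum_cong') (use t in auto)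
      also have "\<dots> = ?i2 (lincomb K N B2 (\<lambda>b. b) (?r2 a))"
        by (rule mod_hom_lincomb[OF NM DM h2 r(2), symmetric]) (use B2 in auto)
      also have "\<dots> = enc (\<zero>\<^bsub>M\<^esub>, lincomb K N B2 (\<lambda>b. b) (?r2 a))"
        using lincomb_closed[OF NM r(2), of "\<lambda>b. b"] B2 by (auto simp: inj2_def)
      finally show ?thesis
        using r
        by (simp only: dsum_simps(3) M.r_zero[OF lincomb_closed[OF MM r(1) id1]] N.l_zero[OF lincomb_closed[OF NM r(2) id2]] simp_thms)
    qed
    have "\<exists>!a. a \<in> coefs K ?B \<and> u = lincomb K (dsum M N) ?B (\<lambda>b. b) a" if u: "u \<in> carrier (dsum M N)" for u
    proof -
      obtain x y where x: "x \<in> carrier M" and y: "y \<in> carrier N" and uxy: "u = enc (x, y)"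
        using u by (rule dsum_cases)
      obtain a1 where a1: "a1 \<in> coefs K B1" "x = lincomb K M B1 (\<lambda>b. b) a1"
        using ex1[OF x] by blast
      obtain a2 where a2: "a2 \<in> coefs K B2" "y = lincomb K N B2 (\<lambda>b. b) a2"
        using ex2[OF y] by blast
      \<comment> \<open>Basis vectors of \<open>N\<close> are nonzero, so the second component
        reveals from which of the two bases \<open>v\<close> comes.\<close>
      let ?a = "\<lambda>v \<in> ?B. if dec2 v = \<zero>\<^bsub>N\<^esub> then a1 (dec1 v) else a2 (dec2 v)"
      have aK: "a1 b \<in> carrier K" if "b \<in> B1" for b
        using a1 that by (auto simp: coefs_def)
      have aK': "a2 b \<in> carrier K" if "b \<in> B2" for b
        using a2 that by (auto simp: coefs_def)
      have v1: "?a (?i1 b) = a1 b" if "b \<in> B1" for b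
        using that by (simp add: i1)
      have v2: "?a (?i2 b) = a2 b" if "b \<in> B2" for b
      proof -
        have "b \<noteq> \<zero>\<^bsub>N\<^esub>" using z2 that by auto
        then show ?thesis using that by (simp add: i2)
      qed
      have "{v \<in> ?B. ?a v \<noteq> \<zero>\<^bsub>K\<^esub>} \<subseteq> ?i1 ` {b \<in> B1. a1 b \<noteq> \<zero>\<^bsub>K\<^esub>} \<union> ?i2 ` {b \<in> B2. a2 b \<noteq> \<zero>\<^bsub>K\<^esub>}"
      proof
        fix v assume v: "v \<in> {v \<in> ?B. ?a v \<noteq> \<zero>\<^bsub>K\<^esub>}"
        then consider b where "b \<in> B1" "v = ?i1 b" | b where "b \<in> B2" "v = ?i2 b"
          by blast
        then show "v \<in> ?i1 ` {b \<in> B1. a1 b \<noteq> \<zero>\<^bsub>K\<^esub>} \<union> ?i2 ` {b \<in> B2. a2 b \<noteq> \<zero>\<^bsub>K\<^esub>}"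
          using v v1 v2 by cases (simp_all only: mem_Collect_eq, blast+)
      qed
      moreover have "finite (?i1 ` {b \<in> B1. a1 b \<noteq> \<zero>\<^bsub>K\<^esub>} \<union> ?i2 ` {b \<in> B2. a2 b \<noteq> \<zero>\<^bsub>K\<^esub>})"
        using a1 a2 by (auto simp: coefs_def)
      ultimately have fin: "finite {v \<in> ?B. ?a v \<noteq> \<zero>\<^bsub>K\<^esub>}"
        by (rule finite_subset)
      have "?a v \<in> carrier K" if "v \<in> ?B" for v
      proof -
        consider b where "b \<in> B1" "v = ?i1 b" | b where "b \<in> B2" "v = ?i2 b"
          using \<open>v \<in> ?B\<close> by blast
        then show ?thesis
          using v1 v2 aK aK' by cases (simp_all only:)
      qed
      then have a: "?a \<in> coefs K ?B"
        using fin unfolding coefs_def mem_Collect_eq by (intro conjI PiE_I) (simp_all only:, simp)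
      have r1: "?r1 ?a = a1"
      proof (rule extensionalityI[of _ B1])
        show "a1 \<in> extensional B1"
          using a1(1) by (simp add: coefs_def PiE_def)
        fix b assume b: "b \<in> B1"
        show "?r1 ?a b = a1 b"
          unfolding restrict_apply'[OF b] by (rule v1[OF b])
      qed (rule restrict_extensional)
      have r2: "?r2 ?a = a2"
      proof (rule extensionalityI[of _ B2])
        show "a2 \<in> extensional B2"
          using a2(1) by (simp add: coefs_def PiE_def)
        fix b assume b: "b \<in> B2"
        show "?r2 ?a b = a2 b"
          unfolding restrict_apply'[OF b] by (rule v2[OF b])
      qed (rule restrict_extensional)
      have eq: "u = lincomb K (dsum M N) ?B (\<lambda>b. b) ?a"
        using split[OF a, unfolded r1 r2] uxy a1(2) a2(2) by (simp only:)
      show ?thesis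
      proof (rule ex1I[of _ ?a])
        show "?a \<in> coefs K ?B \<and> u = lincomb K (dsum M N) ?B (\<lambda>b. b) ?a"
          using a eq by blast
        fix a' assume a': "a' \<in> coefs K ?B \<and> u = lincomb K (dsum M N) ?B (\<lambda>b. b) a'"
        then have "enc (x, y) = enc (lincomb K M B1 (\<lambda>b. b) (?r1 a'), lincomb K N B2 (\<lambda>b. b) (?r2 a'))"
          using split[of a'] uxy by simp
        then have "x = lincomb K M B1 (\<lambda>b. b) (?r1 a')" "y = lincomb K N B2 (\<lambda>b. b) (?r2 a')"
          by simp_all
        then have r1: "?r1 a' = a1" and r2: "?r2 a' = a2"
          using split[of a'] a' a1 a2 ex1[OF x] ex2[OF y] by blast+
        have e1: "a' (?i1 b) = ?a (?i1 b)" if "b \<in> B1" for b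
          using v1[OF that] fun_cong[OF r1, of b] that by simp
        have e2: "a' (?i2 b) = ?a (?i2 b)" if "b \<in> B2" for b
          using v2[OF that] fun_cong[OF r2, of b] that by simp
        show "a' = ?a"
        proof (rule extensionalityI[of _ ?B])
          show "a' \<in> extensional ?B" "?a \<in> extensional ?B"
            using a' by (auto simp: coefs_def PiE_def)
          fix v assume "v \<in> ?B"
          then consider b where "b \<in> B1" "v = ?i1 b" | b where "b \<in> B2" "v = ?i2 b"
            by blast
          then show "a' v = ?a v"
            using e1 e2 by cases (simp_all only:)
        qed
      qed
    qed
    then show ?thesis
      unfolding free_module_iff using DM sub by blast
  qed
qed

end

section \<open>Complete systems of idempotents and elements of cross effects\<close>

section \<open>Cross effects and idempotents\<close>

lemma mod_hom_diff:
  assumes "module K M" "module K N" "f \<in> mod_hom K M N" "g \<in> mod_hom K M N"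
  shows "(\<lambda>x \<in> carrier M. f x \<ominus>\<^bsub>N\<^esub> g x) \<in> mod_hom K M N"
proof -
  interpret M: module K M by fact
  interpret N: module K N by fact
  note cl = mod_hom_closed[OF assms(3)] mod_hom_closed[OF assms(4)]
  have "a \<odot>\<^bsub>N\<^esub> (u \<ominus>\<^bsub>N\<^esub> v) = a \<odot>\<^bsub>N\<^esub> u \<ominus>\<^bsub>N\<^esub> a \<odot>\<^bsub>N\<^esub> v"
    if "a \<in> carrier K" "u \<in> carrier N" "v \<in> carrier N" for a u v
    using that by (simp add: a_minus_def N.smult_r_distr N.smult_r_minus)
  then show ?thesis
    by (intro mod_homI)
      (simp_all add: cl mod_hom_add[OF assms(3)] mod_hom_add[OF assms(4)] mod_hom_smult[OF assms(3)]
        mod_hom_smult[OF assms(4)] N.add_minus_add)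
qed

lemma mod_hom_finsum:
  assumes "module K M" "module K N" "\<And>i. i \<in> I \<Longrightarrow> f i \<in> mod_hom K M N" "finite I"
  shows "(\<lambda>x \<in> carrier M. \<Oplus>\<^bsub>N\<^esub>i \<in> I. f i x) \<in> mod_hom K M N"
proof -
  interpret M: module K M by fact
  interpret N: module K N by fact
  have cl: "(\<lambda>i. f i x) \<in> I \<rightarrow> carrier N" if "x \<in> carrier M" for x
    using assms(3) that by (auto intro: mod_hom_closed)
  show ?thesis
  proof (intro mod_homI)
    fix x y assume xy: "x \<in> carrier M" "y \<in> carrier M"
    have "(\<Oplus>\<^bsub>N\<^esub>i \<in> I. f i (x \<oplus>\<^bsub>M\<^esub> y)) = (\<Oplus>\<^bsub>N\<^esub>i \<in> I. f i x \<oplus>\<^bsub>N\<^esub> f i y)"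
      using cl[OF xy(1)] cl[OF xy(2)] xy by (intro N.finsum_cong') (auto simp: mod_hom_add[OF assms(3)])
    then show "(\<lambda>x \<in> carrier M. \<Oplus>\<^bsub>N\<^esub>i \<in> I. f i x) (x \<oplus>\<^bsub>M\<^esub> y) =
        (\<lambda>x \<in> carrier M. \<Oplus>\<^bsub>N\<^esub>i \<in> I. f i x) x \<oplus>\<^bsub>N\<^esub> (\<lambda>x \<in> carrier M. \<Oplus>\<^bsub>N\<^esub>i \<in> I. f i x) y"
      using xy cl by (simp add: N.finsum_addf)
  next
    fix a x assume ax: "a \<in> carrier K" "x \<in> carrier M"
    have "(\<Oplus>\<^bsub>N\<^esub>i \<in> I. f i (a \<odot>\<^bsub>M\<^esub> x)) = (\<Oplus>\<^bsub>N\<^esub>i \<in> I. a \<odot>\<^bsub>N\<^esub> f i x)"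
      using cl[OF ax(2)] ax by (intro N.finsum_cong') (auto simp: mod_hom_smult[OF assms(3)])
    then show "(\<lambda>x \<in> carrier M. \<Oplus>\<^bsub>N\<^esub>i \<in> I. f i x) (a \<odot>\<^bsub>M\<^esub> x) = a \<odot>\<^bsub>N\<^esub> (\<lambda>x \<in> carrier M. \<Oplus>\<^bsub>N\<^esub>i \<in> I. f i x) x"
      using ax cl[OF ax(2)] assms(4) by (simp add: N.finsum_smult_ldistr)
  qed (use cl N.finsum_closed in auto)
qed

text \<open>Closure under negation comes from the scalar \<open>-1\<close>.\<close>

lemma (in module) submodule_moduleI:
  assumes "H \<subseteq> carrier M" "\<zero>\<^bsub>M\<^esub> \<in> H" "\<And>x y. x \<in> H \<Longrightarrow> y \<in> H \<Longrightarrow> x \<oplus>\<^bsub>M\<^esub> y \<in> H"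
    "\<And>a x. a \<in> carrier R \<Longrightarrow> x \<in> H \<Longrightarrow> a \<odot>\<^bsub>M\<^esub> x \<in> H"
  shows "module R (M\<lparr>carrier := H\<rparr>)"
proof -
  have "\<ominus>\<^bsub>M\<^esub> x \<in> H" if "x \<in> H" for x
  proof -
    have "\<ominus>\<^bsub>M\<^esub> x = (\<ominus>\<^bsub>R\<^esub> \<one>\<^bsub>R\<^esub>) \<odot>\<^bsub>M\<^esub> x"
      using subsetD[OF assms(1) that] by (simp add: smult_l_minus)
    then show ?thesis
      using assms(4)[of "\<ominus>\<^bsub>R\<^esub> \<one>\<^bsub>R\<^esub>" x] that by simp
  qed
  then have "submodule H R M"
    using assms by (intro submoduleI) auto
  then show ?thesis
    by (rule submodule.submodule_is_module) (rule module_axioms)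
qed

lemma image_module:
  assumes "module K M" "module K N" "f \<in> mod_hom K M N"
  shows "module K (N\<lparr>carrier := f ` carrier M\<rparr>)"
proof -
  interpret M: module K M by fact
  interpret N: module K N by fact
  note cl = mod_hom_closed[OF assms(3)]
  show ?thesis
  proof (rule N.submodule_moduleI)
    show "\<zero>\<^bsub>N\<^esub> \<in> f ` carrier M"
      using ahom_zero[OF M.abelian_group_axioms N.abelian_group_axioms mod_hom_ahom[OF assms(3)]]
      by (intro image_eqI[of _ _ "\<zero>\<^bsub>M\<^esub>"]) simp_all
    show "x \<oplus>\<^bsub>N\<^esub> y \<in> f ` carrier M" if "x \<in> f ` carrier M" "y \<in> f ` carrier M" for x y
    proof -
      from that obtain u v where "u \<in> carrier M" "v \<in> carrier M" "x = f u" "y = f v"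
        by blast
      then show ?thesis
        by (intro image_eqI[of _ _ "u \<oplus>\<^bsub>M\<^esub> v"]) (simp_all add: mod_hom_add[OF assms(3)])
    qed
    show "a \<odot>\<^bsub>N\<^esub> x \<in> f ` carrier M" if "a \<in> carrier K" "x \<in> f ` carrier M" for a x
    proof -
      from that(2) obtain u where "u \<in> carrier M" "x = f u"
        by blast
      then show ?thesis
        using that(1) by (intro image_eqI[of _ _ "a \<odot>\<^bsub>M\<^esub> u"]) (simp_all add: mod_hom_smult[OF assms(3)])
    qed
  qed (use cl in auto)
qed

lemma kernel_module:
  assumes "module K M" "module K N" "f \<in> mod_hom K M N"
  shows "module K (M\<lparr>carrier := {x \<in> carrier M. f x = \<zero>\<^bsub>N\<^esub>}\<rparr>)"
proof -
  interpret M: module K M by fact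
  interpret N: module K N by fact
  show ?thesis
    using ahom_zero[OF M.abelian_group_axioms N.abelian_group_axioms mod_hom_ahom[OF assms(3)]]
    by (intro M.submodule_moduleI) (auto simp: mod_hom_add[OF assms(3)] mod_hom_smult[OF assms(3)])
qed

text \<open>An element is the sum of its components, which gives injectivity; a tuple is reached
  from the sum of its entries by orthogonality. The summands are submodules of \<open>S\<close>
  itself, so no coding of tuples is involved.\<close>

lemma direct_sum_of_idempotents:
  assumes S: "module K S" and I: "finite I"
    and hom: "\<And>i. i \<in> I \<Longrightarrow> \<pi> i \<in> mod_hom K S S"
    and orth: "\<And>i j v. i \<in> I \<Longrightarrow> j \<in> I \<Longrightarrow> i \<noteq> j \<Longrightarrow> v \<in> carrier S \<Longrightarrow> \<pi> i (\<pi> j v) = \<zero>\<^bsub>S\<^esub>"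
    and idem: "\<And>i v. i \<in> I \<Longrightarrow> v \<in> carrier S \<Longrightarrow> \<pi> i (\<pi> i v) = \<pi> i v"
    and sum: "\<And>v. v \<in> carrier S \<Longrightarrow> (\<Oplus>\<^bsub>S\<^esub>i \<in> I. \<pi> i v) = v"
    and M: "\<And>i. i \<in> I \<Longrightarrow> M i = S\<lparr>carrier := \<pi> i ` carrier S\<rparr>"
  shows "is_direct_sum K I M S \<pi>"
  unfolding is_direct_sum_def
proof (intro conjI ballI)
  interpret S: module K S by (rule S)
  have cl: "\<pi> i v \<in> carrier S" if "i \<in> I" "v \<in> carrier S" for i v
    using mod_hom_closed[OF hom[OF that(1)] that(2)] .
  fix i assume i: "i \<in> I"
  show "\<pi> i \<in> mod_hom K S (M i)"
    using mod_hom_extensional[OF hom[OF i]] mod_hom_add[OF hom[OF i]] mod_hom_smult[OF hom[OF i]]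
    by (intro mod_homI) (auto simp: M[OF i])
next
  interpret S: module K S by (rule S)
  have cl: "\<pi> i v \<in> carrier S" if "i \<in> I" "v \<in> carrier S" for i v
    using mod_hom_closed[OF hom[OF that(1)] that(2)] .
  show "bij_betw (\<lambda>x. \<lambda>i \<in> I. \<pi> i x) (carrier S) (\<Pi>\<^sub>E i \<in> I. carrier (M i))"
    unfolding bij_betw_def
  proof (intro conjI inj_onI equalityI subsetI)
    fix x y assume x: "x \<in> carrier S" and y: "y \<in> carrier S"
      and eq: "(\<lambda>i \<in> I. \<pi> i x) = (\<lambda>i \<in> I. \<pi> i y)"
    have "\<pi> i x = \<pi> i y" if "i \<in> I" for i
      using fun_cong[OF eq, of i] that by simp
    then have "(\<Oplus>\<^bsub>S\<^esub>i \<in> I. \<pi> i x) = (\<Oplus>\<^bsub>S\<^esub>i \<in> I. \<pi> i y)"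
      using cl[OF _ y] by (intro S.finsum_cong') auto
    then show "x = y"
      using sum x y by simp
  next
    fix t assume "t \<in> (\<lambda>x. \<lambda>i \<in> I. \<pi> i x) ` carrier S"
    then show "t \<in> (\<Pi>\<^sub>E i \<in> I. carrier (M i))"
      by (auto simp: M)
  next
    fix t assume t: "t \<in> (\<Pi>\<^sub>E i \<in> I. carrier (M i))"
    have "t i \<in> \<pi> i ` carrier S" if "i \<in> I" for i
      using t that M[OF that] by (auto simp: PiE_iff)
    then obtain y where y: "y i \<in> carrier S" "t i = \<pi> i (y i)" if "i \<in> I" for i
      unfolding image_iff Bex_def by metis
    have fix': "\<pi> i (t i) = t i" and tS: "t i \<in> carrier S" if "i \<in> I" for i
      using y[OF that] idem[OF that] cl[OF that] by simp_all
    have orth': "\<pi> j (t i) = \<zero>\<^bsub>S\<^esub>" if "i \<in> I" "j \<in> I" "j \<noteq> i" for i j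
      using y[OF that(1)] orth[OF that(2,1,3)] by simp
    let ?x = "\<Oplus>\<^bsub>S\<^esub>i \<in> I. t i"
    have x: "?x \<in> carrier S"
      using tS by (intro S.finsum_closed) auto
    have "\<pi> j ?x = t j" if j: "j \<in> I" for j
    proof -
      have "\<pi> j ?x = (\<Oplus>\<^bsub>S\<^esub>i \<in> I. \<pi> j (t i))"
        by (rule ahom_finsum[OF S.abelian_group_axioms S.abelian_group_axioms mod_hom_ahom[OF hom[OF j]]]) (use tS in auto)
      also have "\<dots> = (\<Oplus>\<^bsub>S\<^esub>i \<in> I. if j = i then t i else \<zero>\<^bsub>S\<^esub>)"
        using j fix' orth' tS by (intro S.finsum_cong') auto
      also have "\<dots> = t j"
        by (rule S.finsum_singleton[OF j I]) (use tS in auto)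
      finally show ?thesis .
    qed
    then have "t = (\<lambda>i \<in> I. \<pi> i ?x)"
      using t by (intro extensionalityI[of _ I]) (auto simp: PiE_def)
    then show "t \<in> (\<lambda>x. \<lambda>i \<in> I. \<pi> i x) ` carrier S"
      using x by blast
  qed
qed (rule S)

text \<open>By \<open>fix_e\<close> the image of \<open>1 - e i\<close> lies in that of
  \<open>\<pi> i\<close>. Hence the projection \<open>q i = 1 - \<pi> i\<close>, which forgets the
  \<open>i\<close>-th summand, satisfies \<open>q i \<circ> e i = q i\<close>, and an element killed
  by \<open>\<Phi> (e i)\<close> is killed by \<open>\<Phi> (q i)\<close>. An element killed in this
  way for all \<open>i\<close> lies in the cross effect.\<close>

lemma cross_effect_of_idempotents:
  assumes cev: "cross_effect_vanishes K U \<Phi> N" and \<Phi>: "is_functor (Mod_cat K U) (Mod_cat K U) \<Phi>"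
    and U: "\<And>X Y. X \<in> U \<Longrightarrow> Y \<subseteq> X \<Longrightarrow> Y \<in> U"
    and S: "module K S" "carrier S \<in> U"
    and hom: "\<And>i. i \<in> {1..N} \<Longrightarrow> \<pi> i \<in> mod_hom K S S"
    and orth: "\<And>i j v. i \<in> {1..N} \<Longrightarrow> j \<in> {1..N} \<Longrightarrow> i \<noteq> j \<Longrightarrow> v \<in> carrier S \<Longrightarrow> \<pi> i (\<pi> j v) = \<zero>\<^bsub>S\<^esub>"
    and idem: "\<And>i v. i \<in> {1..N} \<Longrightarrow> v \<in> carrier S \<Longrightarrow> \<pi> i (\<pi> i v) = \<pi> i v"
    and sum: "\<And>v. v \<in> carrier S \<Longrightarrow> (\<Oplus>\<^bsub>S\<^esub>i \<in> {1..N}. \<pi> i v) = v"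
    and e: "\<And>i. i \<in> {1..N} \<Longrightarrow> e i \<in> mod_hom K S S"
    and fix_e: "\<And>i v. i \<in> {1..N} \<Longrightarrow> v \<in> carrier S \<Longrightarrow> \<pi> i (v \<ominus>\<^bsub>S\<^esub> e i v) = v \<ominus>\<^bsub>S\<^esub> e i v"
    and a: "a \<in> carrier (onO \<Phi> S)" and kill: "\<And>i. i \<in> {1..N} \<Longrightarrow> onA \<Phi> S S (e i) a = \<zero>\<^bsub>onO \<Phi> S\<^esub>"
  shows "a = \<zero>\<^bsub>onO \<Phi> S\<^esub>"
proof -
  interpret S: module K S by (rule S)
  have cl: "\<pi> i v \<in> carrier S" if "i \<in> {1..N}" "v \<in> carrier S" for i v
    using mod_hom_closed[OF hom[OF that(1)] that(2)] .
  have e_cl: "e i v \<in> carrier S" if "i \<in> {1..N}" "v \<in> carrier S" for i v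
    using mod_hom_closed[OF e[OF that(1)] that(2)] .
  define M where "M i = S\<lparr>carrier := \<pi> i ` carrier S\<rparr>" for i
  \<comment> \<open>The kernel of \<open>\<pi> i\<close> serves as the direct sum of the other
    images.\<close>
  define P where "P i = S\<lparr>carrier := {v \<in> carrier S. \<pi> i v = \<zero>\<^bsub>S\<^esub>}\<rparr>" for i
  define \<rho> where "\<rho> i j = restrict (\<pi> j) (carrier (P i))" for i j
  define q where "q i = (\<lambda>v \<in> carrier S. v \<ominus>\<^bsub>S\<^esub> \<pi> i v)" for i
  have Mobj: "M i \<in> obj (Mod_cat K U)" if "i \<in> {1..N}" for i
    using image_module[OF S(1) S(1) hom[OF that]] U[OF S(2) image_subsetI[OF cl[OF that]]]
    by (simp add: M_def Mod_cat_def)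
  have Pmod: "module K (P i)" if "i \<in> {1..N}" for i
    using kernel_module[OF S(1) S(1) hom[OF that]] by (simp add: P_def)
  have Pobj: "P i \<in> obj (Mod_cat K U)" if "i \<in> {1..N}" for i
    using Pmod[OF that] U[OF S(2)] by (auto simp: P_def Mod_cat_def)
  have PS: "v \<in> carrier (P i) \<longleftrightarrow> v \<in> carrier S \<and> \<pi> i v = \<zero>\<^bsub>S\<^esub>" for i v
    by (simp add: P_def)
  have idhom: "(\<lambda>v \<in> carrier S. v) \<in> mod_hom K S S"
    by (intro mod_homI) auto
  have qhom: "q i \<in> mod_hom K S S" if "i \<in> {1..N}" for i
    using mod_hom_diff[OF S(1) S(1) idhom hom[OF that]] by (simp add: q_def cong: restrict_cong)
  have qP: "q i v \<in> carrier (P i)" if "i \<in> {1..N}" "v \<in> carrier S" for i v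
    using that ahom_minus[OF S.abelian_group_axioms S.abelian_group_axioms mod_hom_ahom[OF hom[OF that(1)]] that(2) cl[OF that]]
    by (simp add: PS q_def cl idem)
  have qhomP: "q i \<in> mod_hom K S (P i)" if "i \<in> {1..N}" for i
    using qP[OF that] mod_hom_extensional[OF qhom[OF that]] mod_hom_add[OF qhom[OF that]] mod_hom_smult[OF qhom[OF that]]
    by (intro mod_homI) (auto simp: P_def)
  have dsS: "is_direct_sum K {1..N} M S \<pi>"
    by (rule direct_sum_of_idempotents[OF S(1) _ hom orth idem sum]) (auto simp: M_def)
  have dsP: "is_direct_sum K ({1..N} - {i}) M (P i) (\<rho> i)" if i: "i \<in> {1..N}" for i
  proof (rule direct_sum_of_idempotents[OF Pmod[OF i]])
    fix j assume j: "j \<in> {1..N} - {i}"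
    have \<rho>cl: "\<pi> j v \<in> carrier (P i)" if "v \<in> carrier S" for v
      using that i j cl orth by (auto simp: PS)
    show "\<rho> i j \<in> mod_hom K (P i) (P i)"
      using \<rho>cl mod_hom_add[OF hom] mod_hom_smult[OF hom] j abelian_monoid.a_closed[OF abelian_group.axioms(1)[OF module.axioms(2)[OF Pmod[OF i]]]]
        module.smult_closed[OF Pmod[OF i]]
      by (intro mod_homI) (auto simp: \<rho>_def PS P_def)
    show "M j = P i\<lparr>carrier := \<rho> i j ` carrier (P i)\<rparr>"
    proof -
      have "\<pi> j ` carrier S = \<pi> j ` carrier (P i)"
      proof
        show "\<pi> j ` carrier S \<subseteq> \<pi> j ` carrier (P i)"
        proof
          fix w assume "w \<in> \<pi> j ` carrier S"
          then obtain v where v: "v \<in> carrier S" "w = \<pi> j v"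
            by auto
          then have "w = \<pi> j (\<pi> j v)"
            using idem j by simp
          then show "w \<in> \<pi> j ` carrier (P i)"
            using \<rho>cl[OF v(1)] by blast
        qed
      qed (auto simp: PS)
      also have "\<dots> = \<rho> i j ` carrier (P i)"
        by (auto simp: \<rho>_def)
      finally show ?thesis
        by (simp add: M_def P_def)
    qed
    fix v assume v: "v \<in> carrier (P i)"
    then show "\<rho> i j (\<rho> i j v) = \<rho> i j v"
      using \<rho>cl[of v] j idem by (simp add: \<rho>_def PS)
    fix k assume "k \<in> {1..N} - {i}" "k \<noteq> j"
    then show "\<rho> i k (\<rho> i j v) = \<zero>\<^bsub>P i\<^esub>"
      using v \<rho>cl[of v] j orth by (simp add: \<rho>_def PS) (simp add: P_def)
  next
    fix v assume v: "v \<in> carrier (P i)"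
    then have vS: "v \<in> carrier S" and v0: "\<pi> i v = \<zero>\<^bsub>S\<^esub>"
      by (simp_all add: PS)
    interpret P: module K "P i" by (rule Pmod[OF i])
    \<comment> \<open>The inclusion is additive, so finite sums in the submodule agree with those in
      \<open>S\<close>.\<close>
    have incl: "(\<lambda>x. x) \<in> ahom (P i) S"
      unfolding ahom_iff by (simp add: P_def)
    have cl': "(\<lambda>j. \<rho> i j v) \<in> {1..N} - {i} \<rightarrow> carrier (P i)"
      using v vS cl orth i by (auto simp: \<rho>_def PS)
    have "(\<Oplus>\<^bsub>P i\<^esub>j \<in> {1..N} - {i}. \<rho> i j v) = (\<Oplus>\<^bsub>S\<^esub>j \<in> {1..N} - {i}. \<rho> i j v)"
      using ahom_finsum[OF P.abelian_group_axioms S.abelian_group_axioms incl cl'] .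
    also have "\<dots> = (\<Oplus>\<^bsub>S\<^esub>j \<in> {1..N} - {i}. \<pi> j v)"
      using v cl vS by (intro S.finsum_cong') (auto simp: \<rho>_def)
    also have "\<dots> = (\<Oplus>\<^bsub>S\<^esub>j \<in> insert i ({1..N} - {i}). \<pi> j v)"
      using cl vS i v0 by (subst S.finsum_insert) (auto intro!: S.l_zero[symmetric] S.finsum_closed)
    also have "insert i ({1..N} - {i}) = {1..N}"
      using i by auto
    finally show "(\<Oplus>\<^bsub>P i\<^esub>j \<in> {1..N} - {i}. \<rho> i j v) = v"
      using sum vS by simp
  qed auto
  have \<rho>q: "compose (carrier S) (\<rho> i j) (q i) = \<pi> j" if i: "i \<in> {1..N}" and j: "j \<in> {1..N} - {i}" for i j
  proof (rule extensionalityI[of _ "carrier S"])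
    show "\<pi> j \<in> extensional (carrier S)"
      using mod_hom_extensional[OF hom] j by blast
    fix v assume v: "v \<in> carrier S"
    have "\<pi> j (v \<ominus>\<^bsub>S\<^esub> \<pi> i v) = \<pi> j v \<ominus>\<^bsub>S\<^esub> \<pi> j (\<pi> i v)"
      using ahom_minus[OF S.abelian_group_axioms S.abelian_group_axioms mod_hom_ahom[OF hom]] j v cl[OF i v] by simp
    also have "\<dots> = \<pi> j v"
      using i j v orth cl by simp
    finally show "compose (carrier S) (\<rho> i j) (q i) v = \<pi> j v"
      using qP[OF i v] v by (simp add: compose_def \<rho>_def q_def)
  qed simp
  have Sobj: "S \<in> obj (Mod_cat K U)"
    using S by (simp add: Mod_cat_def)
  have zero: "zero_module (cross_effect \<Phi> N S P q)"
    using cev[unfolded cross_effect_vanishes_def, rule_format, of M S \<pi> P \<rho> q]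
      Mobj Sobj dsS Pobj dsP qhomP \<rho>q by blast
  have qe: "compose (carrier S) (q i) (e i) = q i" if i: "i \<in> {1..N}" for i
  proof (rule extensionalityI[of _ "carrier S"])
    show "q i \<in> extensional (carrier S)"
      by (simp add: q_def)
    fix v assume v: "v \<in> carrier S"
    have "q i v \<ominus>\<^bsub>S\<^esub> q i (e i v) = q i (v \<ominus>\<^bsub>S\<^esub> e i v)"
      using ahom_minus[OF S.abelian_group_axioms S.abelian_group_axioms mod_hom_ahom[OF qhom[OF i]] v e_cl[OF i v]] by simp
    also have "\<dots> = \<zero>\<^bsub>S\<^esub>"
      using fix_e[OF i v] e_cl[OF i v] v by (simp add: q_def)
    finally have "q i v = q i (e i v)"
      using S.minus_eq_zero mod_hom_closed[OF qhom[OF i]] v e_cl[OF i v] by simp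
    then show "compose (carrier S) (q i) (e i) v = q i v"
      using v by (simp add: compose_def)
  qed simp
  have "onA \<Phi> S (P i) (q i) a = \<zero>\<^bsub>onO \<Phi> (P i)\<^esub>" if i: "i \<in> {1..N}" for i
  proof -
    have obj': "onO \<Phi> S \<in> obj (Mod_cat K U)" "onO \<Phi> (P i) \<in> obj (Mod_cat K U)"
      using \<Phi> Sobj Pobj[OF i] by (auto simp: is_functor_def)
    have "q i \<in> arr (Mod_cat K U) S (P i)" "e i \<in> arr (Mod_cat K U) S S"
      using qhomP[OF i] e[OF i] by (simp_all add: Mod_cat_def)
    then have "onA \<Phi> S (P i) (cmp (Mod_cat K U) S S (P i) (q i) (e i)) =
        cmp (Mod_cat K U) (onO \<Phi> S) (onO \<Phi> S) (onO \<Phi> (P i)) (onA \<Phi> S (P i) (q i)) (onA \<Phi> S S (e i))"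
      and qm: "onA \<Phi> S (P i) (q i) \<in> mod_hom K (onO \<Phi> S) (onO \<Phi> (P i))"
      using \<Phi> Sobj Pobj[OF i] by (auto simp: is_functor_def Mod_cat_def)
    then have "onA \<Phi> S (P i) (q i) = compose (carrier (onO \<Phi> S)) (onA \<Phi> S (P i) (q i)) (onA \<Phi> S S (e i))"
      using qe[OF i] by (simp add: Mod_cat_def)
    then have "onA \<Phi> S (P i) (q i) a = onA \<Phi> S (P i) (q i) (onA \<Phi> S S (e i) a)"
      using compose_eq[OF a] by metis
    also have "\<dots> = \<zero>\<^bsub>onO \<Phi> (P i)\<^esub>"
      using kill[OF i] ahom_zero[OF _ _ mod_hom_ahom[OF qm]] obj' by (auto simp: Mod_cat_def module_def)
    finally show ?thesis .
  qed
  then show ?thesis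
    using zero a by (auto simp: zero_module_def cross_effect_def)
qed

text \<open>The maps \<open>1 - e j\<close> are orthogonal idempotents; what they leave over of the identity is
  added as one more summand in place of \<open>1 - e 0\<close>.\<close>

lemma cross_effect_killed:
  assumes cev: "cross_effect_vanishes K U \<Phi> (Suc d)" and \<Phi>: "is_functor (Mod_cat K U) (Mod_cat K U) \<Phi>"
    and U: "\<And>X Y. X \<in> U \<Longrightarrow> Y \<subseteq> X \<Longrightarrow> Y \<in> U"
    and S: "module K S" "carrier S \<in> U"
    and e: "\<And>j. j \<le> d \<Longrightarrow> e j \<in> mod_hom K S S"
    and idem: "\<And>j v. j \<le> d \<Longrightarrow> v \<in> carrier S \<Longrightarrow> e j (e j v) = e j v"
    and fixed: "\<And>i j v. i \<le> d \<Longrightarrow> j \<le> d \<Longrightarrow> i \<noteq> j \<Longrightarrow> v \<in> carrier S \<Longrightarrow> e i (v \<ominus>\<^bsub>S\<^esub> e j v) = v \<ominus>\<^bsub>S\<^esub> e j v"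
    and a: "a \<in> carrier (onO \<Phi> S)" and kill: "\<And>j. j \<le> d \<Longrightarrow> onA \<Phi> S S (e j) a = \<zero>\<^bsub>onO \<Phi> S\<^esub>"
  shows "a = \<zero>\<^bsub>onO \<Phi> S\<^esub>"
proof -
  interpret S: module K S by (rule S)
  note Sg = S.abelian_group_axioms
  define t where "t j = (\<lambda>v \<in> carrier S. v \<ominus>\<^bsub>S\<^esub> e j v)" for j
  have e_cl: "e j v \<in> carrier S" if "j \<le> d" "v \<in> carrier S" for j v
    using mod_hom_closed[OF e[OF that(1)] that(2)] .
  have idhom: "(\<lambda>v \<in> carrier S. v) \<in> mod_hom K S S"
    by (intro mod_homI) auto
  have t: "t j \<in> mod_hom K S S" if "j \<le> d" for j
    using mod_hom_diff[OF S(1) S(1) idhom e[OF that]] by (simp add: t_def cong: restrict_cong)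
  have t_cl: "t j v \<in> carrier S" if "j \<le> d" "v \<in> carrier S" for j v
    using mod_hom_closed[OF t[OF that(1)] that(2)] .
  have tt: "t j (t j v) = t j v" if "j \<le> d" "v \<in> carrier S" for j v
  proof -
    have "e j (t j v) = \<zero>\<^bsub>S\<^esub>"
      using that ahom_minus[OF Sg Sg mod_hom_ahom[OF e[OF that(1)]] that(2) e_cl[OF that]] idem[OF that] e_cl[OF that]
      by (simp add: t_def)
    then show ?thesis
      using t_cl[OF that] by (simp add: t_def[of j])
  qed
  have tt0: "t i (t j v) = \<zero>\<^bsub>S\<^esub>" if "i \<le> d" "j \<le> d" "i \<noteq> j" "v \<in> carrier S" for i j v
    using fixed[OF that] t_cl[OF that(2,4)] that e_cl by (simp add: t_def)
  define s where "s = (\<lambda>v \<in> carrier S. \<Oplus>\<^bsub>S\<^esub>j \<in> {1..d}. t j v)"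
  have s: "s \<in> mod_hom K S S"
    unfolding s_def by (rule mod_hom_finsum[OF S(1) S(1)]) (use t in auto)
  have s_cl: "s v \<in> carrier S" if "v \<in> carrier S" for v
    using mod_hom_closed[OF s that] .
  \<comment> \<open>\<open>s\<close> fixes the images of \<open>t 1\<close>, ..., \<open>t d\<close>
    and kills that of \<open>t 0\<close>, since its summation starts at 1.\<close>
  have st: "s (t i v) = (if i = 0 then \<zero>\<^bsub>S\<^esub> else t i v)" if i: "i \<le> d" and v: "v \<in> carrier S" for i v
  proof -
    have "s (t i v) = (\<Oplus>\<^bsub>S\<^esub>j \<in> {1..d}. t j (t i v))"
      using t_cl[OF that] by (simp add: s_def)
    also have "\<dots> = (\<Oplus>\<^bsub>S\<^esub>j \<in> {1..d}. if i = j then t j v else \<zero>\<^bsub>S\<^esub>)"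
      using i v tt tt0 t_cl by (intro S.finsum_cong') auto
    also have "\<dots> = (if i = 0 then \<zero>\<^bsub>S\<^esub> else t i v)"
    proof (cases "i = 0")
      case True
      have "(\<Oplus>\<^bsub>S\<^esub>j \<in> {1..d}. if i = j then t j v else \<zero>\<^bsub>S\<^esub>) = (\<Oplus>\<^bsub>S\<^esub>j \<in> {1..d}. \<zero>\<^bsub>S\<^esub>)"
        using True by (intro S.finsum_cong') auto
      then show ?thesis
        using True by simp
    next
      case False
      then show ?thesis
        using i v t_cl S.finsum_singleton[of i "{1..d}" "\<lambda>j. t j v"] by simp
    qed
    finally show ?thesis .
  qed
  have ts: "t i (s v) = t i v" if i: "i \<in> {1..d}" and v: "v \<in> carrier S" for i v
  proof -
    have "t i (s v) = (\<Oplus>\<^bsub>S\<^esub>j \<in> {1..d}. t i (t j v))"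
      using v ahom_finsum[OF Sg Sg mod_hom_ahom[OF t], of i "\<lambda>j. t j v" "{1..d}"] t_cl i by (simp add: s_def)
    also have "\<dots> = (\<Oplus>\<^bsub>S\<^esub>j \<in> {1..d}. if i = j then t j v else \<zero>\<^bsub>S\<^esub>)"
      using i v tt tt0 t_cl by (intro S.finsum_cong') auto
    also have "\<dots> = t i v"
      using i v t_cl by (intro S.finsum_singleton) auto
    finally show ?thesis .
  qed
  have ss: "s (s v) = s v" if v: "v \<in> carrier S" for v
  proof -
    have "s (s v) = (\<Oplus>\<^bsub>S\<^esub>j \<in> {1..d}. t j (s v))"
      using s_cl[OF v] by (simp add: s_def)
    also have "\<dots> = (\<Oplus>\<^bsub>S\<^esub>j \<in> {1..d}. t j v)"
      using v ts t_cl by (intro S.finsum_cong') auto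
    finally show ?thesis
      using v by (simp add: s_def)
  qed
  \<comment> \<open>Summands are numbered from 1 and the maps \<open>e\<close> from 0. The maps
    \<open>t 0\<close>, ..., \<open>t d\<close> and their complement would give \<open>d + 2\<close>
    pieces; merging \<open>t 0\<close> with the complement leaves exactly \<open>Suc d\<close>. The
    image of \<open>t 0\<close> lies in that of \<open>\<pi> 1\<close>, as required of
    \<open>e 0\<close>.\<close>
  define \<pi> where "\<pi> i = (if i = 1 then (\<lambda>v \<in> carrier S. v \<ominus>\<^bsub>S\<^esub> s v) else t (i - 1))" for i :: nat
  have p1: "\<pi> 1 v = v \<ominus>\<^bsub>S\<^esub> s v" if "v \<in> carrier S" for v
    using that by (simp add: \<pi>_def)
  have pj: "\<pi> (Suc i) = t i" if "i \<in> {1..d}" for i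
    using that by (simp add: \<pi>_def)
  have p1_cl: "\<pi> 1 v \<in> carrier S" if "v \<in> carrier S" for v
    using that s_cl by (simp add: p1 del: One_nat_def)
  have idx: "i = 1 \<or> (\<exists>j \<in> {1..d}. i = Suc j)" if "i \<in> {1..Suc d}" for i
    using that by (cases i) auto
  have sp1: "s (\<pi> 1 v) = \<zero>\<^bsub>S\<^esub>" if v: "v \<in> carrier S" for v
    using ahom_minus[OF Sg Sg mod_hom_ahom[OF s] v s_cl[OF v]] ss[OF v] s_cl[OF v] v by (simp add: p1 del: One_nat_def)
  have tp1: "t i (\<pi> 1 v) = \<zero>\<^bsub>S\<^esub>" if "i \<in> {1..d}" "v \<in> carrier S" for i v
    using ahom_minus[OF Sg Sg mod_hom_ahom[OF t] that(2) s_cl[OF that(2)], of i] ts[OF that] t_cl that by (simp add: p1 del: One_nat_def)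
  have p1t: "\<pi> 1 (t i v) = (if i = 0 then t i v else \<zero>\<^bsub>S\<^esub>)" if "i \<le> d" "v \<in> carrier S" for i v
    using that st[OF that] t_cl[OF that] by (cases "i = 0") (simp_all add: p1 del: One_nat_def)
  show ?thesis
  proof (rule cross_effect_of_idempotents[OF cev \<Phi> _ S, where \<pi> = \<pi> and e = "\<lambda>i. e (i - 1)"])
    show "\<pi> i \<in> mod_hom K S S" if i: "i \<in> {1..Suc d}" for i
      using mod_hom_diff[OF S(1) S(1) idhom s] t[of "i - 1"] i by (auto simp: \<pi>_def cong: restrict_cong)
    show "\<pi> i (\<pi> j v) = \<zero>\<^bsub>S\<^esub>" if "i \<in> {1..Suc d}" "j \<in> {1..Suc d}" "i \<noteq> j" "v \<in> carrier S" for i j v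
    proof -
      from idx[OF that(1)] idx[OF that(2)] that(3)
      consider (a) b where "i = 1" "b \<in> {1..d}" "j = Suc b" | (b) b where "j = 1" "b \<in> {1..d}" "i = Suc b"
        | (c) b c where "b \<in> {1..d}" "c \<in> {1..d}" "i = Suc b" "j = Suc c" "b \<noteq> c"
        by blast
      then show ?thesis
      proof cases
        case a
        then show ?thesis using p1t[of b v] that(4) by (simp add: pj del: One_nat_def)
      next
        case b
        then show ?thesis using tp1[OF b(2) that(4)] by (simp add: pj del: One_nat_def)
      next
        case c
        then show ?thesis using tt0[of b c v] that(4) by (simp add: pj)
      qed
    qed
    show "\<pi> i (\<pi> i v) = \<pi> i v" if "i \<in> {1..Suc d}" "v \<in> carrier S" for i v
      using idx[OF that(1)] that(2) tt p1[OF p1_cl[OF that(2)]] sp1[OF that(2)] p1_cl[OF that(2)]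
      by (auto simp: pj simp del: One_nat_def)
    show "(\<Oplus>\<^bsub>S\<^esub>i \<in> {1..Suc d}. \<pi> i v) = v" if v: "v \<in> carrier S" for v
    proof -
      have cl: "(\<lambda>j. \<pi> (Suc j) v) \<in> {1..d} \<rightarrow> carrier S"
        using pj t_cl v by auto
      have "{1..Suc d} = insert 1 (Suc ` {1..d})"
        unfolding image_Suc_atLeastAtMost by auto
      then have "(\<Oplus>\<^bsub>S\<^esub>i \<in> {1..Suc d}. \<pi> i v) = (\<Oplus>\<^bsub>S\<^esub>i \<in> insert 1 (Suc ` {1..d}). \<pi> i v)"
        by simp
      also have "\<dots> = \<pi> 1 v \<oplus>\<^bsub>S\<^esub> (\<Oplus>\<^bsub>S\<^esub>i \<in> Suc ` {1..d}. \<pi> i v)"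
        using p1_cl[OF v] cl by (intro S.finsum_insert) (auto simp del: image_Suc_atLeastAtMost)
      also have "(\<Oplus>\<^bsub>S\<^esub>i \<in> Suc ` {1..d}. \<pi> i v) = (\<Oplus>\<^bsub>S\<^esub>j \<in> {1..d}. \<pi> (Suc j) v)"
        using cl by (intro S.finsum_reindex) (auto simp del: image_Suc_atLeastAtMost)
      also have "\<dots> = s v"
        unfolding s_def restrict_apply'[OF v] using pj t_cl v by (intro S.finsum_cong') auto
      also have "\<pi> 1 v \<oplus>\<^bsub>S\<^esub> s v = v"
        using v s_cl by (simp add: p1 S.minus_add_cancel del: One_nat_def)
      finally show ?thesis .
    qed
    show "e (i - 1) \<in> mod_hom K S S" if "i \<in> {1..Suc d}" for i
      using that e by auto
    show "\<pi> i (v \<ominus>\<^bsub>S\<^esub> e (i - 1) v) = v \<ominus>\<^bsub>S\<^esub> e (i - 1) v" if "i \<in> {1..Suc d}" "v \<in> carrier S" for i v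
    proof -
      have "v \<ominus>\<^bsub>S\<^esub> e (i - 1) v = t (i - 1) v"
        using that by (simp add: t_def)
      then show ?thesis
        using idx[OF that(1)] that(2) tt p1t[of 0] by (auto simp: pj simp del: One_nat_def)
    qed
    show "onA \<Phi> S S (e (i - 1)) a = \<zero>\<^bsub>onO \<Phi> S\<^esub>" if "i \<in> {1..Suc d}" for i
      using that kill by auto
  qed (erule (1) U, rule a)
qed

text \<open>The product of the operators \<open>1 - \<Phi> (e j)\<close> sends \<open>a\<close> to
  an element killed by every \<open>\<Phi> (e j)\<close>, which is zero by
  \<open>cross_effect_killed\<close>. Expanded, the product is the identity up to terms in the
  images of the \<open>\<Phi> (e j)\<close>, so \<open>a\<close> lies in \<open>H\<close>. Since
  \<Phi> need not be additive, the differences are formed after applying it.\<close>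

lemma polynomial_generated_by_idempotents:
  assumes cev: "cross_effect_vanishes K U \<Phi> (Suc d)" and \<Phi>: "is_functor (Mod_cat K U) (Mod_cat K U) \<Phi>"
    and U: "\<And>X Y. X \<in> U \<Longrightarrow> Y \<subseteq> X \<Longrightarrow> Y \<in> U"
    and S: "module K S" "carrier S \<in> U"
    and e: "\<And>j. j \<le> d \<Longrightarrow> e j \<in> mod_hom K S S"
    and idem: "\<And>j v. j \<le> d \<Longrightarrow> v \<in> carrier S \<Longrightarrow> e j (e j v) = e j v"
    and fixed: "\<And>i j v. i \<le> d \<Longrightarrow> j \<le> d \<Longrightarrow> i \<noteq> j \<Longrightarrow> v \<in> carrier S \<Longrightarrow> e i (v \<ominus>\<^bsub>S\<^esub> e j v) = v \<ominus>\<^bsub>S\<^esub> e j v"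
    and H: "additive_subgroup H (onO \<Phi> S)"
    and im: "\<And>j u. j \<le> d \<Longrightarrow> u \<in> carrier (onO \<Phi> S) \<Longrightarrow> onA \<Phi> S S (e j) u \<in> H"
    and a: "a \<in> carrier (onO \<Phi> S)"
  shows "a \<in> H"
proof -
  interpret S: module K S by (rule S)
  note Sg = S.abelian_group_axioms
  have Sobj: "S \<in> obj (Mod_cat K U)"
    using S by (simp add: Mod_cat_def)
  then have "module K (onO \<Phi> S)"
    using \<Phi> by (auto simp: is_functor_def Mod_cat_def)
  then interpret F: module K "onO \<Phi> S" .
  have earr: "e j \<in> arr (Mod_cat K U) S S" if "j \<le> d" for j
    using e[OF that] by (simp add: Mod_cat_def)
  have e_cl: "e j v \<in> carrier S" if "j \<le> d" "v \<in> carrier S" for j v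
    using mod_hom_closed[OF e[OF that(1)] that(2)] .
  let ?\<Phi> = "\<lambda>j. onA \<Phi> S S (e j)"
  have ehom: "?\<Phi> j \<in> mod_hom K (onO \<Phi> S) (onO \<Phi> S)" if "j \<le> d" for j
    using \<Phi> Sobj earr[OF that] by (auto simp: is_functor_def Mod_cat_def)
  have \<Phi>_cl: "?\<Phi> j u \<in> carrier (onO \<Phi> S)" if "j \<le> d" "u \<in> carrier (onO \<Phi> S)" for j u
    using mod_hom_closed[OF ehom[OF that(1)] that(2)] .
  have \<Phi>cmp: "?\<Phi> i (?\<Phi> j u) = onA \<Phi> S S (compose (carrier S) (e i) (e j)) u"
    if "i \<le> d" "j \<le> d" "u \<in> carrier (onO \<Phi> S)" for i j u
  proof -
    have "onA \<Phi> S S (cmp (Mod_cat K U) S S S (e i) (e j)) =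
        cmp (Mod_cat K U) (onO \<Phi> S) (onO \<Phi> S) (onO \<Phi> S) (?\<Phi> i) (?\<Phi> j)"
      using \<Phi> Sobj earr that by (auto simp: is_functor_def)
    then show ?thesis
      using that by (simp add: Mod_cat_def compose_def)
  qed
  have ext: "compose (carrier S) (e i) (e j) = g" if "g \<in> extensional (carrier S)" "\<And>v. v \<in> carrier S \<Longrightarrow> e i (e j v) = g v" for i j g
    using that by (intro extensionalityI[of _ "carrier S"]) (auto simp: compose_def)
  have \<Phi>idem: "?\<Phi> j (?\<Phi> j u) = ?\<Phi> j u" if "j \<le> d" "u \<in> carrier (onO \<Phi> S)" for j u
    using \<Phi>cmp[OF that(1) that] ext[OF mod_hom_extensional[OF e[OF that(1)]] idem] that by simp
  \<comment> \<open>For \<open>i \<noteq> j\<close> the assumption \<open>fixed\<close> gives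
    \<open>e i \<circ> e j = e i + e j - 1\<close>, which is symmetric in \<open>i\<close> and
    \<open>j\<close>.\<close>
  have comm: "e i (e j v) = e j (e i v)" if "i \<le> d" "j \<le> d" "v \<in> carrier S" for i j v
  proof (cases "i = j")
    case False
    have 1: "e i (e j v) = e i v \<ominus>\<^bsub>S\<^esub> (v \<ominus>\<^bsub>S\<^esub> e j v)" if "i \<le> d" "j \<le> d" "i \<noteq> j" for i j
    proof -
      have "e i v \<ominus>\<^bsub>S\<^esub> e i (e j v) = v \<ominus>\<^bsub>S\<^esub> e j v"
        using fixed[OF that \<open>v \<in> carrier S\<close>] ahom_minus[OF Sg Sg mod_hom_ahom[OF e[OF that(1)]] \<open>v \<in> carrier S\<close> e_cl] that \<open>v \<in> carrier S\<close> by simp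
      then show ?thesis
        using S.minus_minus_cancel[of "e i v" "e i (e j v)"] e_cl that \<open>v \<in> carrier S\<close> by simp
    qed
    have 2: "x \<ominus>\<^bsub>S\<^esub> (v \<ominus>\<^bsub>S\<^esub> y) = y \<ominus>\<^bsub>S\<^esub> (v \<ominus>\<^bsub>S\<^esub> x)" if "x \<in> carrier S" "y \<in> carrier S" for x y
      using that \<open>v \<in> carrier S\<close> by (simp add: a_minus_def S.minus_add S.a_ac)
    show ?thesis
      using 1[of i j] 1[of j i] 2[of "e i v" "e j v"] False that e_cl by simp
  qed simp
  have \<Phi>comm: "?\<Phi> i (?\<Phi> j u) = ?\<Phi> j (?\<Phi> i u)" if "i \<le> d" "j \<le> d" "u \<in> carrier (onO \<Phi> S)" for i j u
  proof -
    have "compose (carrier S) (e i) (e j) = compose (carrier S) (e j) (e i)"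
      using comm[OF that(1,2)] by (auto simp: compose_def)
    then show ?thesis
      using \<Phi>cmp[OF that(1,2,3)] \<Phi>cmp[OF that(2,1,3)] by simp
  qed
  have Hc: "H \<subseteq> carrier (onO \<Phi> S)"
    using additive_subgroup.a_subset[OF H] .
  \<comment> \<open>The factors of the product are applied one at a time; commutation keeps the
    earlier \<open>\<Phi> (e j)\<close> zero on the new element.\<close>
  have "\<exists>b \<in> carrier (onO \<Phi> S). a \<ominus>\<^bsub>onO \<Phi> S\<^esub> b \<in> H \<and> (\<forall>j < m. ?\<Phi> j b = \<zero>\<^bsub>onO \<Phi> S\<^esub>)" if "m \<le> Suc d" for m
    using that
  proof (induction m)
    case 0
    then show ?case
      using a additive_subgroup.zero_closed[OF H] by (intro bexI[of _ a]) simp_all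
  next
    case (Suc m)
    then obtain b where b: "b \<in> carrier (onO \<Phi> S)" "a \<ominus>\<^bsub>onO \<Phi> S\<^esub> b \<in> H" "\<forall>j < m. ?\<Phi> j b = \<zero>\<^bsub>onO \<Phi> S\<^esub>"
      by auto
    have m: "m \<le> d" using Suc.prems by simp
    let ?b = "b \<ominus>\<^bsub>onO \<Phi> S\<^esub> ?\<Phi> m b"
    note fb = \<Phi>_cl[OF m b(1)]
    have "a \<ominus>\<^bsub>onO \<Phi> S\<^esub> ?b = (a \<ominus>\<^bsub>onO \<Phi> S\<^esub> b) \<oplus>\<^bsub>onO \<Phi> S\<^esub> ?\<Phi> m b"
      using a b(1) fb by (simp add: a_minus_def F.minus_add F.a_ac)
    then have "a \<ominus>\<^bsub>onO \<Phi> S\<^esub> ?b \<in> H"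
      using additive_subgroup.a_closed[OF H b(2) im[OF m b(1)]] by simp
    moreover have "?\<Phi> j ?b = \<zero>\<^bsub>onO \<Phi> S\<^esub>" if "j < Suc m" for j
    proof -
      have j: "j \<le> d" using that m by simp
      have "?\<Phi> j ?b = ?\<Phi> j b \<ominus>\<^bsub>onO \<Phi> S\<^esub> ?\<Phi> j (?\<Phi> m b)"
        by (rule ahom_minus[OF F.abelian_group_axioms F.abelian_group_axioms mod_hom_ahom[OF ehom[OF j]] b(1) fb])
      also have "\<dots> = \<zero>\<^bsub>onO \<Phi> S\<^esub>"
      proof (cases "j = m")
        case True
        then show ?thesis
          using \<Phi>idem[OF m b(1)] fb by simp
      next
        case False
        then have "?\<Phi> j b = \<zero>\<^bsub>onO \<Phi> S\<^esub>"
          using that b(3) by simp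
        moreover have "?\<Phi> j (?\<Phi> m b) = \<zero>\<^bsub>onO \<Phi> S\<^esub>"
          using \<Phi>comm[OF j m b(1)] ahom_zero[OF F.abelian_group_axioms F.abelian_group_axioms mod_hom_ahom[OF ehom[OF m]]]
            \<open>?\<Phi> j b = \<zero>\<^bsub>onO \<Phi> S\<^esub>\<close> by simp
        ultimately show ?thesis by simp
      qed
      finally show ?thesis .
    qed
    ultimately show ?case
      using F.minus_closed[OF b(1) fb] by blast
  qed
  from this[of "Suc d"] obtain b where b: "b \<in> carrier (onO \<Phi> S)" "a \<ominus>\<^bsub>onO \<Phi> S\<^esub> b \<in> H"
    "\<And>j. j \<le> d \<Longrightarrow> ?\<Phi> j b = \<zero>\<^bsub>onO \<Phi> S\<^esub>"
    by (auto simp: less_Suc_eq_le)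
  have "b = \<zero>\<^bsub>onO \<Phi> S\<^esub>"
    by (rule cross_effect_killed[OF cev \<Phi> _ S e idem fixed b(1,3)]) (erule (1) U)
  then show ?thesis
    using b(2) a by simp
qed

section \<open>Groups of compatible families and the cohomology of their complex\<close>

section \<open>Limits\<close>

text \<open>Each coset of \<open>N\<close> by an element of \<open>Z\<close> is \<open>N\<close>
  itself, which is the zero of the quotient.\<close>

lemma quotient_module_zero:
  assumes L: "abelian_group L" and N: "additive_subgroup N L" and Z: "Z \<subseteq> N" "Z \<noteq> {}"
  shows "zero_module (quotient_module (L\<lparr>carrier := Z\<rparr>) N)"
proof -
  interpret L: abelian_group L by (rule L)
  have Nc: "x \<in> carrier L" if "x \<in> N" for x
    using additive_subgroup.a_subset[OF N] that by blast
  have "(\<Union>h \<in> N. {h \<oplus>\<^bsub>L\<^esub> z}) = N" if z: "z \<in> N" for z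
  proof
    show "(\<Union>h \<in> N. {h \<oplus>\<^bsub>L\<^esub> z}) \<subseteq> N"
      using additive_subgroup.a_closed[OF N _ z] by auto
    show "N \<subseteq> (\<Union>h \<in> N. {h \<oplus>\<^bsub>L\<^esub> z})"
    proof
      fix h assume h: "h \<in> N"
      have "h = (h \<ominus>\<^bsub>L\<^esub> z) \<oplus>\<^bsub>L\<^esub> z"
        using L.minus_add_cancel[OF Nc[OF h] Nc[OF z]] by simp
      moreover have "h \<ominus>\<^bsub>L\<^esub> z \<in> N"
        by (rule subgroup_minus[OF L N h z])
      ultimately show "h \<in> (\<Union>h \<in> N. {h \<oplus>\<^bsub>L\<^esub> z})"
        by blast
    qed
  qed
  then have "a_rcosets\<^bsub>L\<lparr>carrier := Z\<rparr>\<^esub> N = {N}"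
    using Z by (auto simp: A_RCOSETS_def' a_r_coset_def')
  then show ?thesis
    by (simp add: zero_module_def quotient_module_def)
qed

lemma lim_module_group:
  assumes G: "is_functor C (Mod_cat K UNIV) G"
  shows "abelian_group (lim_module C G)"
proof (rule abelian_groupI)
  have grp: "abelian_group (onO G x)" if "x \<in> obj C" for x
    using G that by (auto simp: is_functor_def Mod_cat_def intro: module.axioms(2))
  have hom: "onA G x y f \<in> ahom (onO G x) (onO G y)" if "x \<in> obj C" "y \<in> obj C" "f \<in> arr C x y" for x y f
    by (rule mod_hom_ahom[of _ K]) (use G that in \<open>simp add: is_functor_def Mod_cat_def\<close>)
  have mon: "abelian_monoid (onO G x)" if "x \<in> obj C" for x
    using grp[OF that] by (rule abelian_group.axioms(1))
  let ?L = "lim_module C G"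
  have Lc: "s \<in> carrier ?L \<longleftrightarrow> s \<in> extensional (obj C) \<and> (\<forall>x \<in> obj C. s x \<in> carrier (onO G x)) \<and>
      (\<forall>x \<in> obj C. \<forall>y \<in> obj C. \<forall>f \<in> arr C x y. onA G x y f (s x) = s y)" for s
    by (auto simp: lim_module_def PiE_def Pi_def)
  have Ladd: "s \<oplus>\<^bsub>?L\<^esub> t = (\<lambda>x \<in> obj C. s x \<oplus>\<^bsub>onO G x\<^esub> t x)" for s t
    by (simp add: lim_module_def)
  have Lzero: "\<zero>\<^bsub>?L\<^esub> = (\<lambda>x \<in> obj C. \<zero>\<^bsub>onO G x\<^esub>)"
    by (simp add: lim_module_def)
  show add: "s \<oplus>\<^bsub>?L\<^esub> t \<in> carrier ?L" if "s \<in> carrier ?L" "t \<in> carrier ?L" for s t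
    using that unfolding Lc Ladd by (simp add: abelian_monoid.a_closed[OF mon] ahom_add[OF hom])
  show "\<zero>\<^bsub>?L\<^esub> \<in> carrier ?L"
    unfolding Lc Lzero by (simp add: abelian_monoid.zero_closed[OF mon] ahom_zero[OF grp grp hom])
  show "(s \<oplus>\<^bsub>?L\<^esub> t) \<oplus>\<^bsub>?L\<^esub> u = s \<oplus>\<^bsub>?L\<^esub> (t \<oplus>\<^bsub>?L\<^esub> u)"
    if "s \<in> carrier ?L" "t \<in> carrier ?L" "u \<in> carrier ?L" for s t u
    using that unfolding Lc Ladd by (intro restrict_ext) (simp add: abelian_monoid.a_assoc[OF mon])
  show "s \<oplus>\<^bsub>?L\<^esub> t = t \<oplus>\<^bsub>?L\<^esub> s" if "s \<in> carrier ?L" "t \<in> carrier ?L" for s t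
    using that unfolding Lc Ladd by (intro restrict_ext) (simp add: abelian_monoid.a_comm[OF mon])
  show "\<zero>\<^bsub>?L\<^esub> \<oplus>\<^bsub>?L\<^esub> s = s" if "s \<in> carrier ?L" for s
    using that unfolding Lc Ladd Lzero
    by (intro extensionalityI[of _ "obj C"]) (simp_all add: abelian_monoid.l_zero[OF mon])
  show "\<exists>t \<in> carrier ?L. t \<oplus>\<^bsub>?L\<^esub> s = \<zero>\<^bsub>?L\<^esub>" if s: "s \<in> carrier ?L" for s
  proof -
    let ?t = "\<lambda>x \<in> obj C. \<zero>\<^bsub>onO G x\<^esub> \<ominus>\<^bsub>onO G x\<^esub> s x"
    have sx: "s x \<in> carrier (onO G x)" if "x \<in> obj C" for x
      using s that unfolding Lc by blast
    have tx: "\<zero>\<^bsub>onO G x\<^esub> \<ominus>\<^bsub>onO G x\<^esub> s x \<in> carrier (onO G x)" if "x \<in> obj C" for x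
      using sx[OF that] abelian_group.minus_closed[OF grp[OF that] abelian_monoid.zero_closed[OF mon[OF that]]] by blast
    have "?t \<in> carrier ?L"
      unfolding Lc
    proof (intro conjI ballI)
      fix x y f assume xyf: "x \<in> obj C" "y \<in> obj C" "f \<in> arr C x y"
      have "onA G x y f (s x) = s y"
        using s xyf unfolding Lc by blast
      then show "onA G x y f (?t x) = ?t y"
        using xyf ahom_minus[OF grp grp hom[OF xyf] abelian_monoid.zero_closed[OF mon] sx]
          ahom_zero[OF grp grp hom[OF xyf]] by simp
    qed (simp_all add: tx)
    moreover have "?t \<oplus>\<^bsub>?L\<^esub> s = \<zero>\<^bsub>?L\<^esub>"
      unfolding Ladd Lzero
      using sx abelian_group.minus_add_cancel[OF grp abelian_monoid.zero_closed[OF mon]]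
      by (intro restrict_ext) simp
    ultimately show ?thesis by blast
  qed
qed

lemma lim_map_ahom:
  assumes G: "is_functor C (Mod_cat K UNIV) G" and H: "is_functor C (Mod_cat K UNIV) H"
    and \<theta>: "\<theta> \<in> nat_trans C (Mod_cat K UNIV) G H"
  shows "lim_map C \<theta> \<in> ahom (lim_module C G) (lim_module C H)"
proof -
  have hom: "\<theta> x \<in> ahom (onO G x) (onO H x)" if "x \<in> obj C" for x
    by (rule mod_hom_ahom[of _ K]) (use \<theta> that in \<open>simp add: nat_trans_def Mod_cat_def\<close>)
  have nat: "\<theta> y (onA G x y f v) = onA H x y f (\<theta> x v)"
    if "x \<in> obj C" "y \<in> obj C" "f \<in> arr C x y" "v \<in> carrier (onO G x)" for x y f v
  proof -
    have "compose (carrier (onO G x)) (\<theta> y) (onA G x y f) v = compose (carrier (onO G x)) (onA H x y f) (\<theta> x) v"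
      using \<theta> that by (simp add: nat_trans_def Mod_cat_def)
    then show ?thesis
      using that(4) by (simp add: compose_def)
  qed
  have Lc: "s \<in> carrier (lim_module C G) \<longleftrightarrow> s \<in> extensional (obj C) \<and> (\<forall>x \<in> obj C. s x \<in> carrier (onO G x)) \<and>
      (\<forall>x \<in> obj C. \<forall>y \<in> obj C. \<forall>f \<in> arr C x y. onA G x y f (s x) = s y)" for s G
    by (auto simp: lim_module_def PiE_def Pi_def)
  show ?thesis
    unfolding ahom_iff
  proof (intro conjI ballI)
    fix s assume s: "s \<in> carrier (lim_module C G)"
    then have sx: "s x \<in> carrier (onO G x)" if "x \<in> obj C" for x
      using that unfolding Lc by blast
    have "onA H x y f (\<theta> x (s x)) = \<theta> y (s y)" if "x \<in> obj C" "y \<in> obj C" "f \<in> arr C x y" for x y f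
    proof -
      have "onA G x y f (s x) = s y"
        using s that unfolding Lc by blast
      then show ?thesis
        using nat[OF that sx[OF that(1)]] by simp
    qed
    then show "lim_map C \<theta> s \<in> carrier (lim_module C H)"
      unfolding Lc by (simp add: lim_map_def ahom_closed[OF hom sx])
    fix t assume "t \<in> carrier (lim_module C G)"
    then have tx: "t x \<in> carrier (onO G x)" if "x \<in> obj C" for x
      using that unfolding Lc by blast
    show "lim_map C \<theta> (s \<oplus>\<^bsub>lim_module C G\<^esub> t) = lim_map C \<theta> s \<oplus>\<^bsub>lim_module C H\<^esub> lim_map C \<theta> t"
      by (auto simp: lim_map_def lim_module_def ahom_add[OF hom sx tx] intro!: restrict_ext)
  qed
qed

text \<open>In a successor degree the cohomology divides by the image of the preceding map, and
  exactness puts all cocycles into that image.\<close>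

lemma cohomology_zero:
  assumes res: "injective_resolution K C F I \<epsilon> \<delta>"
    and exact: "\<And>s. s \<in> carrier (lim_module C (I (Suc m)))
      \<Longrightarrow> lim_map C (\<delta> (Suc m)) s = \<zero>\<^bsub>lim_module C (I (Suc (Suc m)))\<^esub>
      \<Longrightarrow> s \<in> lim_map C (\<delta> m) ` carrier (lim_module C (I m))"
  shows "zero_module (cochain_cohomology (\<lambda>n. lim_module C (I n)) (\<lambda>n. lim_map C (\<delta> n)) (Suc m))"
proof -
  have I: "is_functor C (Mod_cat K UNIV) (I n)" and \<delta>: "\<delta> n \<in> nat_trans C (Mod_cat K UNIV) (I n) (I (Suc n))" for n
    using res by (auto simp: injective_resolution_def injective_functor_def)
  have grp: "abelian_group (lim_module C (I n))" for n
    by (rule lim_module_group[OF I])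
  have hom: "lim_map C (\<delta> n) \<in> ahom (lim_module C (I n)) (lim_module C (I (Suc n)))" for n
    by (rule lim_map_ahom[OF I I \<delta>])
  interpret A: abelian_group "lim_module C (I m)" by (rule grp)
  interpret B: abelian_group "lim_module C (I (Suc m))" by (rule grp)
  let ?N = "lim_map C (\<delta> m) ` carrier (lim_module C (I m))"
  let ?Z = "a_kernel (lim_module C (I (Suc m))) (lim_module C (I (Suc (Suc m)))) (lim_map C (\<delta> (Suc m)))"
  have N: "additive_subgroup ?N (lim_module C (I (Suc m)))"
  proof (rule additive_subgroup_minusI[OF grp])
    show "?N \<subseteq> carrier (lim_module C (I (Suc m)))"
      using ahom_closed[OF hom] by blast
    show "\<zero>\<^bsub>lim_module C (I (Suc m))\<^esub> \<in> ?N"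
      using ahom_zero[OF grp grp hom, symmetric] A.zero_closed by (rule image_eqI)
    fix x y assume "x \<in> ?N" "y \<in> ?N"
    then obtain u v where uv: "u \<in> carrier (lim_module C (I m))" "v \<in> carrier (lim_module C (I m))"
      and xy: "x = lim_map C (\<delta> m) u" "y = lim_map C (\<delta> m) v"
      by blast
    show "x \<ominus>\<^bsub>lim_module C (I (Suc m))\<^esub> y \<in> ?N"
      unfolding xy using ahom_minus[OF grp grp hom uv, symmetric] A.minus_closed[OF uv] by (rule image_eqI)
  qed
  have "?Z \<subseteq> ?N"
    using exact by (auto simp: a_kernel_def')
  moreover have "\<zero>\<^bsub>lim_module C (I (Suc m))\<^esub> \<in> ?Z"
    using ahom_zero[OF grp grp hom] by (simp add: a_kernel_def')
  ultimately show ?thesis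
    unfolding cochain_cohomology_def
    using quotient_module_zero[OF grp N, of ?Z] by auto
qed

section \<open>The category of presentations and its coproduct functor\<close>

section \<open>Presentations\<close>

lemma Pres_obj_iff: "(F, p) \<in> obj (Pres_cat K U A) \<longleftrightarrow> module K F \<and> carrier F \<in> U \<and> free_module K F \<and>
    p \<in> mod_hom K F A \<and> p ` carrier F = carrier A"
  by (auto simp: Pres_cat_def Mod_cat_def)

text \<open>Arrows are defined by an equation between extensional functions; as \<open>p\<close> is
  extensional, it becomes a condition on elements.\<close>

lemma Pres_arr_iff:
  assumes "p \<in> mod_hom K F A"
  shows "g \<in> arr (Pres_cat K U A) (F, p) (F', p') \<longleftrightarrow> g \<in> mod_hom K F F' \<and> (\<forall>x \<in> carrier F. p' (g x) = p x)"
proof -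
  have "compose (carrier F) p' g = p \<longleftrightarrow> (\<forall>x \<in> carrier F. p' (g x) = p x)"
  proof
    assume "\<forall>x \<in> carrier F. p' (g x) = p x"
    then show "compose (carrier F) p' g = p"
      using mod_hom_extensional[OF assms] by (intro extensionalityI[of _ "carrier F"]) (auto simp: compose_def)
  next
    assume "compose (carrier F) p' g = p"
    then show "\<forall>x \<in> carrier F. p' (g x) = p x"
      by (metis compose_eq)
  qed
  then show ?thesis
    by (simp add: Pres_cat_def)
qed

lemma Pres_simps [simp]:
  "idn (Pres_cat K U A) (F, p) = (\<lambda>x \<in> carrier F. x)"
  "cmp (Pres_cat K U A) (F, p) y z g f = compose (carrier F) g f"
  by (simp_all add: Pres_cat_def)

text \<open>\<open>(P, p0)\<close> is the object \<open>c\<close> of the abstract complex, and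
  \<open>U_times\<close> keeps coproducts of presentations in the same class of sets.\<close>

locale presentation = pairing enc for enc :: "'v \<times> 'v \<Rightarrow> 'v" +
  fixes K :: "('r, 'k) ring_scheme" and U :: "'v set set" and A :: "('r, 'v) module"
    and P :: "('r, 'v) module" and p0 :: "'v \<Rightarrow> 'v"
  assumes A_module: "module K A"
    and P_obj: "(P, p0) \<in> obj (Pres_cat K U A)"
    and U_times: "X \<in> U \<Longrightarrow> Y \<in> U \<Longrightarrow> enc ` (X \<times> Y) \<in> U"
begin

abbreviation Pr :: "(('r, 'v) module \<times> ('v \<Rightarrow> 'v), 'v \<Rightarrow> 'v) category" where
  "Pr \<equiv> Pres_cat K U A"

definition Efun :: "(('r, 'v) module \<times> ('v \<Rightarrow> 'v), 'v \<Rightarrow> 'v, ('r, 'v) module \<times> ('v \<Rightarrow> 'v), 'v \<Rightarrow> 'v) func" where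
  "Efun = \<lparr>onO = (\<lambda>(X, p). (dsum P X, copr P X A p0 p)),
     onA = (\<lambda>(X, p) (Y, q) f. copr P X (dsum P Y) (inj1 P Y) (compose (carrier X) (inj2 P Y) f))\<rparr>"

lemma Efun_simps [simp]:
  "onO Efun (X, p) = (dsum P X, copr P X A p0 p)"
  "onA Efun (X, p) (Y, q) f = copr P X (dsum P Y) (inj1 P Y) (compose (carrier X) (inj2 P Y) f)"
  by (simp_all add: Efun_def)

lemma P_module: "module K P" and p0_hom: "p0 \<in> mod_hom K P A" and P_free: "free_module K P"
  using P_obj by (simp_all add: Pres_obj_iff)

lemma dsum_eqI:
  assumes "f \<in> extensional (carrier (dsum M N))" "g \<in> extensional (carrier (dsum M N))"
    "\<And>x y. x \<in> carrier M \<Longrightarrow> y \<in> carrier N \<Longrightarrow> f (enc (x, y)) = g (enc (x, y))"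
  shows "f = g"
proof (rule extensionalityI[OF assms(1,2)])
  fix u assume "u \<in> carrier (dsum M N)"
  then show "f u = g u"
    by (rule dsum_cases) (use assms(3) in simp)
qed

text \<open>In coordinates \<open>onA Efun\<close> is the identity of \<open>P\<close> next to
  \<open>f\<close>. Its definition as a copairing makes it a homomorphism by
  \<open>copr_hom\<close>.\<close>

lemma onA_Efun_enc:
  assumes "module K Y" "module K X" "f \<in> mod_hom K X Y" "a \<in> carrier P" "x \<in> carrier X"
  shows "onA Efun (X, p) (Y, q) f (enc (a, x)) = enc (a, f x)"
proof -
  interpret P: module K P by (rule P_module)
  interpret Y: module K Y by fact
  show ?thesis
    using assms(4,5) mod_hom_closed[OF assms(3,5)] by (simp add: inj1_def inj2_def compose_def)
qed

lemma Efun_obj: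
  assumes "(X, p) \<in> obj Pr"
  shows "onO Efun (X, p) \<in> obj Pr"
proof -
  have X: "module K X" "p \<in> mod_hom K X A" "free_module K X" "carrier X \<in> U" "p ` carrier X = carrier A"
    using assms by (simp_all add: Pres_obj_iff)
  interpret A: module K A by (rule A_module)
  interpret X: module K X by (rule X)
  interpret P: module K P by (rule P_module)
  have hom: "copr P X A p0 p \<in> mod_hom K (dsum P X) A"
    by (rule copr_hom[OF P_module X(1) A_module p0_hom X(2)])
  have "copr P X A p0 p ` carrier (dsum P X) = carrier A"
  proof
    show "copr P X A p0 p ` carrier (dsum P X) \<subseteq> carrier A"
      using mod_hom_closed[OF hom] by blast
    show "carrier A \<subseteq> copr P X A p0 p ` carrier (dsum P X)"
    proof
      fix a assume "a \<in> carrier A"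
      then obtain x where x: "x \<in> carrier X" "a = p x"
        using X(5) by auto
      have "p0 \<zero>\<^bsub>P\<^esub> = \<zero>\<^bsub>A\<^esub>"
        by (rule ahom_zero[OF P.abelian_group_axioms A.abelian_group_axioms mod_hom_ahom[OF p0_hom]])
      then have "a = copr P X A p0 p (enc (\<zero>\<^bsub>P\<^esub>, x))"
        using x mod_hom_closed[OF X(2) x(1)] by simp
      then show "a \<in> copr P X A p0 p ` carrier (dsum P X)"
        using x(1) by (intro image_eqI[of _ _ "enc (\<zero>\<^bsub>P\<^esub>, x)"]) simp_all
    qed
  qed
  moreover have "carrier (dsum P X) \<in> U"
    using U_times[of "carrier P" "carrier X"] P_obj X(4) by (simp add: Pres_obj_iff dsum_def)
  ultimately show ?thesis
    using hom dsum_module[OF P_module X(1)] dsum_free[OF P_free X(3)] by (simp add: Pres_obj_iff)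
qed

text \<open>\<open>arr_nonempty\<close> is the lifting property of the free module \<open>P\<close>.
  The conditions on \<open>E\<close>, \<eta> and \<kappa> are those of a coproduct over
  \<open>A\<close> and are checked on coded pairs.\<close>

lemma cone: "cone_category Pr Efun (\<lambda>(X, p). inj2 P X) (\<lambda>(X, p). inj1 P X) (P, p0)"
proof
  interpret P: module K P by (rule P_module)
  interpret A: module K A by (rule A_module)
  have p00: "p0 \<zero>\<^bsub>P\<^esub> = \<zero>\<^bsub>A\<^esub>"
    by (rule ahom_zero[OF P.abelian_group_axioms A.abelian_group_axioms mod_hom_ahom[OF p0_hom]])
  show "(P, p0) \<in> obj Pr"
    by (rule P_obj)
  show "idn Pr x \<in> arr Pr x x" if "x \<in> obj Pr" for x
  proof (cases x)
    case (Pair X p)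
    then have X: "module K X" "p \<in> mod_hom K X A"
      using that by (simp_all add: Pres_obj_iff)
    interpret X: module K X by (rule X)
    show ?thesis
      unfolding Pair Pres_arr_iff[OF X(2)] by (auto intro!: mod_homI)
  qed
  show "cmp Pr x y z g f \<in> arr Pr x z"
    if "x \<in> obj Pr" "y \<in> obj Pr" "z \<in> obj Pr" "f \<in> arr Pr x y" "g \<in> arr Pr y z" for x y z f g
  proof (cases x, cases y, cases z)
    fix X p Y q Z r assume xyz: "x = (X, p)" "y = (Y, q)" "z = (Z, r)"
    then have X: "module K X" "p \<in> mod_hom K X A" "q \<in> mod_hom K Y A"
      using that by (simp_all add: Pres_obj_iff)
    have f: "f \<in> mod_hom K X Y" "\<forall>x \<in> carrier X. q (f x) = p x"
      and g: "g \<in> mod_hom K Y Z" "\<forall>x \<in> carrier Y. r (g x) = q x"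
      using that(4,5) unfolding xyz Pres_arr_iff[OF X(2)] Pres_arr_iff[OF X(3)] by auto
    show ?thesis
      unfolding xyz Pres_arr_iff[OF X(2)] Pres_simps
      using mod_hom_compose[OF X(1) f(1) g(1)] f g mod_hom_closed[OF f(1)] by (simp add: compose_def)
  qed
  show "\<exists>f. f \<in> arr Pr (P, p0) x" if "x \<in> obj Pr" for x
  proof (cases x)
    case (Pair X p)
    then have X: "module K X" "p \<in> mod_hom K X A" "p ` carrier X = carrier A"
      using that by (simp_all add: Pres_obj_iff)
    then show ?thesis
      unfolding Pair Pres_arr_iff[OF p0_hom]
      using free_module_lift[OF P_free X(1) A_module p0_hom X(2,3)] by blast
  qed
  have E_arr: "onA Efun x y f \<in> arr Pr (onO Efun x) (onO Efun y)"
    if "x \<in> obj Pr" "y \<in> obj Pr" "f \<in> arr Pr x y" for x y f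
  proof (cases x, cases y)
    fix X p Y q assume xy: "x = (X, p)" "y = (Y, q)"
    then have X: "module K X" "p \<in> mod_hom K X A" "module K Y" "q \<in> mod_hom K Y A"
      using that by (simp_all add: Pres_obj_iff)
    have f: "f \<in> mod_hom K X Y" "\<forall>x \<in> carrier X. q (f x) = p x"
      using that(3) unfolding xy Pres_arr_iff[OF X(2)] by auto
    have "copr P Y A p0 q (onA Efun (X, p) (Y, q) f u) = copr P X A p0 p u" if u: "u \<in> carrier (dsum P X)" for u
      using u
    proof (rule dsum_cases)
      fix a b assume *: "a \<in> carrier P" "b \<in> carrier X" "u = enc (a, b)"
      show ?thesis
        unfolding *(3) onA_Efun_enc[OF X(3,1) f(1) *(1,2)]
        using *(1,2) mod_hom_closed[OF f(1) *(2)] f(2) by simp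
    qed
    then show ?thesis
      unfolding xy Efun_simps(1) Pres_arr_iff[OF copr_hom[OF P_module X(1) A_module p0_hom X(2)]]
      using copr_hom[OF P_module X(1) dsum_module[OF P_module X(3)] inj1_hom[OF P_module X(3)]
          mod_hom_compose[OF X(1) f(1) inj2_hom[OF P_module X(3)]]] by simp
  qed
  have E_ext: "onA Efun (X, p) (Y, q) f \<in> extensional (carrier (dsum P X))" for X p Y q f
    by (simp add: copr_def)
  show "is_functor Pr Pr Efun"
    unfolding is_functor_def
  proof (intro conjI ballI)
    show "onO Efun x \<in> obj Pr" if "x \<in> obj Pr" for x
      using that Efun_obj by (cases x) blast
    show "onA Efun x y f \<in> arr Pr (onO Efun x) (onO Efun y)"
      if "x \<in> obj Pr" "y \<in> obj Pr" "f \<in> arr Pr x y" for x y f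
      by (rule E_arr[OF that])
    show "onA Efun x x (idn Pr x) = idn Pr (onO Efun x)" if "x \<in> obj Pr" for x
    proof (cases x)
      case (Pair X p)
      then have X: "module K X"
        using that by (simp_all add: Pres_obj_iff)
      interpret X: module K X by (rule X)
      have id: "(\<lambda>x \<in> carrier X. x) \<in> mod_hom K X X"
        by (auto intro!: mod_homI)
      have "onA Efun (X, p) (X, p) (\<lambda>x \<in> carrier X. x) = (\<lambda>u \<in> carrier (dsum P X). u)"
      proof (rule dsum_eqI[OF E_ext])
        fix a b assume *: "a \<in> carrier P" "b \<in> carrier X"
        show "onA Efun (X, p) (X, p) (\<lambda>x \<in> carrier X. x) (enc (a, b)) = (\<lambda>u \<in> carrier (dsum P X). u) (enc (a, b))"
          unfolding onA_Efun_enc[OF X X id *] using * by simp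
      qed simp
      then show ?thesis
        unfolding Pair by simp
    qed
    show "onA Efun x z (cmp Pr x y z g f) =
        cmp Pr (onO Efun x) (onO Efun y) (onO Efun z) (onA Efun y z g) (onA Efun x y f)"
      if "x \<in> obj Pr" "y \<in> obj Pr" "z \<in> obj Pr" "f \<in> arr Pr x y" "g \<in> arr Pr y z" for x y z f g
    proof (cases x, cases y, cases z)
      fix X p Y q Z r assume xyz: "x = (X, p)" "y = (Y, q)" "z = (Z, r)"
      then have X: "module K X" "p \<in> mod_hom K X A" "module K Y" "q \<in> mod_hom K Y A" "module K Z"
        using that by (simp_all add: Pres_obj_iff)
      have f: "f \<in> mod_hom K X Y" and g: "g \<in> mod_hom K Y Z"
        using that(4,5) unfolding xyz Pres_arr_iff[OF X(2)] Pres_arr_iff[OF X(4)] by auto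
      have gf: "compose (carrier X) g f \<in> mod_hom K X Z"
        by (rule mod_hom_compose[OF X(1) f g])
      have "onA Efun (X, p) (Z, r) (compose (carrier X) g f) =
          compose (carrier (dsum P X)) (onA Efun (Y, q) (Z, r) g) (onA Efun (X, p) (Y, q) f)"
      proof (rule dsum_eqI[OF E_ext])
        fix a b assume *: "a \<in> carrier P" "b \<in> carrier X"
        have "onA Efun (Y, q) (Z, r) g (onA Efun (X, p) (Y, q) f (enc (a, b))) = enc (a, g (f b))"
          unfolding onA_Efun_enc[OF X(3,1) f *] onA_Efun_enc[OF X(5,3) g *(1) mod_hom_closed[OF f *(2)]] ..
        then show "onA Efun (X, p) (Z, r) (compose (carrier X) g f) (enc (a, b)) =
            compose (carrier (dsum P X)) (onA Efun (Y, q) (Z, r) g) (onA Efun (X, p) (Y, q) f) (enc (a, b))"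
          unfolding onA_Efun_enc[OF X(5,1) gf *] using * by (simp add: compose_def del: Efun_simps)
      qed simp
      then show ?thesis
        unfolding xyz by simp
    qed
  qed
  show "(case x of (X, p) \<Rightarrow> inj2 P X) \<in> arr Pr x (onO Efun x)" if "x \<in> obj Pr" for x
  proof (cases x)
    case (Pair X p)
    then have X: "module K X" "p \<in> mod_hom K X A"
      using that by (simp_all add: Pres_obj_iff)
    show ?thesis
      unfolding Pair Efun_simps Pres_arr_iff[OF X(2)] prod.case
      using inj2_hom[OF P_module X(1)] p00 mod_hom_closed[OF X(2)] by (simp add: inj2_def)
  qed
  show "(case x of (X, p) \<Rightarrow> inj1 P X) \<in> arr Pr (P, p0) (onO Efun x)" if "x \<in> obj Pr" for x
  proof (cases x)
    case (Pair X p)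
    then have X: "module K X" "p \<in> mod_hom K X A"
      using that by (simp_all add: Pres_obj_iff)
    interpret X: module K X by (rule X)
    have "p \<zero>\<^bsub>X\<^esub> = \<zero>\<^bsub>A\<^esub>"
      by (rule ahom_zero[OF X.abelian_group_axioms A.abelian_group_axioms mod_hom_ahom[OF X(2)]])
    then show ?thesis
      unfolding Pair Efun_simps Pres_arr_iff[OF p0_hom] prod.case
      using inj1_hom[OF P_module X(1)] mod_hom_closed[OF p0_hom] by (simp add: inj1_def)
  qed
  show "cmp Pr x y (onO Efun y) (case y of (X, p) \<Rightarrow> inj2 P X) f =
      cmp Pr x (onO Efun x) (onO Efun y) (onA Efun x y f) (case x of (X, p) \<Rightarrow> inj2 P X)"
    if "x \<in> obj Pr" "y \<in> obj Pr" "f \<in> arr Pr x y" for x y f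
  proof (cases x, cases y)
    fix X p Y q assume xy: "x = (X, p)" "y = (Y, q)"
    then have X: "module K X" "p \<in> mod_hom K X A" "module K Y" "q \<in> mod_hom K Y A"
      using that by (simp_all add: Pres_obj_iff)
    have f: "f \<in> mod_hom K X Y"
      using that(3) unfolding xy Pres_arr_iff[OF X(2)] by auto
    have "compose (carrier X) (inj2 P Y) f = compose (carrier X) (onA Efun (X, p) (Y, q) f) (inj2 P X)"
    proof (rule extensionalityI[of _ "carrier X"])
      fix v assume v: "v \<in> carrier X"
      then have "onA Efun (X, p) (Y, q) f (inj2 P X v) = enc (\<zero>\<^bsub>P\<^esub>, f v)"
        using onA_Efun_enc[OF X(3,1) f P.zero_closed v] by (simp add: inj2_def del: Efun_simps)
      then show "compose (carrier X) (inj2 P Y) f v = compose (carrier X) (onA Efun (X, p) (Y, q) f) (inj2 P X) v"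
        using v mod_hom_closed[OF f v] by (simp add: compose_def inj2_def del: Efun_simps)
    qed simp_all
    then show ?thesis
      unfolding xy by simp
  qed
  show "cmp Pr (P, p0) (onO Efun x) (onO Efun y) (onA Efun x y f) (case x of (X, p) \<Rightarrow> inj1 P X) =
      (case y of (X, p) \<Rightarrow> inj1 P X)"
    if "x \<in> obj Pr" "y \<in> obj Pr" "f \<in> arr Pr x y" for x y f
  proof (cases x, cases y)
    fix X p Y q assume xy: "x = (X, p)" "y = (Y, q)"
    then have X: "module K X" "p \<in> mod_hom K X A" "module K Y" "q \<in> mod_hom K Y A"
      using that by (simp_all add: Pres_obj_iff)
    interpret X: module K X by (rule X)
    interpret Y: module K Y by (rule X)
    have f: "f \<in> mod_hom K X Y"
      using that(3) unfolding xy Pres_arr_iff[OF X(2)] by auto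
    have f0: "f \<zero>\<^bsub>X\<^esub> = \<zero>\<^bsub>Y\<^esub>"
      by (rule ahom_zero[OF X.abelian_group_axioms Y.abelian_group_axioms mod_hom_ahom[OF f]])
    have "compose (carrier P) (onA Efun (X, p) (Y, q) f) (inj1 P X) = inj1 P Y"
    proof (rule extensionalityI[of _ "carrier P"])
      fix v assume v: "v \<in> carrier P"
      then have "onA Efun (X, p) (Y, q) f (inj1 P X v) = enc (v, \<zero>\<^bsub>Y\<^esub>)"
        using onA_Efun_enc[OF X(3,1) f v X.zero_closed] f0 by (simp add: inj1_def del: Efun_simps)
      then show "compose (carrier P) (onA Efun (X, p) (Y, q) f) (inj1 P X) v = inj1 P Y v"
        using v by (simp add: compose_def inj1_def del: Efun_simps)
    qed (simp_all add: inj1_def)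
    then show ?thesis
      unfolding xy by simp
  qed
  show "\<exists>h \<in> arr Pr (onO Efun x) y. cmp Pr x (onO Efun x) y h (case x of (X, p) \<Rightarrow> inj2 P X) = f \<and>
      cmp Pr (P, p0) (onO Efun x) y h (case x of (X, p) \<Rightarrow> inj1 P X) = g"
    if "x \<in> obj Pr" "y \<in> obj Pr" "f \<in> arr Pr x y" "g \<in> arr Pr (P, p0) y" for x y f g
  proof (cases x, cases y)
    fix X p Y q assume xy: "x = (X, p)" "y = (Y, q)"
    then have X: "module K X" "p \<in> mod_hom K X A" "module K Y" "q \<in> mod_hom K Y A"
      using that by (simp_all add: Pres_obj_iff)
    interpret X: module K X by (rule X)
    interpret Y: module K Y by (rule X)
    have f: "f \<in> mod_hom K X Y" "\<forall>x \<in> carrier X. q (f x) = p x"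
      using that(3) unfolding xy Pres_arr_iff[OF X(2)] by auto
    have g: "g \<in> mod_hom K P Y" "\<forall>x \<in> carrier P. q (g x) = p0 x"
      using that(4) unfolding xy Pres_arr_iff[OF p0_hom] by auto
    have f0: "f \<zero>\<^bsub>X\<^esub> = \<zero>\<^bsub>Y\<^esub>" and g0: "g \<zero>\<^bsub>P\<^esub> = \<zero>\<^bsub>Y\<^esub>"
      using ahom_zero[OF X.abelian_group_axioms Y.abelian_group_axioms mod_hom_ahom[OF f(1)]]
        ahom_zero[OF P.abelian_group_axioms Y.abelian_group_axioms mod_hom_ahom[OF g(1)]] by simp_all
    let ?h = "copr P X Y g f"
    have "?h \<in> arr Pr (onO Efun x) y"
      unfolding xy Efun_simps Pres_arr_iff[OF copr_hom[OF P_module X(1) A_module p0_hom X(2)]]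
    proof (intro conjI ballI)
      show "?h \<in> mod_hom K (dsum P X) Y"
        by (rule copr_hom[OF P_module X(1) X(3) g(1) f(1)])
      fix u assume "u \<in> carrier (dsum P X)"
      then show "q (?h u) = copr P X A p0 p u"
      proof (rule dsum_cases)
        fix a b assume "a \<in> carrier P" "b \<in> carrier X" "u = enc (a, b)"
        then show ?thesis
          using mod_hom_add[OF X(4)] mod_hom_closed[OF f(1)] mod_hom_closed[OF g(1)] f(2) g(2) by simp
      qed
    qed
    moreover have "compose (carrier X) ?h (inj2 P X) = f"
      using mod_hom_extensional[OF f(1)] g0 mod_hom_closed[OF f(1)]
      by (intro extensionalityI[of _ "carrier X"]) (simp_all add: compose_def inj2_def)
    moreover have "compose (carrier P) ?h (inj1 P X) = g"
      using mod_hom_extensional[OF g(1)] f0 mod_hom_closed[OF g(1)]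
      by (intro extensionalityI[of _ "carrier P"]) (simp_all add: compose_def inj1_def)
    ultimately show ?thesis
      unfolding xy by auto
  qed
qed

end

text \<open>Negation is determined by a search in the carrier, so changing the carrier could change
  it; the additive inclusion shows that it does not.\<close>

lemma submodule_minus_eq:
  assumes "module K M" "module K (M\<lparr>carrier := H\<rparr>)" "H \<subseteq> carrier M" "v \<in> H" "w \<in> H"
  shows "v \<ominus>\<^bsub>M\<lparr>carrier := H\<rparr>\<^esub> w = v \<ominus>\<^bsub>M\<^esub> w"
proof -
  have "(\<lambda>x. x) \<in> ahom (M\<lparr>carrier := H\<rparr>) M"
    using assms(3) unfolding ahom_iff by auto
  then show ?thesis
    using ahom_minus[OF module.axioms(2)[OF assms(2)] module.axioms(2)[OF assms(1)]] assms(4,5) by fastforce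
qed

section \<open>Idempotents on iterated coproducts and on their relation modules\<close>

context presentation
begin

sublocale cone_category K Pr Efun "\<lambda>(X, p). inj2 P X" "\<lambda>(X, p). inj1 P X" "(P, p0)"
  by (rule cone)

text \<open>The idempotent \<open>e j\<close> projects away the \<open>j\<close>-th of the \<open>k\<close> copies of \<open>P\<close> in \<open>E\<^sup>k x\<close>.
  Moving that copy along one and the same \<open>\<sigma>\<close>, fixed by all \<open>e j\<close>, keeps the map over \<open>A\<close> and makes
  the idempotents commute.\<close>

lemma idempotents_exist:
  assumes x: "x \<in> obj Pr"
  shows "\<exists>e \<sigma>. (\<forall>j < k. e j \<in> arr Pr ((onO Efun ^^ k) x) ((onO Efun ^^ k) x)) \<and>
    \<sigma> \<in> arr Pr (P, p0) ((onO Efun ^^ k) x) \<and>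
    (\<forall>j < k. \<forall>a \<in> carrier P. e j (\<sigma> a) = \<sigma> a) \<and>
    (\<forall>j < k. \<forall>v \<in> carrier (fst ((onO Efun ^^ k) x)). e j (e j v) = e j v) \<and>
    (\<forall>i < k. \<forall>j < k. i \<noteq> j \<longrightarrow> (\<forall>v \<in> carrier (fst ((onO Efun ^^ k) x)).
       e i (v \<ominus>\<^bsub>fst ((onO Efun ^^ k) x)\<^esub> e j v) = v \<ominus>\<^bsub>fst ((onO Efun ^^ k) x)\<^esub> e j v)) \<and>
    (\<forall>(G :: (('r, 'v) module \<times> ('v \<Rightarrow> 'v), 'v \<Rightarrow> 'v, ('r, 'v) module, 'v \<Rightarrow> 'v) func) D.
       fct G \<longrightarrow> subfunctor G D \<longrightarrow> (\<forall>j < k. \<forall>u \<in> carrier (onO G ((onO Efun ^^ k) x)).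
         onA G ((onO Efun ^^ k) x) ((onO Efun ^^ k) x) (e j) u \<in> iter_sub k G D x))"
\<comment> \<open>The last conjunct speaks of all \<open>G\<close> and \<open>D\<close>, because the
  next step uses it for \<open>shift G\<close> and \<open>eta_sub G D\<close> with the same
  idempotents.\<close>
proof (induction k)
  case 0
  show ?case
    using arr_nonempty[OF x] by simp
next
  case (Suc k)
  obtain Y q where yeq: "(onO Efun ^^ k) x = (Y, q)"
    by (cases "(onO Efun ^^ k) x")
  let ?y = "(Y, q)"
  let ?Ey = "onO Efun ?y"
  let ?D = "dsum P Y"
  have y: "?y \<in> obj Pr"
    using E_pow_obj[OF x, of k] yeq by simp
  have Y: "module K Y" "q \<in> mod_hom K Y A"
    using y by (simp_all add: Pres_obj_iff)
  from Suc.IH[unfolded yeq fst_conv] obtain e \<sigma> where e': "\<forall>j < k. e j \<in> arr Pr ?y ?y" and \<sigma>: "\<sigma> \<in> arr Pr (P, p0) ?y"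
    and e\<sigma>': "\<forall>j < k. \<forall>a \<in> carrier P. e j (\<sigma> a) = \<sigma> a"
    and ee': "\<forall>j < k. \<forall>v \<in> carrier Y. e j (e j v) = e j v"
    and ed': "\<forall>i < k. \<forall>j < k. i \<noteq> j \<longrightarrow> (\<forall>v \<in> carrier Y. e i (v \<ominus>\<^bsub>Y\<^esub> e j v) = v \<ominus>\<^bsub>Y\<^esub> e j v)"
    and eD': "\<forall>(G :: (('r, 'v) module \<times> ('v \<Rightarrow> 'v), 'v \<Rightarrow> 'v, ('r, 'v) module, 'v \<Rightarrow> 'v) func) D.
       fct G \<longrightarrow> subfunctor G D \<longrightarrow> (\<forall>j < k. \<forall>u \<in> carrier (onO G ?y). onA G ?y ?y (e j) u \<in> iter_sub k G D x)"
    by (elim exE conjE) (rule that; assumption)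
  note e = e'[rule_format] and e\<sigma> = e\<sigma>'[rule_format] and ee = ee'[rule_format] and ed = ed'[rule_format]
    and eD = eD'[rule_format]
  have e_hom: "e j \<in> mod_hom K Y Y" if "j < k" for j
    using e[OF that] unfolding Pres_arr_iff[OF Y(2)] by blast
  have \<sigma>_hom: "\<sigma> \<in> mod_hom K P Y"
    using \<sigma> unfolding Pres_arr_iff[OF p0_hom] by blast
  note e_cl = mod_hom_closed[OF e_hom] and \<sigma>_cl = mod_hom_closed[OF \<sigma>_hom]
  interpret P: module K P by (rule P_module)
  interpret Y: module K Y by (rule Y)
  have D: "module K ?D"
    by (rule dsum_module[OF P_module Y(1)])
  interpret D: module K ?D by (rule D)
  note minus = dsum_minus[OF P.abelian_group_axioms Y.abelian_group_axioms D.abelian_group_axioms]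
  have \<sigma>0: "\<sigma> \<zero>\<^bsub>P\<^esub> = \<zero>\<^bsub>Y\<^esub>"
    by (rule ahom_zero[OF P.abelian_group_axioms Y.abelian_group_axioms mod_hom_ahom[OF \<sigma>_hom]])
  note e_minus = ahom_minus[OF Y.abelian_group_axioms Y.abelian_group_axioms mod_hom_ahom[OF e_hom]]
  \<comment> \<open>\<open>h\<close> folds the new copy of \<open>P\<close> into \<open>Y\<close>:
    it sends \<open>(a, v)\<close> to \<open>\<sigma> a + v\<close>.\<close>
  obtain h where h: "h \<in> arr Pr ?Ey ?y" "cmp Pr ?y ?Ey ?y h (inj2 P Y) = idn Pr ?y" "cmp Pr (P, p0) ?Ey ?y h (inj1 P Y) = \<sigma>"
    using copair[OF y y idn_arr[OF y] \<sigma>] by auto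
  have copr_hom': "copr P Y A p0 q \<in> mod_hom K ?D A"
    by (rule copr_hom[OF P_module Y(1) A_module p0_hom Y(2)])
  have h_hom: "h \<in> mod_hom K ?D Y"
    using h(1) unfolding Efun_simps Pres_arr_iff[OF copr_hom'] by blast
  have h_enc: "h (enc (a, v)) = \<sigma> a \<oplus>\<^bsub>Y\<^esub> v" if "a \<in> carrier P" "v \<in> carrier Y" for a v
  proof -
    have "h (enc (a, \<zero>\<^bsub>Y\<^esub>) \<oplus>\<^bsub>?D\<^esub> enc (\<zero>\<^bsub>P\<^esub>, v)) = h (enc (a, \<zero>\<^bsub>Y\<^esub>)) \<oplus>\<^bsub>Y\<^esub> h (enc (\<zero>\<^bsub>P\<^esub>, v))"
      using that by (intro mod_hom_add[OF h_hom]) simp_all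
    moreover have "h (enc (a, \<zero>\<^bsub>Y\<^esub>)) = \<sigma> a"
      using fun_cong[OF h(3), of a] that by (simp add: compose_def inj1_def)
    moreover have "h (enc (\<zero>\<^bsub>P\<^esub>, v)) = v"
      using fun_cong[OF h(2), of v] that by (simp add: compose_def inj2_def)
    ultimately show ?thesis
      using that by simp
  qed
  \<comment> \<open>Index 0 belongs to the newest copy: \<open>e' 0\<close> sends
    \<open>(a, v)\<close> to \<open>(0, \<sigma> a + v)\<close>, while \<open>e' (Suc i)\<close>
    sends it to \<open>(a, e i v)\<close>.\<close>
  define e0 where "e0 = cmp Pr ?Ey ?y ?Ey (inj2 P Y) h"
  define e' where "e' j = (case j of 0 \<Rightarrow> e0 | Suc i \<Rightarrow> onA Efun ?y ?y (e i))" for j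
  have e'0: "e' 0 (enc (a, v)) = enc (\<zero>\<^bsub>P\<^esub>, \<sigma> a \<oplus>\<^bsub>Y\<^esub> v)" if "a \<in> carrier P" "v \<in> carrier Y" for a v
    using that \<sigma>_cl by (simp add: e'_def e0_def compose_def h_enc inj2_def)
  have e'S: "e' (Suc i) (enc (a, v)) = enc (a, e i v)" if "i < k" "a \<in> carrier P" "v \<in> carrier Y" for i a v
    using onA_Efun_enc[OF Y(1) Y(1) e_hom[OF that(1)] that(2,3)] by (simp add: e'_def del: Efun_simps)
  have eta: "inj2 P Y \<in> arr Pr ?y ?Ey"
    using eta_arr[OF y] by simp
  have Ey: "?Ey \<in> obj Pr"
    by (rule E_obj[OF y])
  \<comment> \<open>The values of \<open>\<sigma>'\<close> have zero component in the new copy, so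
    \<open>e' 0\<close> fixes them; the other idempotents fix them by the induction
    hypothesis.\<close>
  define \<sigma>' where "\<sigma>' = cmp Pr (P, p0) ?y ?Ey (inj2 P Y) \<sigma>"
  have \<sigma>'_val: "\<sigma>' a = enc (\<zero>\<^bsub>P\<^esub>, \<sigma> a)" if "a \<in> carrier P" for a
    using that \<sigma>_cl by (simp add: \<sigma>'_def compose_def inj2_def)
  have small: "j = 0 \<or> (\<exists>i < k. j = Suc i)" if "j < Suc k" for j
    using that by (cases j) auto
  have 1: "e' j \<in> arr Pr ?Ey ?Ey" if "j < Suc k" for j
    using small[OF that]
  proof
    assume "j = 0"
    then show ?thesis
      using cmp_arr[OF Ey y Ey h(1) eta] by (simp add: e'_def e0_def)
  next
    assume "\<exists>i < k. j = Suc i"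
    then show ?thesis
      using E_arr[OF y y e] by (auto simp: e'_def simp del: Efun_simps)
  qed
  have 2: "\<sigma>' \<in> arr Pr (P, p0) ?Ey"
    unfolding \<sigma>'_def by (rule cmp_arr[OF P_obj y Ey \<sigma> eta])
  have 3: "e' j (\<sigma>' a) = \<sigma>' a" if "j < Suc k" "a \<in> carrier P" for j a
    using small[OF that(1)] that(2) \<sigma>_cl e\<sigma> by (auto simp: \<sigma>'_val e'0 e'S \<sigma>0)
  have 4: "e' j (e' j u) = e' j u" if "j < Suc k" "u \<in> carrier ?D" for j u
    using that(2)
  proof (rule dsum_cases)
    fix a v assume "a \<in> carrier P" "v \<in> carrier Y" "u = enc (a, v)"
    then show ?thesis
      using small[OF that(1)] \<sigma>_cl e_cl ee by (auto simp: e'0 e'S \<sigma>0)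
  qed
  have 5: "e' i (u \<ominus>\<^bsub>?D\<^esub> e' j u) = u \<ominus>\<^bsub>?D\<^esub> e' j u" if "i < Suc k" "j < Suc k" "i \<noteq> j" "u \<in> carrier ?D" for i j u
    using that(4)
  proof (rule dsum_cases)
    fix a v assume av: "a \<in> carrier P" "v \<in> carrier Y" and u: "u = enc (a, v)"
    show ?thesis
    proof (cases j)
      case 0
      with small[OF that(1)] that(3) obtain m where m: "m < k" "i = Suc m"
        by auto
      \<comment> \<open>\<open>1 - e' 0\<close> sends \<open>(a, v)\<close> to
        \<open>(a, - \<sigma> a)\<close>, which \<open>e' (Suc m)\<close> fixes because
        \<open>e m\<close> fixes the values of \<sigma>.\<close>
      have neg: "v \<ominus>\<^bsub>Y\<^esub> (\<sigma> a \<oplus>\<^bsub>Y\<^esub> v) = \<ominus>\<^bsub>Y\<^esub> \<sigma> a"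
        using av \<sigma>_cl[OF av(1)] by (simp add: a_minus_def Y.minus_add Y.a_lcomm[of v] Y.r_neg)
      have "e m (\<ominus>\<^bsub>Y\<^esub> \<sigma> a) = \<ominus>\<^bsub>Y\<^esub> \<sigma> a"
        using e_minus[OF m(1) Y.zero_closed \<sigma>_cl[OF av(1)]] e\<sigma>[OF m(1) av(1)] \<sigma>_cl[OF av(1)]
          ahom_zero[OF Y.abelian_group_axioms Y.abelian_group_axioms mod_hom_ahom[OF e_hom[OF m(1)]]]
        by (simp add: a_minus_def)
      then show ?thesis
        unfolding u 0 m(2) e'0[OF av] minus[OF av P.zero_closed Y.a_closed[OF \<sigma>_cl[OF av(1)] av(2)]] neg
        using m(1) av \<sigma>_cl by (simp add: e'S)
    next
      case (Suc m)
      then have m: "m < k"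
        using that(2) by simp
      have vm: "v \<ominus>\<^bsub>Y\<^esub> e m v \<in> carrier Y"
        using av e_cl[OF m] by simp
      \<comment> \<open>\<open>1 - e' (Suc m)\<close> has zero component in the new copy. Such
        elements are fixed by \<open>e' 0\<close>, and by another \<open>e' (Suc l)\<close> through
        the induction hypothesis.\<close>
      have mm: "enc (a, v) \<ominus>\<^bsub>?D\<^esub> e' j (enc (a, v)) = enc (\<zero>\<^bsub>P\<^esub>, v \<ominus>\<^bsub>Y\<^esub> e m v)"
        unfolding Suc e'S[OF m av] minus[OF av av(1) e_cl[OF m av(2)]] using av by simp
      show ?thesis
        unfolding u mm
      proof (cases "i = 0")
        case True
        then show "e' i (enc (\<zero>\<^bsub>P\<^esub>, v \<ominus>\<^bsub>Y\<^esub> e m v)) = enc (\<zero>\<^bsub>P\<^esub>, v \<ominus>\<^bsub>Y\<^esub> e m v)"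
          using vm by (simp add: e'0 \<sigma>0)
      next
        case False
        with small[OF that(1)] that(3) Suc obtain l where l: "l < k" "i = Suc l" "l \<noteq> m"
          by auto
        then show "e' i (enc (\<zero>\<^bsub>P\<^esub>, v \<ominus>\<^bsub>Y\<^esub> e m v)) = enc (\<zero>\<^bsub>P\<^esub>, v \<ominus>\<^bsub>Y\<^esub> e m v)"
          using vm ed[OF l(1) m l(3) av(2)] by (simp add: e'S)
      qed
    qed
  qed
  have 6: "onA G ?Ey ?Ey (e' j) u \<in> iter_sub (Suc k) G D x"
    if G: "fct G" and D: "subfunctor G D" and j: "j < Suc k" and u: "u \<in> carrier (onO G ?Ey)"
    for G :: "(('r, 'v) module \<times> ('v \<Rightarrow> 'v), 'v \<Rightarrow> 'v, ('r, 'v) module, 'v \<Rightarrow> 'v) func" and D j u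
    using small[OF j]
  proof
    assume j0: "j = 0"
    \<comment> \<open>\<open>e' 0\<close> factors through \<eta>, which puts its values under
      \<open>G\<close> into \<open>eta_sub\<close>. For the others, \<open>G\<close> at
      \<open>e' (Suc i)\<close> is \<open>shift G\<close> at \<open>e i\<close>.\<close>
    have "onA G ?Ey ?Ey (e' j) u = onA G ?y ?Ey (inj2 P Y) (onA G ?Ey ?y h u)"
      using fct_cmp[OF G Ey y Ey h(1) eta u] j0 by (simp add: e'_def e0_def)
    also have "\<dots> \<in> eta_sub G D ?y"
      using eta_sub_image[OF G D y fct_closed[OF G Ey y h(1) u]] by simp
    finally have "onA G ?Ey ?Ey (e' j) u \<in> eta_sub G D ((onO Efun ^^ k) x)"
      unfolding yeq .
    then show ?thesis
      using iter_sub_sub[OF fct_shift[OF G] subfunctor_eta_sub[OF G D] x] by simp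
  next
    assume "\<exists>i < k. j = Suc i"
    then obtain i where i: "i < k" "j = Suc i"
      by blast
    then show ?thesis
      using eD[OF fct_shift[OF G] subfunctor_eta_sub[OF G D] i(1)] u by (simp add: e'_def del: Efun_simps)
  qed
  have Eyk: "(onO Efun ^^ Suc k) x = ?Ey"
    using yeq by simp
  have fstE: "fst ?Ey = ?D"
    by simp
  show ?case
    unfolding Eyk fstE
    by (intro exI[of _ e'] exI[of _ \<sigma>'] conjI allI impI ballI) (rule 1 2 3 4 5 6; assumption)+
qed

text \<open>Maps over \<open>A\<close> preserve the kernel of \<open>q\<close>, so the idempotents
  \<open>e 0\<close>, ..., \<open>e d\<close> restrict to the relation module. There
  \<open>polynomial_generated_by_idempotents\<close> applies, with \<open>iter_sub\<close> as the
  subgroup that contains the images.\<close>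

lemma iter_sub_polynomial:
  assumes cev: "cross_effect_vanishes K U \<Phi> (Suc d)" and \<Phi>: "is_functor (Mod_cat K U) (Mod_cat K U) \<Phi>"
    and U: "\<And>X Y. X \<in> U \<Longrightarrow> Y \<subseteq> X \<Longrightarrow> Y \<in> U"
    and F: "fct (func_comp \<Phi> (rel_functor A))" and x: "x \<in> obj Pr"
    and D: "subfunctor (func_comp \<Phi> (rel_functor A)) D"
  shows "iter_sub (Suc d) (func_comp \<Phi> (rel_functor A)) D x =
    carrier (onO (func_comp \<Phi> (rel_functor A)) ((onO Efun ^^ Suc d) x))"
proof -
  let ?F = "func_comp \<Phi> (rel_functor A)"
  obtain Y q where yeq: "(onO Efun ^^ Suc d) x = (Y, q)"
    by (cases "(onO Efun ^^ Suc d) x")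
  have y: "(Y, q) \<in> obj Pr"
    using E_pow_obj[OF x, of "Suc d"] yeq by simp
  have Y: "module K Y" "q \<in> mod_hom K Y A" "carrier Y \<in> U"
    using y by (simp_all add: Pres_obj_iff)
  from idempotents_exist[OF x, of "Suc d", unfolded yeq fst_conv] obtain e
    where e': "\<forall>j < Suc d. e j \<in> arr Pr (Y, q) (Y, q)"
    and ee': "\<forall>j < Suc d. \<forall>v \<in> carrier Y. e j (e j v) = e j v"
    and ed': "\<forall>i < Suc d. \<forall>j < Suc d. i \<noteq> j \<longrightarrow> (\<forall>v \<in> carrier Y. e i (v \<ominus>\<^bsub>Y\<^esub> e j v) = v \<ominus>\<^bsub>Y\<^esub> e j v)"
    and eD': "\<forall>(G :: (('r, 'v) module \<times> ('v \<Rightarrow> 'v), 'v \<Rightarrow> 'v, ('r, 'v) module, 'v \<Rightarrow> 'v) func) D.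
       fct G \<longrightarrow> subfunctor G D \<longrightarrow> (\<forall>j < Suc d. \<forall>u \<in> carrier (onO G (Y, q)). onA G (Y, q) (Y, q) (e j) u \<in> iter_sub (Suc d) G D x)"
    by (elim exE conjE) (rule that; assumption)
  note e = e'[rule_format] and ee = ee'[rule_format] and ed = ed'[rule_format]
    and eD = eD'[rule_format, OF F D]
  have e_hom: "e j \<in> mod_hom K Y Y" "\<And>v. v \<in> carrier Y \<Longrightarrow> q (e j v) = q v" if "j < Suc d" for j
    using e[OF that] unfolding Pres_arr_iff[OF Y(2)] by auto
  note e_cl = mod_hom_closed[OF e_hom(1)]
  define H where "H = {v \<in> carrier Y. q v = \<zero>\<^bsub>A\<^esub>}"
  let ?S = "Y\<lparr>carrier := H\<rparr>"
  interpret Y: module K Y by (rule Y)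
  have S: "module K ?S"
    unfolding H_def by (rule kernel_module[OF Y(1) A_module Y(2)])
  interpret S: module K ?S by (rule S)
  have HY: "H \<subseteq> carrier Y"
    by (auto simp: H_def)
  have eH: "e j v \<in> H" if "j < Suc d" "v \<in> H" for j v
    using that e_cl e_hom(2) by (auto simp: H_def)
  have relS: "onO (rel_functor A) (Y, q) = ?S"
    by (simp add: rel_functor_def H_def a_kernel_def')
  have rele: "onA (rel_functor A) (Y, q) (Y, q) g = restrict g H" for g
    by (simp add: rel_functor_def H_def a_kernel_def')
  let ?e = "\<lambda>j. restrict (e j) H"
  have minus: "v \<ominus>\<^bsub>?S\<^esub> w = v \<ominus>\<^bsub>Y\<^esub> w" if "v \<in> H" "w \<in> H" for v w
    by (rule submodule_minus_eq[OF Y(1) S HY that])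
  have minusH: "v \<ominus>\<^bsub>Y\<^esub> w \<in> H" if "v \<in> H" "w \<in> H" for v w
    using S.minus_closed[of v w] minus[OF that] that by simp
  have grp: "additive_subgroup (iter_sub (Suc d) ?F D x) (onO \<Phi> ?S)"
    using iter_sub_group[OF F D x, of "Suc d"] unfolding yeq by (simp add: func_comp_def relS)
  have Fc: "carrier (onO ?F (Y, q)) = carrier (onO \<Phi> ?S)"
    by (simp add: func_comp_def relS)
  have "a \<in> iter_sub (Suc d) ?F D x" if a: "a \<in> carrier (onO \<Phi> ?S)" for a
  proof (rule polynomial_generated_by_idempotents[OF cev \<Phi> _ S, where e = ?e])
    show "Y' \<in> U" if "X' \<in> U" "Y' \<subseteq> X'" for X' Y'
      by (rule U[OF that])
    show "carrier ?S \<in> U"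
      using U[OF Y(3) HY] by simp
    show "?e j \<in> mod_hom K ?S ?S" if "j \<le> d" for j
      using that eH[of j] HY mod_hom_add[OF e_hom(1)] mod_hom_smult[OF e_hom(1)] S.a_closed S.smult_closed
      by (intro mod_homI) (auto simp: subset_iff)
    show "?e j (?e j v) = ?e j v" if "j \<le> d" "v \<in> carrier ?S" for j v
      using that eH[of j v] ee[of j v] HY by auto
    show "?e i (v \<ominus>\<^bsub>?S\<^esub> ?e j v) = v \<ominus>\<^bsub>?S\<^esub> ?e j v" if "i \<le> d" "j \<le> d" "i \<noteq> j" "v \<in> carrier ?S" for i j v
      using that eH[of j v] ed[of i j v] HY minus[of v "e j v"] minusH[of v "e j v"] by auto
    show "onA \<Phi> ?S ?S (?e j) u \<in> iter_sub (Suc d) ?F D x" if "j \<le> d" "u \<in> carrier (onO \<Phi> ?S)" for j u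
    proof -
      have "onA ?F (Y, q) (Y, q) (e j) u = onA \<Phi> ?S ?S (?e j) u"
        by (simp add: func_comp_def relS rele)
      then show ?thesis
        using eD[of j u] that Fc by simp
    qed
  qed (rule grp, rule a)
  moreover have "iter_sub (Suc d) ?F D x \<subseteq> carrier (onO \<Phi> ?S)"
    by (rule additive_subgroup.a_subset[OF grp])
  ultimately show ?thesis
    unfolding yeq Fc by blast
qed

end

section \<open>Cardinalities, the empty case and the vanishing theorem\<close>

lemma exists_pairing:
  assumes "infinite (UNIV :: 'v set)"
  obtains enc :: "'v \<times> 'v \<Rightarrow> 'v" where "inj enc"
proof -
  obtain f where "bij_betw f ((UNIV :: 'v set) \<times> (UNIV :: 'v set)) (UNIV :: 'v set)"
    using card_of_Times_same_infinite[OF assms] card_of_ordIso[of "(UNIV :: 'v set) \<times> (UNIV :: 'v set)"] by blast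
  then have "inj f"
    by (simp add: bij_betw_def)
  then show thesis
    by (rule that)
qed

lemma small_sets_subset: "X \<in> small_sets T \<Longrightarrow> Y \<subseteq> X \<Longrightarrow> Y \<in> small_sets T"
  unfolding small_sets_def using subset_imp_lepoll lesspoll_trans1 by blast

lemma infinite_times_self_lepoll:
  assumes "infinite W"
  shows "W \<times> W \<lesssim> W"
  using card_of_Times_same_infinite[OF assms] card_of_ordIso[of "W \<times> W" W] eqpoll_imp_lepoll
  unfolding eqpoll_def by blast

text \<open>The product embeds in the square of its larger factor, and the square of a set is finite
  or embeds in that set.\<close>

lemma times_lesspoll_infinite:
  assumes T: "infinite T" and "X \<prec> T" "Y \<prec> T"
  shows "X \<times> Y \<prec> T"
proof -
  have *: "W \<times> W \<prec> T" if "W \<prec> T" for W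
  proof (cases "finite W")
    case True
    then show ?thesis
      using T by (intro finite_lesspoll_infinite) auto
  next
    case False
    then show ?thesis
      using infinite_times_self_lepoll lesspoll_trans1 that by blast
  qed
  have "X \<lesssim> Y \<or> Y \<lesssim> X"
    using ordLeq_total[OF card_of_Well_order card_of_Well_order, of X Y] card_of_ordLeq[of X Y] card_of_ordLeq[of Y X]
    unfolding lepoll_def by blast
  then show ?thesis
  proof
    assume "X \<lesssim> Y"
    then have "X \<times> Y \<lesssim> Y \<times> Y"
      by (rule times_lepoll_mono) simp
    then show ?thesis
      using *[OF assms(3)] lesspoll_trans1 by blast
  next
    assume "Y \<lesssim> X"
    then have "X \<times> Y \<lesssim> X \<times> X"
      by (intro times_lepoll_mono) simp_all
    then show ?thesis
      using *[OF assms(2)] lesspoll_trans1 by blast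
  qed
qed

lemma small_sets_times:
  assumes "infinite T" "X \<in> small_sets T" "Y \<in> small_sets T"
  shows "f ` (X \<times> Y) \<in> small_sets T"
proof -
  have "X \<times> Y \<prec> T"
    using assms unfolding small_sets_def by (intro times_lesspoll_infinite) simp_all
  then show ?thesis
    unfolding small_sets_def using image_lepoll lesspoll_trans1 by blast
qed

text \<open>Over the empty category the only compatible family is \<open>undefined\<close>
  everywhere, so every limit is a point. This settles the case without presentations, so that no
  small free cover of \<open>A\<close> has to be constructed.\<close>

lemma lim_empty:
  assumes "obj C = {}" "s \<in> carrier (lim_module C G)"
  shows "s \<in> lim_map C \<theta> ` carrier (lim_module C H)"
proof
  show "(\<lambda>x. undefined) \<in> carrier (lim_module C H)"
    using assms by (simp add: lim_module_def)
  show "s = lim_map C \<theta> (\<lambda>x. undefined)"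
    using assms by (simp add: lim_module_def lim_map_def restrict_def)
qed

theorem corollary3p8:
  fixes K :: "('r, 'k) ring_scheme"
    and T :: "'v set"
    and \<Phi> :: "(('r, 'v) module, 'v \<Rightarrow> 'v, ('r, 'v) module, 'v \<Rightarrow> 'v) func"
    and A :: "('r, 'v) module"
    and d :: nat
  assumes "cring K"
    and "uncountable T" and "carrier K \<prec> T" and "Pow T \<lesssim> (UNIV :: 'v set)"
    and "is_functor (Mod_cat K (small_sets T)) (Mod_cat K (small_sets T)) \<Phi>"
    and "\<And>Z. Z \<in> obj (Mod_cat K (small_sets T)) \<Longrightarrow> zero_module Z \<Longrightarrow> zero_module (onO \<Phi> Z)"
    and "A \<in> obj (Mod_cat K (small_sets T))"
    and "polynomial_of_degree K (small_sets T) \<Phi> d"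
  shows "\<forall>i > d. \<forall>H. is_higher_lim K (Pres_cat K (small_sets T) A) (func_comp \<Phi> (rel_functor A)) i H
           \<longrightarrow> zero_module H"
proof (intro allI impI)
  fix i H
  let ?C = "Pres_cat K (small_sets T) A" and ?F = "func_comp \<Phi> (rel_functor A)"
  assume "d < i" and "is_higher_lim K ?C ?F i H"
  \<comment> \<open>The degrees above \<open>d\<close> are the successors of the
    \<open>m \<ge> d\<close>.\<close>
  moreover from \<open>d < i\<close> obtain m where im: "i = Suc m" and m: "d \<le> m"
    by (cases i) auto
  ultimately obtain I \<epsilon> \<delta> where res: "injective_resolution K ?C ?F I \<epsilon> \<delta>"
    and H: "H = cochain_cohomology (\<lambda>n. lim_module ?C (I n)) (\<lambda>n. lim_map ?C (\<delta> n)) (Suc m)"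
    unfolding is_higher_lim_def im by blast
  \<comment> \<open>A resolution resolves a functor by definition, so functoriality of the composite
    into all modules is at hand.\<close>
  have F: "is_functor ?C (Mod_cat K UNIV) ?F"
    using res by (simp add: injective_resolution_def)
  have infT: "infinite T"
    using assms(2) by (rule uncountable_infinite)
  show "zero_module H"
    unfolding H
  proof (rule cohomology_zero[OF res])
    fix s assume s: "s \<in> carrier (lim_module ?C (I (Suc m)))"
      and ker: "lim_map ?C (\<delta> (Suc m)) s = \<zero>\<^bsub>lim_module ?C (I (Suc (Suc m)))\<^esub>"
    show "s \<in> lim_map ?C (\<delta> m) ` carrier (lim_module ?C (I m))"
    proof (cases "obj ?C = {}")
      case True
      then show ?thesis
        using s by (rule lim_empty)
    next
      case False
      then obtain P p0 where P: "(P, p0) \<in> obj ?C"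
        by (metis equals0I surj_pair)
      obtain enc :: "'v \<times> 'v \<Rightarrow> 'v" where enc: "inj enc"
        using exists_pairing infinite_super[OF subset_UNIV infT] by blast
      interpret presentation enc K "small_sets T" A P p0
      proof (intro presentation.intro pairing.intro presentation_axioms.intro)
        show "module K A"
          using assms(7) by (simp add: Mod_cat_def)
      qed (use enc P small_sets_times[OF infT] in auto)
      have cev: "cross_effect_vanishes K (small_sets T) \<Phi> (Suc d)"
        using assms(8) by (simp add: polynomial_of_degree_def polynomial_degree_le_def)
      show ?thesis
      proof (rule higher_lim_vanishes[OF res _ m s ker])
        fix x assume x: "x \<in> obj ?C"
        show "iter_sub (Suc d) ?F (\<lambda>x. {\<zero>\<^bsub>onO ?F x\<^esub>}) x = carrier (onO ?F ((onO Efun ^^ Suc d) x))"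
          by (rule iter_sub_polynomial[OF cev assms(5) _ F x zero_subfunctor[OF F]]) (erule (1) small_sets_subset)
      qed
    qed
  qed
qed

end
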